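(* Let $m\ge0$. If $|\theta|<\frac{\pi}{2}$, then the operator $$H_\theta=-i\alpha_1e^{-i\theta/2}\partial_x-\alpha_2e^{i\theta/2}x+m\alpha_3$$ in $L^2(\mathbb{R})^4$ with domain $\mathsf{D}(H_\theta):=\mathcal{D}^4$, where $\mathcal{D}=H^1(\mathbb{R})\cap L^2(\mathbb{R},x^2\,dx)$, is a closed operator with compact resolvent.
   Context: Pauli matrices: $\sigma_1=\begin{pmatrix}0&1\\1&0\end{pmatrix}$, $\sigma_2=\begin{pmatrix}0&-i\\i&0\end{pmatrix}$, $\sigma_3=\begin{pmatrix}1&0\\0&-1\end{pmatrix}$; Dirac matrices $\alpha_k=\begin{pmatrix}0&\sigma_k\\\sigma_k&0\end{pmatrix}$, $k=1,2,3$. $L^2(\mathbb{R})^4=L^2(\mathbb{R};\mathbb{C}^4)$. "Compact resolvent" means that the resolvent set is non-empty and the resolvent is compact at its points. *)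

theory Defs
  imports "HOL-Analysis.Analysis"
begin

section \<open>Complex normed spaces and unbounded operators\<close>

class complex_normed_vector = real_normed_vector +
  fixes scaleC :: "complex \<Rightarrow> 'a \<Rightarrow> 'a" (infixr "*\<^sub>C" 75)
  assumes scaleC_add_right: "a *\<^sub>C (x + y) = a *\<^sub>C x + a *\<^sub>C y"
    and scaleC_add_left: "(a + b) *\<^sub>C x = a *\<^sub>C x + b *\<^sub>C x"
    and scaleC_scaleC: "a *\<^sub>C b *\<^sub>C x = (a * b) *\<^sub>C x"
    and scaleC_of_real: "of_real r *\<^sub>C x = r *\<^sub>R x"
    and norm_scaleC: "norm (a *\<^sub>C x) = norm a * norm x"

instantiation vec :: (complex_normed_vector, finite) complex_normed_vector
begin

definition scaleC_vec :: "complex \<Rightarrow> 'a ^ 'b \<Rightarrow> 'a ^ 'b" where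
  "a *\<^sub>C v = (\<chi> i. a *\<^sub>C v $ i)"

instance
proof
  fix a b :: complex and x y :: "'a ^ 'b" and r :: real
  show "a *\<^sub>C (x + y) = a *\<^sub>C x + a *\<^sub>C y"
    by (simp add: scaleC_vec_def vec_eq_iff scaleC_add_right)
  show "(a + b) *\<^sub>C x = a *\<^sub>C x + b *\<^sub>C x"
    by (simp add: scaleC_vec_def vec_eq_iff scaleC_add_left)
  show "a *\<^sub>C b *\<^sub>C x = (a * b) *\<^sub>C x"
    by (simp add: scaleC_vec_def vec_eq_iff scaleC_scaleC)
  show "of_real r *\<^sub>C x = r *\<^sub>R x"
    by (simp add: scaleC_vec_def vec_eq_iff scaleC_of_real)
  show "norm (a *\<^sub>C x) = norm a * norm x"
    by (simp add: scaleC_vec_def norm_vec_def norm_scaleC L2_set_right_distrib)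
qed

end

text \<open>
  An unbounded operator is given by its domain \<open>D\<close> and a map \<open>T\<close>; the values of \<open>T\<close> outside
  of \<open>D\<close> are irrelevant.
\<close>

definition linear_operator :: "'a::complex_normed_vector set \<Rightarrow> ('a \<Rightarrow> 'a) \<Rightarrow> bool" where
  "linear_operator D T \<longleftrightarrow>
     0 \<in> D \<and>
     (\<forall>u\<in>D. \<forall>v\<in>D. u + v \<in> D \<and> T (u + v) = T u + T v) \<and>
     (\<forall>c. \<forall>u\<in>D. c *\<^sub>C u \<in> D \<and> T (c *\<^sub>C u) = c *\<^sub>C T u)"

definition closed_operator :: "'a::complex_normed_vector set \<Rightarrow> ('a \<Rightarrow> 'a) \<Rightarrow> bool" where
  "closed_operator D T \<longleftrightarrow> linear_operator D T \<and> closed {(u, T u) |u. u \<in> D}"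

definition resolvent :: "'a::complex_normed_vector set \<Rightarrow> ('a \<Rightarrow> 'a) \<Rightarrow> complex \<Rightarrow> 'a \<Rightarrow> 'a" where
  "resolvent D T z = the_inv_into D (\<lambda>u. T u - z *\<^sub>C u)"

definition resolvent_set :: "'a::complex_normed_vector set \<Rightarrow> ('a \<Rightarrow> 'a) \<Rightarrow> complex set" where
  "resolvent_set D T =
     {z. bij_betw (\<lambda>u. T u - z *\<^sub>C u) D UNIV \<and> bounded_linear (resolvent D T z)}"

definition compact_operator :: "('a::complex_normed_vector \<Rightarrow> 'a) \<Rightarrow> bool" where
  "compact_operator R \<longleftrightarrow>
     linear_operator UNIV R \<and> (\<forall>S. bounded S \<longrightarrow> compact (closure (R ` S)))"

definition has_compact_resolvent :: "'a::complex_normed_vector set \<Rightarrow> ('a \<Rightarrow> 'a) \<Rightarrow> bool" where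
  "has_compact_resolvent D T \<longleftrightarrow>
     resolvent_set D T \<noteq> {} \<and> (\<forall>z\<in>resolvent_set D T. compact_operator (resolvent D T z))"


section \<open>The Hilbert space of square-integrable functions on the real line\<close>

definition sq_integrable :: "(real \<Rightarrow> complex) \<Rightarrow> bool" where
  "sq_integrable f \<longleftrightarrow>
     f \<in> borel_measurable lborel \<and> integrable lborel (\<lambda>x. (norm (f x))\<^sup>2)"

lemma sq_integrable_zero: "sq_integrable (\<lambda>_. 0)"
  by (simp add: sq_integrable_def)

lemma sq_integrable_mult_left:
  assumes "sq_integrable f" shows "sq_integrable (\<lambda>x. c * f x)"
  using assms by (auto simp: sq_integrable_def norm_mult power_mult_distrib)

lemma sq_integrable_add:
  assumes f: "sq_integrable f" and g: "sq_integrable g"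
  shows "sq_integrable (\<lambda>x. f x + g x)"
proof -
  have [measurable]: "f \<in> borel_measurable lborel" "g \<in> borel_measurable lborel"
    using f g by (simp_all add: sq_integrable_def)
  have "integrable lborel (\<lambda>x. (norm (f x + g x))\<^sup>2)"
  proof (rule Bochner_Integration.integrable_bound)
    show "integrable lborel (\<lambda>x. 2 * (norm (f x))\<^sup>2 + 2 * (norm (g x))\<^sup>2)"
      using f g by (simp add: sq_integrable_def)
    have "(norm (a + b))\<^sup>2 \<le> 2 * (norm a)\<^sup>2 + 2 * (norm b)\<^sup>2" for a b :: complex
    proof -
      have "(norm (a + b))\<^sup>2 \<le> (norm a + norm b)\<^sup>2"
        by (intro power_mono norm_triangle_ineq) simp
      also have "\<dots> \<le> 2 * (norm a)\<^sup>2 + 2 * (norm b)\<^sup>2"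
        using zero_le_power2[of "norm a - norm b"] by (simp add: power2_eq_square algebra_simps)
      finally show ?thesis .
    qed
    then show "AE x in lborel. norm ((norm (f x + g x))\<^sup>2)
        \<le> norm (2 * (norm (f x))\<^sup>2 + 2 * (norm (g x))\<^sup>2)"
      by simp
  qed measurable
  then show ?thesis by (simp add: sq_integrable_def)
qed

lemma integrable_inner_sq_integrable:
  assumes f: "sq_integrable f" and g: "sq_integrable g"
  shows "integrable lborel (\<lambda>x. f x \<bullet> g x)"
proof (rule Bochner_Integration.integrable_bound)
  have [measurable]: "f \<in> borel_measurable lborel" "g \<in> borel_measurable lborel"
    using f g by (simp_all add: sq_integrable_def)
  show "(\<lambda>x. f x \<bullet> g x) \<in> borel_measurable lborel" by measurable
  show "integrable lborel (\<lambda>x. (norm (f x))\<^sup>2 + (norm (g x))\<^sup>2)"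
    using f g by (simp add: sq_integrable_def)
  have "\<bar>a \<bullet> b\<bar> \<le> (norm a)\<^sup>2 + (norm b)\<^sup>2" for a b :: complex
  proof -
    have "\<bar>a \<bullet> b\<bar> \<le> norm a * norm b" by (rule Cauchy_Schwarz_ineq2)
    also have "\<dots> \<le> 2 * (norm a * norm b)" by simp
    also have "\<dots> \<le> (norm a)\<^sup>2 + (norm b)\<^sup>2"
      using zero_le_power2[of "norm a - norm b"] by (simp add: power2_eq_square algebra_simps)
    finally show ?thesis .
  qed
  then show "AE x in lborel. norm (f x \<bullet> g x) \<le> norm ((norm (f x))\<^sup>2 + (norm (g x))\<^sup>2)"
    by simp
qed

definition L2_rel :: "(real \<Rightarrow> complex) \<Rightarrow> (real \<Rightarrow> complex) \<Rightarrow> bool" where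
  "L2_rel f g \<longleftrightarrow> sq_integrable f \<and> sq_integrable g \<and> (AE x in lborel. f x = g x)"

quotient_type L2 = "real \<Rightarrow> complex" / partial: L2_rel
  morphisms rep_L2 abs_L2
proof (rule part_equivpI)
  show "\<exists>f. L2_rel f f"
    using sq_integrable_zero by (auto simp: L2_rel_def)
  show "symp L2_rel"
    by (rule sympI) (auto simp: L2_rel_def)
  show "transp L2_rel"
  proof (rule transpI)
    fix f g h assume "L2_rel f g" "L2_rel g h"
    then show "L2_rel f h" unfolding L2_rel_def by (auto elim: AE_mp)
  qed
qed

instantiation L2 :: real_inner
begin

lift_definition zero_L2 :: L2 is "\<lambda>_. 0"
  by (simp add: L2_rel_def sq_integrable_zero)

lift_definition plus_L2 :: "L2 \<Rightarrow> L2 \<Rightarrow> L2" is "\<lambda>f g x. f x + g x"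
  unfolding L2_rel_def by (auto intro: sq_integrable_add elim: AE_mp)

lift_definition uminus_L2 :: "L2 \<Rightarrow> L2" is "\<lambda>f x. - f x"
  unfolding L2_rel_def by (auto simp: sq_integrable_def elim: AE_mp)

definition minus_L2 :: "L2 \<Rightarrow> L2 \<Rightarrow> L2" where
  "minus_L2 f g = f + - g"

lift_definition scaleR_L2 :: "real \<Rightarrow> L2 \<Rightarrow> L2" is "\<lambda>r f x. of_real r * f x"
  unfolding L2_rel_def by (auto intro: sq_integrable_mult_left elim: AE_mp)

lift_definition inner_L2 :: "L2 \<Rightarrow> L2 \<Rightarrow> real" is "\<lambda>f g. \<integral>x. f x \<bullet> g x \<partial>lborel"
proof -
  fix f f' g g' assume fg: "L2_rel f f'" "L2_rel g g'"
  then have [measurable]: "f \<in> borel_measurable lborel" "f' \<in> borel_measurable lborel"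
      "g \<in> borel_measurable lborel" "g' \<in> borel_measurable lborel"
    by (simp_all add: L2_rel_def sq_integrable_def)
  show "(\<integral>x. f x \<bullet> g x \<partial>lborel) = (\<integral>x. f' x \<bullet> g' x \<partial>lborel)"
    by (rule integral_cong_AE) (use fg in \<open>auto simp: L2_rel_def elim: AE_mp\<close>)
qed

definition norm_L2 :: "L2 \<Rightarrow> real" where "norm_L2 f = sqrt (f \<bullet> f)"
definition dist_L2 :: "L2 \<Rightarrow> L2 \<Rightarrow> real" where "dist_L2 f g = norm (f - g)"
definition sgn_L2 :: "L2 \<Rightarrow> L2" where "sgn_L2 f = inverse (norm f) *\<^sub>R f"
definition uniformity_L2 :: "(L2 \<times> L2) filter" where
  "uniformity_L2 = (INF e\<in>{0<..}. principal {(f, g). dist f g < e})"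
definition open_L2 :: "L2 set \<Rightarrow> bool" where
  "open_L2 U \<longleftrightarrow> (\<forall>f\<in>U. \<forall>\<^sub>F (f', g) in uniformity. f' = f \<longrightarrow> g \<in> U)"

instance
proof
  fix f g h :: L2 and r s :: real and U :: "L2 set"
  show "f + g + h = f + (g + h)"
    by transfer (auto simp: L2_rel_def algebra_simps intro!: sq_integrable_add)
  show "f + g = g + f"
    by transfer (auto simp: L2_rel_def algebra_simps intro!: sq_integrable_add)
  show "0 + f = f" by transfer (auto simp: L2_rel_def)
  show "- f + f = 0" by transfer (auto simp: L2_rel_def sq_integrable_zero)
  show "f - g = f + - g" by (rule minus_L2_def)
  show "r *\<^sub>R (f + g) = r *\<^sub>R f + r *\<^sub>R g"
    by transfer (auto simp: L2_rel_def distrib_left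
        intro!: sq_integrable_add sq_integrable_mult_left)
  show "(r + s) *\<^sub>R f = r *\<^sub>R f + s *\<^sub>R f"
    by transfer (auto simp: L2_rel_def distrib_right
        intro!: sq_integrable_add sq_integrable_mult_left)
  show "r *\<^sub>R s *\<^sub>R f = (r * s) *\<^sub>R f"
    by transfer (auto simp: L2_rel_def mult.assoc intro!: sq_integrable_mult_left)
  show "1 *\<^sub>R f = f" by transfer (auto simp: L2_rel_def)
  show "dist f g = norm (f - g)" by (rule dist_L2_def)
  show "sgn f = inverse (norm f) *\<^sub>R f" by (rule sgn_L2_def)
  show "uniformity = (INF e\<in>{0<..}. principal {(f, g :: L2). dist f g < e})"
    by (rule uniformity_L2_def)
  show "open U = (\<forall>f\<in>U. \<forall>\<^sub>F (f', g) in uniformity. f' = f \<longrightarrow> g \<in> U)"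
    by (rule open_L2_def)
  show "f \<bullet> g = g \<bullet> f" by transfer (simp add: inner_commute)
  show "(f + g) \<bullet> h = f \<bullet> h + g \<bullet> h"
    by transfer (simp add: L2_rel_def inner_add_left integrable_inner_sq_integrable)
  show "r *\<^sub>R f \<bullet> g = r * (f \<bullet> g)"
    by transfer (simp flip: scaleR_conv_of_real)
  show "0 \<le> f \<bullet> f" by transfer simp
  show "(f \<bullet> f = 0) = (f = 0)"
  proof transfer
    fix f assume "L2_rel f f"
    then have f: "sq_integrable f" by (simp add: L2_rel_def)
    have "(\<integral>x. f x \<bullet> f x \<partial>lborel) = 0 \<longleftrightarrow> (AE x in lborel. f x \<bullet> f x = 0)"
      by (rule integral_nonneg_eq_0_iff_AE) (simp_all add: integrable_inner_sq_integrable f)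
    then show "(\<integral>x. f x \<bullet> f x \<partial>lborel) = 0 \<longleftrightarrow> L2_rel f (\<lambda>_. 0)"
      by (simp add: L2_rel_def f sq_integrable_zero)
  qed
  show "norm f = sqrt (f \<bullet> f)" by (rule norm_L2_def)
qed

end

instantiation L2 :: complex_normed_vector
begin

lift_definition scaleC_L2 :: "complex \<Rightarrow> L2 \<Rightarrow> L2" is "\<lambda>c f x. c * f x"
  unfolding L2_rel_def by (auto intro: sq_integrable_mult_left elim: AE_mp)

instance
proof
  fix f g :: L2 and a b :: complex and r :: real
  show "a *\<^sub>C (f + g) = a *\<^sub>C f + a *\<^sub>C g"
    by transfer (auto simp: L2_rel_def distrib_left
        intro!: sq_integrable_add sq_integrable_mult_left)
  show "(a + b) *\<^sub>C f = a *\<^sub>C f + b *\<^sub>C f"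
    by transfer (auto simp: L2_rel_def distrib_right
        intro!: sq_integrable_add sq_integrable_mult_left)
  show "a *\<^sub>C b *\<^sub>C f = (a * b) *\<^sub>C f"
    by transfer (auto simp: L2_rel_def mult.assoc intro!: sq_integrable_mult_left)
  show "of_real r *\<^sub>C f = r *\<^sub>R f"
    by transfer (auto simp: L2_rel_def intro!: sq_integrable_mult_left)
  have "(a *\<^sub>C f) \<bullet> (a *\<^sub>C f) = (norm a)\<^sup>2 * (f \<bullet> f)"
    by transfer (simp add: dot_square_norm norm_mult power_mult_distrib)
  then show "norm (a *\<^sub>C f) = norm a * norm f"
    by (simp add: norm_L2_def real_sqrt_mult)
qed

end


section \<open>Weak derivative, position operator and the domain\<close>

definition test_function :: "(real \<Rightarrow> complex) \<Rightarrow> bool" where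
  "test_function \<phi> \<longleftrightarrow>
     (\<forall>n x. ((\<lambda>f y. vector_derivative f (at y)) ^^ n) \<phi> differentiable (at x)) \<and>
     compact (closure {x. \<phi> x \<noteq> 0})"

text \<open>
  The operators below are totalised: \<open>weak_derivative f\<close> is meaningful on \<open>H1\<close> only, and
  \<open>position f\<close> is the class of \<open>x f(x)\<close> on \<open>L2_weighted\<close> and \<open>0\<close> elsewhere.
\<close>

lift_definition has_weak_derivative :: "L2 \<Rightarrow> L2 \<Rightarrow> bool" is
  "\<lambda>f g. \<forall>\<phi>. test_function \<phi> \<longrightarrow>
     (\<integral>x. f x * vector_derivative \<phi> (at x) \<partial>lborel) = - (\<integral>x. g x * \<phi> x \<partial>lborel)"
proof -
  have eq: "(\<integral>x. f x * \<psi> x \<partial>lborel) = (\<integral>x. f' x * \<psi> x \<partial>lborel)"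
    if "L2_rel f f'" "\<psi> \<in> borel_measurable lborel" for f f' \<psi> :: "real \<Rightarrow> complex"
  proof (rule integral_cong_AE)
    show "AE x in lborel. f x * \<psi> x = f' x * \<psi> x"
      using that by (auto simp: L2_rel_def elim: AE_mp)
  qed (use that in \<open>auto simp: L2_rel_def sq_integrable_def\<close>)
  have meas: "\<phi> \<in> borel_measurable lborel"
      "(\<lambda>x. vector_derivative \<phi> (at x)) \<in> borel_measurable lborel"
    if "test_function \<phi>" for \<phi>
  proof -
    have "((\<lambda>f y. vector_derivative f (at y)) ^^ n) \<phi> \<in> borel_measurable lborel" for n
    proof -
      have "continuous_on UNIV (((\<lambda>f y. vector_derivative f (at y)) ^^ n) \<phi>)"
        using that unfolding test_function_def
        by (intro continuous_at_imp_continuous_on ballI differentiable_imp_continuous_within) auto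
      then show ?thesis by (simp add: borel_measurable_continuous_onI)
    qed
    from this[of 0] this[of 1] show "\<phi> \<in> borel_measurable lborel"
      "(\<lambda>x. vector_derivative \<phi> (at x)) \<in> borel_measurable lborel" by simp_all
  qed
  fix f f' g g' assume fg: "L2_rel f f'" "L2_rel g g'"
  have "((\<integral>x. f x * vector_derivative \<phi> (at x) \<partial>lborel) = - (\<integral>x. g x * \<phi> x \<partial>lborel)) =
      ((\<integral>x. f' x * vector_derivative \<phi> (at x) \<partial>lborel) = - (\<integral>x. g' x * \<phi> x \<partial>lborel))"
    if "test_function \<phi>" for \<phi>
    by (simp only: eq[OF fg(1) meas(2)[OF that]] eq[OF fg(2) meas(1)[OF that]])
  then show "(\<forall>\<phi>. test_function \<phi> \<longrightarrow>
       (\<integral>x. f x * vector_derivative \<phi> (at x) \<partial>lborel) = - (\<integral>x. g x * \<phi> x \<partial>lborel)) =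
     (\<forall>\<phi>. test_function \<phi> \<longrightarrow>
       (\<integral>x. f' x * vector_derivative \<phi> (at x) \<partial>lborel) = - (\<integral>x. g' x * \<phi> x \<partial>lborel))"
    by blast
qed

definition H1 :: "L2 set" where
  "H1 = {f. \<exists>g. has_weak_derivative f g}"

definition weak_derivative :: "L2 \<Rightarrow> L2" where
  "weak_derivative f = (THE g. has_weak_derivative f g)"

lemma sq_integrable_position_cong:
  assumes "L2_rel f g"
  shows "sq_integrable (\<lambda>x. of_real x * f x) \<longleftrightarrow> sq_integrable (\<lambda>x. of_real x * g x)"
proof -
  have [measurable]: "f \<in> borel_measurable lborel" "g \<in> borel_measurable lborel"
    and "AE x in lborel. f x = g x"
    using assms by (simp_all add: L2_rel_def sq_integrable_def)
  then have "integrable lborel (\<lambda>x. (norm (of_real x * f x))\<^sup>2) \<longleftrightarrow>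
      integrable lborel (\<lambda>x. (norm (of_real x * g x))\<^sup>2)"
    by (intro integrable_cong_AE) (auto elim: AE_mp)
  then show ?thesis by (simp add: sq_integrable_def)
qed

lift_definition in_L2_weighted :: "L2 \<Rightarrow> bool" is
  "\<lambda>f. sq_integrable (\<lambda>x. of_real x * f x)"
  by (rule sq_integrable_position_cong)

definition L2_weighted :: "L2 set" where
  "L2_weighted = {f. in_L2_weighted f}"

lift_definition position :: "L2 \<Rightarrow> L2" is
  "\<lambda>f. if sq_integrable (\<lambda>x. of_real x * f x) then (\<lambda>x. of_real x * f x) else (\<lambda>_. 0)"
proof -
  fix f g assume fg: "L2_rel f g"
  show "L2_rel (if sq_integrable (\<lambda>x. of_real x * f x) then \<lambda>x. of_real x * f x else (\<lambda>_. 0))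
      (if sq_integrable (\<lambda>x. of_real x * g x) then \<lambda>x. of_real x * g x else (\<lambda>_. 0))"
  proof (cases "sq_integrable (\<lambda>x. of_real x * f x)")
    case True
    have "AE x in lborel. of_real x * f x = of_real x * g x"
      using fg by (auto simp: L2_rel_def elim: AE_mp)
    with True show ?thesis
      using sq_integrable_position_cong[OF fg] by (simp add: L2_rel_def)
  next
    case False
    then show ?thesis
      using sq_integrable_position_cong[OF fg] by (simp add: L2_rel_def sq_integrable_zero)
  qed
qed

definition domD :: "L2 set" where
  "domD = H1 \<inter> L2_weighted"


section \<open>The operator\<close>

definition sigma1 :: "complex ^ 2 ^ 2" where
  "sigma1 = vector [vector [0, 1], vector [1, 0]]"

definition sigma2 :: "complex ^ 2 ^ 2" where
  "sigma2 = vector [vector [0, - \<i>], vector [\<i>, 0]]"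

definition sigma3 :: "complex ^ 2 ^ 2" where
  "sigma3 = vector [vector [1, 0], vector [0, - 1]]"

definition dirac_block :: "complex ^ 2 ^ 2 \<Rightarrow> complex ^ 4 ^ 4" where
  "dirac_block S = vector
     [vector [0, 0, S $ 1 $ 1, S $ 1 $ 2],
      vector [0, 0, S $ 2 $ 1, S $ 2 $ 2],
      vector [S $ 1 $ 1, S $ 1 $ 2, 0, 0],
      vector [S $ 2 $ 1, S $ 2 $ 2, 0, 0]]"

definition alpha1 :: "complex ^ 4 ^ 4" where "alpha1 = dirac_block sigma1"
definition alpha2 :: "complex ^ 4 ^ 4" where "alpha2 = dirac_block sigma2"
definition alpha3 :: "complex ^ 4 ^ 4" where "alpha3 = dirac_block sigma3"

text \<open>
  \<open>L\<^sup>2(\<real>)\<^sup>4\<close> is the type \<open>L2 ^ 4\<close>, whose library norm is the Euclidean norm of the componentwise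
  norms, that is, the norm of \<open>L\<^sup>2(\<real>; \<complex>\<^sup>4)\<close>.
\<close>

definition mat_apply :: "complex ^ 'n ^ 'm \<Rightarrow> L2 ^ 'n \<Rightarrow> L2 ^ 'm" (infixr "\<odot>" 75) where
  "A \<odot> u = (\<chi> i. \<Sum>j\<in>UNIV. A $ i $ j *\<^sub>C u $ j)"

definition dom_H :: "(L2 ^ 4) set" where
  "dom_H = {u. \<forall>k. u $ k \<in> domD}"

definition op_H :: "real \<Rightarrow> real \<Rightarrow> L2 ^ 4 \<Rightarrow> L2 ^ 4" where
  "op_H m \<theta> u =
     (- \<i> * exp (- \<i> * of_real \<theta> / 2)) *\<^sub>C (alpha1 \<odot> (\<chi> k. weak_derivative (u $ k)))
     - exp (\<i> * of_real \<theta> / 2) *\<^sub>C (alpha2 \<odot> (\<chi> k. position (u $ k)))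
     + of_real m *\<^sub>C (alpha3 \<odot> u)"

end

theory Submission
  imports Defs
begin

text \<open>
  Since \<open>H\<^sub>\<theta>\<close> and \<open>H\<^sub>-\<^sub>\<theta>\<close> are formally adjoint, all cross terms cancel, for real \<open>\<lambda>\<close>, in the real
  part of the inner product of \<open>(H\<^sub>\<theta> - i\<lambda>)u\<close> and \<open>(H\<^sub>-\<^sub>\<theta> - i\<lambda>)u\<close>. What remains is
  \<open>cos \<theta> (\<parallel>u'\<parallel>\<^sup>2 + \<parallel>xu\<parallel>\<^sup>2) + (m\<^sup>2 + \<lambda>\<^sup>2) \<parallel>u\<parallel>\<^sup>2\<close>, up to terms \<open>\<plusminus>\<parallel>u\<^sub>k\<parallel>\<^sup>2\<close>
  coming from the commutator of the derivative with \<open>x\<close>. For \<open>\<bar>\<theta>\<bar> < \<pi>/2\<close> and \<open>\<lambda>\<^sup>2 \<ge> 2\<close> this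
  bounds the graph norm of \<open>u\<close> by a multiple of \<open>\<parallel>(H\<^sub>\<theta> - i\<lambda>)u\<parallel>\<close>, so \<open>H\<^sub>\<theta>\<close> is closed and
  \<open>H\<^sub>\<theta> - i\<lambda>\<close> is injective with closed range. If \<open>w\<close> is orthogonal to that range, then
  \<open>w / (1 + c\<^sup>2x\<^sup>2)\<close> lies in the domain and \<open>H\<^sub>-\<^sub>\<theta> + i\<lambda>\<close> maps it to a commutator of norm
  \<open>O(c)\<close>; the estimate for \<open>-\<theta>\<close> and \<open>c \<rightarrow> 0\<close> give \<open>w = 0\<close>. Thus \<open>i\<lambda>\<close> is in the resolvent
  set. Every resolvent maps bounded sets to sets bounded in the graph norm, and these are totally
  bounded in \<open>L\<^sup>2\<close>: the weight makes the tails uniformly small, and on a compact interval the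
  functions are uniformly Hoelder continuous. Weak derivatives are handled through absolutely
  continuous representatives.
\<close>

section \<open>Complex scalar multiplication\<close>

text \<open>The operator is of first order and, for \<theta> \<noteq> 0, not symmetric, so neither
  coercivity nor symmetry of \<open>op_H\<close> itself yields an estimate; pairing with the
  opposite angle amounts to testing a second-order operator, and there the two coefficients become
  phases with real part \<open>cos \<theta>\<close>. The number 2 in the bound on the squared shift
  pays once for the commutator terms and once for \<open>cos \<theta>\<close> times the squared norm
  of \<open>u\<close>. The obstacle is the range. An element \<open>w\<close> orthogonal to it
  solves the adjoint equation only weakly, which controls a combination of \<open>w'\<close> and
  \<open>x w\<close> but neither of them alone, so the estimate cannot be applied to
  \<open>w\<close>. A factor decaying at least like 1/x makes the weighted term square-integrable by
  itself, and the equation then delivers the derivative; the factor must also have a uniformly small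
  derivative, which the rational one has. The inner product of \<open>L2\<close> is real-valued, so
  identities are proved for real parts, and imaginary parts are recovered by inserting complex
  factors.\<close>

lemma scaleC_zero_left [simp]: "0 *\<^sub>C u = 0" and scaleC_one [simp]: "1 *\<^sub>C u = u"
  and scaleC_minus_left: "(- a) *\<^sub>C u = - (a *\<^sub>C u)" for u :: "'a::complex_normed_vector"
proof -
  show "0 *\<^sub>C u = 0" using scaleC_of_real[of 0 u] by simp
  show "1 *\<^sub>C u = u" using scaleC_of_real[of 1 u] by simp
  show "(- a) *\<^sub>C u = - (a *\<^sub>C u)"
    using scaleC_scaleC[of "of_real (-1)" a u] unfolding scaleC_of_real by simp
qed

lemma bounded_linear_scaleC: "bounded_linear ((*\<^sub>C) c :: 'a::complex_normed_vector \<Rightarrow> 'a)"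
  by (rule bounded_linear_intro[of _ "norm c"])
    (simp_all add: scaleC_add_right norm_scaleC scaleC_scaleC mult.commute flip: scaleC_of_real)

lemma scaleC_zero_right [simp]: "c *\<^sub>C 0 = 0" and scaleC_minus_right: "c *\<^sub>C (- u) = - (c *\<^sub>C u)"
  and scaleC_diff_right: "c *\<^sub>C (u - v) = c *\<^sub>C u - c *\<^sub>C v" for u v :: "'a::complex_normed_vector"
  using linear_0 linear_neg linear_diff bounded_linear.linear[OF bounded_linear_scaleC] by blast+

lemmas tendsto_scaleC = bounded_linear.tendsto[OF bounded_linear_scaleC]

section \<open>Calculus of classes of square-integrable functions\<close>

lemma sq_integrable_measurable: "sq_integrable f \<Longrightarrow> f \<in> borel_measurable borel"
  by (simp add: sq_integrable_def)

lemma L2_rel_refl_iff: "L2_rel f f \<longleftrightarrow> sq_integrable f"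
  by (simp add: L2_rel_def)

lemma abs_rep_L2 [simp]: "abs_L2 (rep_L2 u) = u"
  using Quotient_abs_rep[OF Quotient_L2] .

lemma sq_integrable_rep_L2 [simp]: "sq_integrable (rep_L2 u)"
  using Quotient_rep_reflp[OF Quotient_L2] by (simp add: L2_rel_refl_iff)

lemma abs_L2_eq_iff:
  assumes "sq_integrable f" "sq_integrable g"
  shows "abs_L2 f = abs_L2 g \<longleftrightarrow> (AE x in lborel. f x = g x)"
  using Quotient_rel[OF Quotient_L2, of f g] assms by (auto simp: L2_rel_def)

lemma abs_L2_eqI:
  assumes "sq_integrable f" "sq_integrable g" "AE x in lborel. f x = g x"
  shows "abs_L2 f = abs_L2 g"
  using assms by (simp add: abs_L2_eq_iff)

lemma rep_abs_L2:
  assumes "sq_integrable f"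
  shows "AE x in lborel. rep_L2 (abs_L2 f) x = f x"
  using assms abs_L2_eq_iff[of "rep_L2 (abs_L2 f)" f] by simp

lemma L2_cases:
  obtains f where "sq_integrable f" "u = abs_L2 f"
  by (metis abs_rep_L2 sq_integrable_rep_L2)

lemma sq_integrable_uminus: "sq_integrable f \<Longrightarrow> sq_integrable (\<lambda>x. - f x)"
  using sq_integrable_mult_left[of f "-1"] by simp

lemma sq_integrable_diff:
  "sq_integrable f \<Longrightarrow> sq_integrable g \<Longrightarrow> sq_integrable (\<lambda>x. f x - g x)"
  using sq_integrable_add[of f "\<lambda>x. - g x"] by (simp add: sq_integrable_uminus)

lemma zero_eq_abs_L2: "0 = abs_L2 (\<lambda>_. 0)"
  by (simp add: zero_L2_def)

lemma plus_abs_L2: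
  "sq_integrable f \<Longrightarrow> sq_integrable g \<Longrightarrow> abs_L2 f + abs_L2 g = abs_L2 (\<lambda>x. f x + g x)"
  by (rule plus_L2.abs_eq) (simp_all add: L2_rel_refl_iff)

lemma uminus_abs_L2: "sq_integrable f \<Longrightarrow> - abs_L2 f = abs_L2 (\<lambda>x. - f x)"
  by (rule uminus_L2.abs_eq) (simp_all add: L2_rel_refl_iff)

lemma diff_abs_L2:
  "sq_integrable f \<Longrightarrow> sq_integrable g \<Longrightarrow> abs_L2 f - abs_L2 g = abs_L2 (\<lambda>x. f x - g x)"
  by (simp add: minus_L2_def uminus_abs_L2 plus_abs_L2 sq_integrable_uminus)

lemma scaleC_abs_L2: "sq_integrable f \<Longrightarrow> c *\<^sub>C abs_L2 f = abs_L2 (\<lambda>x. c * f x)"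
  by (rule scaleC_L2.abs_eq) (simp_all add: L2_rel_refl_iff)

lemma inner_abs_L2:
  "sq_integrable f \<Longrightarrow> sq_integrable g \<Longrightarrow> abs_L2 f \<bullet> abs_L2 g = (\<integral>x. f x \<bullet> g x \<partial>lborel)"
  by (rule inner_L2.abs_eq) (simp_all add: L2_rel_refl_iff)

lemma norm_abs_L2: "sq_integrable f \<Longrightarrow> (norm (abs_L2 f))\<^sup>2 = (\<integral>x. (norm (f x))\<^sup>2 \<partial>lborel)"
  by (simp only: power2_norm_eq_inner inner_abs_L2)

lemma sq_integrable_cong_AE:
  assumes "sq_integrable f" "AE x in lborel. f x = g x" "g \<in> borel_measurable borel"
  shows "sq_integrable g"
proof -
  have [measurable]: "f \<in> borel_measurable borel" "g \<in> borel_measurable borel"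
    using assms by (simp_all add: sq_integrable_def)
  have "integrable lborel (\<lambda>x. (norm (g x))\<^sup>2) \<longleftrightarrow> integrable lborel (\<lambda>x. (norm (f x))\<^sup>2)"
    by (rule integrable_cong_AE) (use assms(2) in auto)
  with assms show ?thesis by (simp add: sq_integrable_def)
qed

lemma integrable_mult_sq_integrable:
  assumes f: "sq_integrable f" and g: "sq_integrable g"
  shows "integrable lborel (\<lambda>x. f x * g x)"
proof (rule Bochner_Integration.integrable_bound)
  have [measurable]: "f \<in> borel_measurable borel" "g \<in> borel_measurable borel"
    using f g by (simp_all add: sq_integrable_def)
  show "(\<lambda>x. f x * g x) \<in> borel_measurable lborel" by measurable
  show "integrable lborel (\<lambda>x. (norm (f x))\<^sup>2 + (norm (g x))\<^sup>2)"
    using f g by (simp add: sq_integrable_def)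
  have "norm (a * b) \<le> (norm a)\<^sup>2 + (norm b)\<^sup>2" for a b :: complex
  proof -
    have "norm (a * b) \<le> 2 * (norm a * norm b)" by (simp add: norm_mult)
    also have "\<dots> \<le> (norm a)\<^sup>2 + (norm b)\<^sup>2"
      using zero_le_power2[of "norm a - norm b"] by (simp add: power2_eq_square algebra_simps)
    finally show ?thesis .
  qed
  then show "AE x in lborel. norm (f x * g x) \<le> norm ((norm (f x))\<^sup>2 + (norm (g x))\<^sup>2)"
    by simp
qed

lemma sq_integrable_cnj: "sq_integrable f \<Longrightarrow> sq_integrable (\<lambda>x. cnj (f x))"
  by (auto simp: sq_integrable_def intro: borel_measurable_continuous_on[of cnj] continuous_intros)

lemma inner_complex_Re: "a \<bullet> b = Re (a * cnj b)" for a b :: complex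
  by (simp add: inner_complex_def)

text \<open>Links the real inner product to the Hermitian one, so that complex integration by parts
  can be used on it.\<close>

lemma inner_abs_L2_Re:
  assumes "sq_integrable f" "sq_integrable g"
  shows "abs_L2 f \<bullet> abs_L2 g = Re (\<integral>x. f x * cnj (g x) \<partial>lborel)"
proof -
  have "(\<integral>x. f x \<bullet> g x \<partial>lborel) = (\<integral>x. Re (f x * cnj (g x)) \<partial>lborel)"
    by (simp only: inner_complex_Re)
  also have "\<dots> = Re (\<integral>x. f x * cnj (g x) \<partial>lborel)"
    by (intro integral_Re integrable_mult_sq_integrable sq_integrable_cnj assms)
  finally show ?thesis using assms by (simp add: inner_abs_L2)
qed

lemma sq_integrable_mult_bounded:
  assumes f: "sq_integrable f" and b: "b \<in> borel_measurable borel" and C: "\<And>x. norm (b x) \<le> C"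
  shows "sq_integrable (\<lambda>x. b x * f x)"
    and "(\<integral>x. (norm (b x * f x))\<^sup>2 \<partial>lborel) \<le> C\<^sup>2 * (\<integral>x. (norm (f x))\<^sup>2 \<partial>lborel)"
proof -
  have [measurable]: "f \<in> borel_measurable borel" "b \<in> borel_measurable borel"
    using f b by (simp_all add: sq_integrable_def)
  have bd: "(norm (b x * f x))\<^sup>2 \<le> C\<^sup>2 * (norm (f x))\<^sup>2" for x
    using C[of x] by (simp add: norm_mult power_mult_distrib mult_right_mono power_mono)
  have i: "integrable lborel (\<lambda>x. C\<^sup>2 * (norm (f x))\<^sup>2)"
    using f by (simp add: sq_integrable_def)
  have "integrable lborel (\<lambda>x. (norm (b x * f x))\<^sup>2)"
    by (rule Bochner_Integration.integrable_bound[OF i]) (use bd in auto)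
  then show "sq_integrable (\<lambda>x. b x * f x)" by (simp add: sq_integrable_def)
  show "(\<integral>x. (norm (b x * f x))\<^sup>2 \<partial>lborel) \<le> C\<^sup>2 * (\<integral>x. (norm (f x))\<^sup>2 \<partial>lborel)"
    using integral_mono[OF \<open>integrable lborel (\<lambda>x. (norm (b x * f x))\<^sup>2)\<close> i bd] by simp
qed

lemma norm_abs_L2_mult_bounded:
  assumes f: "sq_integrable f" and b: "b \<in> borel_measurable borel" and C: "\<And>x. norm (b x) \<le> C"
  shows "norm (abs_L2 (\<lambda>x. b x * f x)) \<le> C * norm (abs_L2 f)"
proof (rule power2_le_imp_le)
  have "0 \<le> C" using C[of 0] norm_ge_zero order_trans by blast
  then show "0 \<le> C * norm (abs_L2 f)" by simp
  show "(norm (abs_L2 (\<lambda>x. b x * f x)))\<^sup>2 \<le> (C * norm (abs_L2 f))\<^sup>2"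
    using sq_integrable_mult_bounded[OF assms] f by (simp add: norm_abs_L2 power_mult_distrib)
qed

section \<open>Completeness\<close>

text \<open>The pointwise half of the Riesz-Fischer theorem: the increments of the representatives
  are absolutely summable almost everywhere, hence the telescoping sums converge there.\<close>

lemma L2_fast_Cauchy_AE_convergent:
  fixes X :: "nat \<Rightarrow> L2"
  assumes step: "\<And>k. norm (X (Suc k) - X k) \<le> (1/2) ^ k"
  shows "\<exists>f. f \<in> borel_measurable borel \<and> (AE x in lborel. (\<lambda>k. rep_L2 (X k) x) \<longlonglongrightarrow> f x)"
proof -
  define F where "F k = rep_L2 (X k)" for k
  have sqF: "sq_integrable (F k)" for k by (simp add: F_def)
  have X: "X k = abs_L2 (F k)" for k by (simp add: F_def)
  have [measurable]: "F k \<in> borel_measurable borel" for k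
    using sqF sq_integrable_measurable by blast
  define h where "h k x = F (Suc k) x - F k x" for k x
  have [measurable]: "h k \<in> borel_measurable borel" for k by (simp add: h_def[abs_def])
  have sqh: "sq_integrable (h k)" for k unfolding h_def[abs_def] by (intro sq_integrable_diff sqF)
  have inth: "(\<integral>x. (norm (h k x))\<^sup>2 \<partial>lborel) \<le> (1/4) ^ k" for k
  proof -
    have "(\<integral>x. (norm (h k x))\<^sup>2 \<partial>lborel) = (norm (X (Suc k) - X k))\<^sup>2"
      by (simp add: X diff_abs_L2 sqF norm_abs_L2 sq_integrable_diff h_def)
    also have "\<dots> \<le> ((1/2) ^ k)\<^sup>2" by (rule power_mono[OF step]) simp
    also have "\<dots> = (1/4) ^ k" by (simp add: power2_eq_square flip: power_mult_distrib)
    finally show ?thesis .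
  qed
  \<comment> \<open>The weights \<open>2 ^ k\<close> make the squares summable and, by \<open>a \<le> 2\<^sup>-\<^sup>k + 2\<^sup>k a\<^sup>2\<close>, control the
     increments themselves.\<close>
  have "(\<integral>\<^sup>+x. (\<Sum>k. ennreal (2 ^ k * (norm (h k x))\<^sup>2)) \<partial>lborel)
      = (\<Sum>k. \<integral>\<^sup>+x. ennreal (2 ^ k * (norm (h k x))\<^sup>2) \<partial>lborel)"
    by (rule nn_integral_suminf) measurable
  also have "\<dots> \<le> (\<Sum>k. ennreal ((1/2) ^ k))"
  proof (intro suminf_le allI)
    fix k
    have "(\<integral>\<^sup>+x. ennreal (2 ^ k * (norm (h k x))\<^sup>2) \<partial>lborel)
        = ennreal (\<integral>x. 2 ^ k * (norm (h k x))\<^sup>2 \<partial>lborel)"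
      using sqh[of k] by (intro nn_integral_eq_integral) (auto simp: sq_integrable_def)
    also have "\<dots> \<le> ennreal ((1/2) ^ k)"
    proof (rule ennreal_leI)
      have "(\<integral>x. 2 ^ k * (norm (h k x))\<^sup>2 \<partial>lborel) \<le> 2 ^ k * (1/4) ^ k"
        using inth[of k] by simp
      also have "\<dots> = (1/2) ^ k" by (simp flip: power_mult_distrib)
      finally show "(\<integral>x. 2 ^ k * (norm (h k x))\<^sup>2 \<partial>lborel) \<le> (1/2) ^ k" .
    qed
    finally show "(\<integral>\<^sup>+x. ennreal (2 ^ k * (norm (h k x))\<^sup>2) \<partial>lborel) \<le> ennreal ((1/2) ^ k)" .
  qed auto
  also have "\<dots> < \<infinity>"
    by (subst suminf_ennreal2) (auto simp: summable_geometric)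
  finally have "AE x in lborel. (\<Sum>k. ennreal (2 ^ k * (norm (h k x))\<^sup>2)) \<noteq> \<infinity>"
    by (intro nn_integral_PInf_AE) auto
  then have conv: "AE x in lborel. convergent (\<lambda>k. F k x)"
  proof (rule AE_mp, intro AE_I2 impI)
    fix x assume "(\<Sum>k. ennreal (2 ^ k * (norm (h k x))\<^sup>2)) \<noteq> \<infinity>"
    then have s: "summable (\<lambda>k. 2 ^ k * (norm (h k x))\<^sup>2)"
      by (intro summable_suminf_not_top) auto
    have "summable (\<lambda>k. (1/2) ^ k + 2 ^ k * (norm (h k x))\<^sup>2)"
      by (intro summable_add s) (simp add: summable_geometric)
    moreover have "norm (h k x) \<le> (1/2) ^ k + 2 ^ k * (norm (h k x))\<^sup>2" for k
    proof (cases "norm (h k x) \<le> (1/2) ^ k")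
      case False
      then have "1 * norm (h k x) \<le> (2 ^ k * norm (h k x)) * norm (h k x)"
        by (intro mult_right_mono) (auto simp: field_simps)
      then have "norm (h k x) \<le> 2 ^ k * (norm (h k x))\<^sup>2" by (simp add: power2_eq_square mult.assoc)
      then show ?thesis by (smt (verit) zero_le_power divide_nonneg_nonneg)
    qed (simp add: add_increasing2)
    ultimately have "summable (\<lambda>k. h k x)"
      by (rule summable_comparison_test'[where N = 0])
    then have "convergent (\<lambda>n. \<Sum>k<n. h k x)" by (simp add: summable_iff_convergent)
    moreover have "(\<Sum>k<n. h k x) = F n x - F 0 x" for n
      unfolding h_def by (rule sum_lessThan_telescope)
    ultimately have "convergent (\<lambda>n. F n x - F 0 x)" by simp
    then show "convergent (\<lambda>k. F k x)" using convergent_add_const_right_iff[of _ "- F 0 x"] by simp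
  qed
  have "AE x in lborel. (\<lambda>k. F k x) \<longlonglongrightarrow> lim (\<lambda>k. F k x)"
    using conv by (rule AE_mp) (intro AE_I2 impI, simp only: convergent_LIMSEQ_iff)
  moreover have "(\<lambda>x. lim (\<lambda>k. F k x)) \<in> borel_measurable borel" by measurable
  ultimately show ?thesis unfolding F_def by blast
qed

text \<open>The norm half of the Riesz-Fischer theorem: Fatou's lemma carries the Cauchy bound on
  \<open>F k - F n\<close> over to \<open>f - F n\<close>.\<close>

lemma L2_fast_Cauchy_convergent:
  fixes X :: "nat \<Rightarrow> L2"
  assumes "Cauchy X" and step: "\<And>k. norm (X (Suc k) - X k) \<le> (1/2) ^ k"
  shows "convergent X"
proof -
  define F where "F k = rep_L2 (X k)" for k
  have sqF: "sq_integrable (F k)" for k by (simp add: F_def)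
  have X: "X k = abs_L2 (F k)" for k by (simp add: F_def)
  have [measurable]: "F k \<in> borel_measurable borel" for k
    using sqF sq_integrable_measurable by blast
  obtain f where [measurable]: "f \<in> borel_measurable borel"
    and lim: "AE x in lborel. (\<lambda>k. F k x) \<longlonglongrightarrow> f x"
    using L2_fast_Cauchy_AE_convergent[of X] step unfolding F_def by blast
  have fatou: "(\<integral>\<^sup>+x. ennreal ((norm (f x - F n x))\<^sup>2) \<partial>lborel) \<le> ennreal (e\<^sup>2)"
    if "0 \<le> e" "\<And>k. k \<ge> n \<Longrightarrow> norm (X k - X n) \<le> e" for n e
  proof -
    have "(\<integral>\<^sup>+x. ennreal ((norm (f x - F n x))\<^sup>2) \<partial>lborel)
       = (\<integral>\<^sup>+x. liminf (\<lambda>k. ennreal ((norm (F k x - F n x))\<^sup>2)) \<partial>lborel)"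
    proof (rule nn_integral_cong_AE, use lim in \<open>rule AE_mp\<close>, intro AE_I2 impI)
      fix x assume "(\<lambda>k. F k x) \<longlonglongrightarrow> f x"
      then have "(\<lambda>k. ennreal ((norm (F k x - F n x))\<^sup>2)) \<longlonglongrightarrow> ennreal ((norm (f x - F n x))\<^sup>2)"
        by (intro tendsto_intros)
      then show "ennreal ((norm (f x - F n x))\<^sup>2) = liminf (\<lambda>k. ennreal ((norm (F k x - F n x))\<^sup>2))"
        by (intro lim_imp_Liminf[symmetric]) simp_all
    qed
    also have "\<dots> \<le> liminf (\<lambda>k. \<integral>\<^sup>+x. ennreal ((norm (F k x - F n x))\<^sup>2) \<partial>lborel)"
      by (rule nn_integral_liminf) measurable
    also have "\<dots> \<le> limsup (\<lambda>k. \<integral>\<^sup>+x. ennreal ((norm (F k x - F n x))\<^sup>2) \<partial>lborel)"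
      by (rule Liminf_le_Limsup) simp
    also have "\<dots> \<le> ennreal (e\<^sup>2)"
    proof (rule Limsup_bounded, rule eventually_sequentiallyI)
      fix k assume "n \<le> k"
      have sq: "sq_integrable (\<lambda>x. F k x - F n x)" by (intro sq_integrable_diff sqF)
      have "(\<integral>\<^sup>+x. ennreal ((norm (F k x - F n x))\<^sup>2) \<partial>lborel) = ennreal ((norm (X k - X n))\<^sup>2)"
        unfolding X diff_abs_L2[OF sqF sqF] norm_abs_L2[OF sq]
        using sq by (intro nn_integral_eq_integral) (auto simp: sq_integrable_def)
      also have "\<dots> \<le> ennreal (e\<^sup>2)" using that(2)[OF \<open>n \<le> k\<close>] by (intro ennreal_leI power_mono) auto
      finally show "(\<integral>\<^sup>+x. ennreal ((norm (F k x - F n x))\<^sup>2) \<partial>lborel) \<le> ennreal (e\<^sup>2)" .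
    qed
    finally show ?thesis .
  qed
  \<comment> \<open>The limit \<open>f\<close> is not known to be square-integrable yet. Its
    difference from a single \<open>F N\<close> is, and adding \<open>F N\<close> back settles
    \<open>f\<close>.\<close>
  have sqd: "sq_integrable (\<lambda>x. f x - F n x)"
    if "0 \<le> e" "\<And>k. k \<ge> n \<Longrightarrow> norm (X k - X n) \<le> e" for n e
  proof -
    have "integrable lborel (\<lambda>x. (norm (f x - F n x))\<^sup>2)"
    proof (rule integrableI_nonneg)
      show "(\<integral>\<^sup>+x. ennreal ((norm (f x - F n x))\<^sup>2) \<partial>lborel) < \<infinity>"
        using order_le_less_trans[OF fatou[OF that] ennreal_less_top] by simp
    qed auto
    then show ?thesis by (simp add: sq_integrable_def)
  qed
  have ex: "\<exists>N. \<forall>n\<ge>N. \<forall>k\<ge>n. norm (X k - X n) \<le> e" if e: "e > 0" for e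
  proof -
    obtain N where "\<forall>m\<ge>N. \<forall>n\<ge>N. norm (X m - X n) < e"
      using \<open>Cauchy X\<close> e unfolding Cauchy_iff by blast
    then have "\<forall>n\<ge>N. \<forall>k\<ge>n. norm (X k - X n) \<le> e"
      by (metis less_imp_le le_trans)
    then show ?thesis ..
  qed
  obtain N where N: "\<forall>n\<ge>N. \<forall>k\<ge>n. norm (X k - X n) \<le> 1" using ex[of 1] by auto
  have "sq_integrable (\<lambda>x. f x - F N x)" using N by (intro sqd[of 1]) auto
  from sq_integrable_add[OF this sqF[of N]] have sqf: "sq_integrable f" by simp
  have "X \<longlonglongrightarrow> abs_L2 f"
  proof (rule LIMSEQ_I)
    fix e :: real assume "e > 0"
    then obtain M where M: "\<forall>n\<ge>M. \<forall>k\<ge>n. norm (X k - X n) \<le> e / 2" using ex[of "e/2"] by auto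
    have "norm (X n - abs_L2 f) < e" if "n \<ge> M" for n
    proof -
      have b: "0 \<le> e / 2" "\<And>k. k \<ge> n \<Longrightarrow> norm (X k - X n) \<le> e / 2" using M that \<open>e > 0\<close> by auto
      have sq: "sq_integrable (\<lambda>x. f x - F n x)" using sqd[OF b] .
      have "ennreal ((norm (X n - abs_L2 f))\<^sup>2) = (\<integral>\<^sup>+x. ennreal ((norm (f x - F n x))\<^sup>2) \<partial>lborel)"
        unfolding norm_minus_commute[of "X n" "abs_L2 f"]
          unfolding X diff_abs_L2[OF sqf sqF] norm_abs_L2[OF sq]
        using sq by (intro nn_integral_eq_integral[symmetric]) (auto simp: sq_integrable_def)
      also have "\<dots> \<le> ennreal ((e/2)\<^sup>2)" by (rule fatou[OF b])
      finally have "(norm (X n - abs_L2 f))\<^sup>2 \<le> (e/2)\<^sup>2" by (simp add: ennreal_le_iff)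
      then have "norm (X n - abs_L2 f) \<le> e/2" using b(1) power2_le_imp_le by blast
      then show ?thesis using \<open>e > 0\<close> by simp
    qed
    then show "\<exists>no. \<forall>n\<ge>no. norm (X n - abs_L2 f) < e" by blast
  qed
  then show ?thesis by (rule convergentI)
qed

instance L2 :: complete_space
proof
  fix X :: "nat \<Rightarrow> L2" assume X: "Cauchy X"
  have "\<exists>N. \<forall>m\<ge>N. \<forall>n\<ge>N. norm (X m - X n) < (1/2) ^ k" for k
    using X unfolding Cauchy_iff by simp
  then obtain N where N: "\<And>k m n. m \<ge> N k \<Longrightarrow> n \<ge> N k \<Longrightarrow> norm (X m - X n) < (1/2) ^ k" by metis
  \<comment> \<open>The \<open>Suc\<close> makes the partial sums strictly increasing, while each
    still dominates \<open>N k\<close>.\<close>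
  define r where "r k = (\<Sum>i\<le>k. Suc (N i))" for k
  have r: "strict_mono r" by (rule strict_mono_Suc_iff[THEN iffD2]) (simp add: r_def)
  have rN: "r k \<ge> N k" for k unfolding r_def by (induction k) auto
  have "norm (X (r (Suc k)) - X (r k)) \<le> (1/2) ^ k" for k
  proof (rule less_imp_le, rule N)
    show "N k \<le> r k" by (rule rN)
    also have "\<dots> \<le> r (Suc k)" using r by (simp add: strict_mono_less_eq)
    finally show "N k \<le> r (Suc k)" .
  qed
  then have "convergent (X \<circ> r)"
    by (intro L2_fast_Cauchy_convergent Cauchy_subseq_Cauchy[OF X r]) simp
  then show "convergent X"
    using Cauchy_converges_subseq[OF X r] by (auto simp: convergent_def)
qed

section \<open>Absolutely continuous functions\<close>

text \<open>Continuity follows from integrability and the last clause; having it in the definition makes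
  measurability immediate.\<close>

definition has_ac_derivative :: "(real \<Rightarrow> complex) \<Rightarrow> (real \<Rightarrow> complex) \<Rightarrow> bool" where
  "has_ac_derivative f g \<longleftrightarrow>
     continuous_on UNIV f \<and> g \<in> borel_measurable borel \<and> (\<forall>a b. set_integrable lborel {a<..b} g) \<and>
     (\<forall>a b. a \<le> b \<longrightarrow> f b - f a = (LINT x:{a<..b}|lborel. g x))"

lemma has_ac_derivative_measurable:
  assumes "has_ac_derivative f g"
  shows "f \<in> borel_measurable borel" "g \<in> borel_measurable borel"
  using assms by (auto simp: has_ac_derivative_def borel_measurable_continuous_onI)

lemma has_ac_derivative_continuous:
  "has_ac_derivative f g \<Longrightarrow> continuous_on UNIV f"
  by (simp add: has_ac_derivative_def)

lemma has_ac_derivativeD: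
  assumes "has_ac_derivative f g"
  shows "set_integrable lborel {a<..b} g"
    and "a \<le> b \<Longrightarrow> f b - f a = (LINT x:{a<..b}|lborel. g x)"
  using assms by (auto simp: has_ac_derivative_def)

lemma has_ac_derivative_C1:
  assumes d: "\<And>x. (f has_vector_derivative g x) (at x)" and c: "continuous_on UNIV g"
  shows "has_ac_derivative f g"
proof -
  have cf: "continuous_on UNIV f"
    using d by (auto intro!: continuous_at_imp_continuous_on has_vector_derivative_continuous)
  have i: "has_bochner_integral lborel (\<lambda>x. indicat_real {a..b} x *\<^sub>R g x) (f b - f a)" if "a \<le> b"
    for a b
    using that d c
    by (intro has_bochner_integral_FTC_Icc) (auto intro: has_vector_derivative_at_within continuous_on_subset)
  \<comment> \<open>The fundamental theorem is applied on closed intervals; half-open ones, which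
    split without overlap, differ from them by a null set.\<close>
  have ae: "AE x in lborel. indicat_real {a..b} x *\<^sub>R g x = indicat_real {a<..b} x *\<^sub>R g x" for a b
    using AE_lborel_singleton[of a] by eventually_elim (auto simp: indicator_def)
  have gm[measurable]: "g \<in> borel_measurable borel" using c
    by (simp add: borel_measurable_continuous_onI)
  have i': "has_bochner_integral lborel (\<lambda>x. indicat_real {a<..b} x *\<^sub>R g x) (f b - f a)" if "a \<le> b"
    for a b
    using i[OF that] ae[of a b]
    by (subst (asm) has_bochner_integral_cong_AE[where g="\<lambda>x. indicat_real {a<..b} x *\<^sub>R g x"]) auto
  have "set_integrable lborel {a<..b} g" for a b
  proof (cases "a \<le> b")
    case True
    then show ?thesis using i' by (auto simp: set_integrable_def has_bochner_integral_iff)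
  next
    case False
    then have "{a<..b} = {}" by auto
    then show ?thesis by (simp add: set_integrable_def)
  qed
  then show ?thesis
    unfolding has_ac_derivative_def set_lebesgue_integral_def
    using cf gm i' by (auto simp: has_bochner_integral_iff)
qed

lemma has_ac_derivative_cnj:
  assumes "has_ac_derivative f g"
  shows "has_ac_derivative (\<lambda>x. cnj (f x)) (\<lambda>x. cnj (g x))"
proof -
  have [measurable]: "g \<in> borel_measurable borel" using has_ac_derivative_measurable assms by blast
  have 1: "set_integrable lborel {a<..b} g" for a b using has_ac_derivativeD(1)[OF assms] .
  have eq: "indicat_real A x *\<^sub>R cnj z = cnj (indicat_real A x *\<^sub>R z)" for A x z
    by (simp add: indicator_def)
  show ?thesis
    unfolding has_ac_derivative_def set_integrable_def set_lebesgue_integral_def eq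
  proof (intro conjI allI impI)
    show "continuous_on UNIV (\<lambda>x. cnj (f x))"
      using assms by (auto simp: has_ac_derivative_def intro: continuous_intros)
    show "(\<lambda>x. cnj (g x)) \<in> borel_measurable borel"
      by (intro borel_measurable_continuous_on[of cnj] continuous_intros) measurable
    show "complex_integrable lborel (\<lambda>x. cnj (indicat_real {a<..b} x *\<^sub>R g x))" for a b
      using 1[of a b] unfolding set_integrable_def by (rule integrable_cnj)
    show "cnj (f b) - cnj (f a) = (CLBINT x. cnj (indicat_real {a<..b} x *\<^sub>R g x))" if "a \<le> b" for a b
    proof -
      have "(\<integral>x. cnj (indicat_real {a<..b} x *\<^sub>R g x) \<partial>lborel) = cnj (f b - f a)"
        unfolding has_ac_derivativeD(2)[OF assms that] set_lebesgue_integral_def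
          by (rule Bochner_Integration.integral_cnj)
      then show ?thesis by simp
    qed
  qed
qed

text \<open>Both sides integrate \<open>K x * F t\<close> over the half-plane t \<le> x, in the two
  orders. This is the core of the product rule below.\<close>

lemma Fubini_triangle:
  fixes F K :: "real \<Rightarrow> complex"
  assumes F: "integrable lborel F" and K: "integrable lborel K"
  shows "(\<integral>x. K x * (\<integral>t. (if t \<le> x then F t else 0) \<partial>lborel) \<partial>lborel) =
         (\<integral>t. F t * (\<integral>x. (if t \<le> x then K x else 0) \<partial>lborel) \<partial>lborel)"
proof -
  have [measurable]: "F \<in> borel_measurable borel" "K \<in> borel_measurable borel"
    using F K borel_measurable_integrable by auto
  define H where "H x t = (if t \<le> x then K x * F t else 0)" for x t
  have iF: "integrable lborel (\<lambda>t. if t \<le> x then F t else 0)" for x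
    by (rule Bochner_Integration.integrable_bound[OF F]) auto
  have Hm[measurable]: "case_prod H \<in> borel_measurable (lborel \<Otimes>\<^sub>M lborel)"
    unfolding H_def[abs_def] by measurable
  have Hx: "H x = (\<lambda>t. K x * (if t \<le> x then F t else 0))" for x by (auto simp: H_def)
  have Ht: "(\<lambda>x. H x t) = (\<lambda>x. F t * (if t \<le> x then K x else 0))" for t by (auto simp: H_def)
  have "integrable (lborel \<Otimes>\<^sub>M lborel) (case_prod H)"
  proof (rule lborel_pair.Fubini_integrable)
    show "integrable lborel (\<lambda>x. \<integral>t. norm (case_prod H (x, t)) \<partial>lborel)"
    proof (rule Bochner_Integration.integrable_bound)
      show "integrable lborel (\<lambda>x. norm (K x) * (\<integral>t. norm (F t) \<partial>lborel))"
        using K by simp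
      show "AE x in lborel. norm (\<integral>t. norm (case_prod H (x, t)) \<partial>lborel)
          \<le> norm (norm (K x) * (\<integral>t. norm (F t) \<partial>lborel))"
      proof (intro AE_I2)
        fix x
        have "(\<integral>t. norm (H x t) \<partial>lborel) = norm (K x) * (\<integral>t. norm (if t \<le> x then F t else 0) \<partial>lborel)"
          by (simp add: Hx norm_mult)
        also have "\<dots> \<le> norm (K x) * (\<integral>t. norm (F t) \<partial>lborel)"
          using iF F by (intro mult_left_mono integral_mono) auto
        finally show "norm (\<integral>t. norm (case_prod H (x, t)) \<partial>lborel)
          \<le> norm (norm (K x) * (\<integral>t. norm (F t) \<partial>lborel))" by simp
      qed
    qed measurable
    show "AE x in lborel. integrable lborel (\<lambda>t. case_prod H (x, t))"
      using iF by (simp add: Hx)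
  qed measurable
  then have "(\<integral>t. (\<integral>x. H x t \<partial>lborel) \<partial>lborel) = (\<integral>x. integral\<^sup>L lborel (H x) \<partial>lborel)"
    by (rule lborel_pair.Fubini_integral)
  moreover have "(\<integral>t. (\<integral>x. H x t \<partial>lborel) \<partial>lborel) =
      (\<integral>t. F t * (\<integral>x. (if t \<le> x then K x else 0) \<partial>lborel) \<partial>lborel)"
    by (simp only: Ht integral_mult_right_zero)
  moreover have "(\<integral>x. integral\<^sup>L lborel (H x) \<partial>lborel) =
      (\<integral>x. K x * (\<integral>t. (if t \<le> x then F t else 0) \<partial>lborel) \<partial>lborel)"
    by (simp only: Hx integral_mult_right_zero)
  ultimately show ?thesis by simp
qed

text \<open>Integrating \<open>g' x * f' t\<close> over the triangle a < t \<le> x \<le> b in both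
  orders gives the integral of g'(f - f(a)) on one side and that of f'(g(b) - g) on the other;
  rearranging yields the increment of the product.\<close>

lemma has_ac_derivative_mult:
  assumes f: "has_ac_derivative f f'" and g: "has_ac_derivative g g'"
  shows "has_ac_derivative (\<lambda>x. f x * g x) (\<lambda>x. f' x * g x + f x * g' x)"
proof -
  note [measurable] = has_ac_derivative_measurable[OF f] has_ac_derivative_measurable[OF g]
  have cf: "continuous_on UNIV f" and cg: "continuous_on UNIV g"
    using f g by (simp_all add: has_ac_derivative_continuous)
  have *: "set_integrable lborel {a<..b} (\<lambda>x. h' x * h x)"
    if "continuous_on UNIV h" "set_integrable lborel {a<..b} h'" "h' \<in> borel_measurable borel"
      for h h' :: "real \<Rightarrow> complex" and a b
  proof -
    note [measurable] = that(3) borel_measurable_continuous_onI[OF that(1)]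
    have "compact (h ` {a..b})"
      using that(1) by (intro compact_continuous_image) (auto intro: continuous_on_subset)
    then have "bounded (h ` {a..b})" by (rule compact_imp_bounded)
    then obtain B where B: "\<forall>x\<in>{a..b}. norm (h x) \<le> B"
      unfolding bounded_iff by auto
    show ?thesis unfolding set_integrable_def
    proof (rule Bochner_Integration.integrable_bound)
      show "integrable lborel (\<lambda>x. B *\<^sub>R (indicat_real {a<..b} x *\<^sub>R h' x))"
        using that(2) unfolding set_integrable_def by (rule integrable_scaleR_right)
      show "AE x in lborel. norm (indicat_real {a<..b} x *\<^sub>R (h' x * h x))
            \<le> norm (B *\<^sub>R (indicat_real {a<..b} x *\<^sub>R h' x))"
      proof (intro AE_I2)
        fix x
        show "norm (indicat_real {a<..b} x *\<^sub>R (h' x * h x))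
            \<le> norm (B *\<^sub>R (indicat_real {a<..b} x *\<^sub>R h' x))"
        proof (cases "x \<in> {a<..b}")
          case True
          then have "norm (h x) \<le> \<bar>B\<bar>" using B by (auto dest!: bspec[of _ _ x])
          from mult_right_mono[OF this norm_ge_zero[of "h' x"]] True
          show ?thesis by (simp add: norm_mult mult.commute)
        qed simp
      qed
    qed measurable
  qed
  have i1: "set_integrable lborel {a<..b} (\<lambda>x. f' x * g x)" for a b
    by (intro * cg has_ac_derivativeD(1)[OF f]) measurable
  have i2: "set_integrable lborel {a<..b} (\<lambda>x. f x * g' x)" for a b
    using *[OF cf has_ac_derivativeD(1)[OF g]] by (simp add: mult.commute)
  have eq: "f b * g b - f a * g a = (LINT x:{a<..b}|lborel. f' x * g x + f x * g' x)" if ab: "a \<le> b"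
    for a b
  proof -
    define F where "F x = indicat_real {a<..b} x *\<^sub>R f' x" for x
    define K where "K x = indicat_real {a<..b} x *\<^sub>R g' x" for x
    have iF: "integrable lborel F" and iK: "integrable lborel K"
      using has_ac_derivativeD(1)[OF f] has_ac_derivativeD(1)[OF g]
      by (auto simp: set_integrable_def F_def[abs_def] K_def[abs_def])
    have [measurable]: "K \<in> borel_measurable borel" "F \<in> borel_measurable borel"
      using iF iK borel_measurable_integrable by auto
    have F: "(\<integral>x. F x \<partial>lborel) = f b - f a" and K: "(\<integral>x. K x \<partial>lborel) = g b - g a"
      using has_ac_derivativeD(2)[OF f ab] has_ac_derivativeD(2)[OF g ab]
      by (simp_all add: set_lebesgue_integral_def F_def[abs_def] K_def[abs_def])
    have Ff: "(\<integral>t. (if t \<le> x then F t else 0) \<partial>lborel) = f x - f a" if "x \<in> {a<..b}" for x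
    proof -
      have "(\<lambda>t. if t \<le> x then F t else 0) = (\<lambda>t. indicat_real {a<..x} t *\<^sub>R f' t)"
        using that by (auto simp: F_def indicator_def)
      then show ?thesis using has_ac_derivativeD(2)[OF f, of a x] that
        by (simp add: set_lebesgue_integral_def)
    qed
    have Kg: "(\<integral>x. (if t \<le> x then K x else 0) \<partial>lborel) = g b - g t" if "t \<in> {a<..b}" for t
    proof -
      have "(\<integral>x. (if t \<le> x then K x else 0) \<partial>lborel) = (\<integral>x. indicat_real {t<..b} x *\<^sub>R g' x \<partial>lborel)"
      proof (rule integral_cong_AE)
        show "AE x in lborel. (if t \<le> x then K x else 0) = indicat_real {t<..b} x *\<^sub>R g' x"
          using AE_lborel_singleton[of t]
              by eventually_elim (use that in \<open>auto simp: K_def indicator_def\<close>)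
      qed measurable
      then show ?thesis using has_ac_derivativeD(2)[OF g, of t b] that
        by (simp add: set_lebesgue_integral_def)
    qed
    have "(\<integral>x. K x * (f x - f a) \<partial>lborel)
        = (\<integral>x. K x * (\<integral>t. (if t \<le> x then F t else 0) \<partial>lborel) \<partial>lborel)"
      by (intro Bochner_Integration.integral_cong refl) (metis Ff K_def indicator_simps(2) mult_zero_left scaleR_zero_left)
    also have "\<dots> = (\<integral>t. F t * (\<integral>x. (if t \<le> x then K x else 0) \<partial>lborel) \<partial>lborel)"
      by (rule Fubini_triangle[OF iF iK])
    also have "\<dots> = (\<integral>t. F t * (g b - g t) \<partial>lborel)"
      by (intro Bochner_Integration.integral_cong refl) (metis Kg F_def indicator_simps(2) mult_zero_left scaleR_zero_left)
    finally have main: "(\<integral>x. K x * (f x - f a) \<partial>lborel) = (\<integral>t. F t * (g b - g t) \<partial>lborel)" .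
    have iKf: "integrable lborel (\<lambda>x. K x * f x)" and iFg: "integrable lborel (\<lambda>x. F x * g x)"
      using i2[of a b] i1[of a b]
          by (auto simp: set_integrable_def F_def[abs_def] K_def[abs_def] mult_ac)
    have "(\<integral>x. K x * f x \<partial>lborel) - (g b - g a) * f a = (f b - f a) * g b - (\<integral>x. F x * g x \<partial>lborel)"
      using main iKf iFg iF iK F K by (simp add: right_diff_distrib)
    then have "f b * g b - f a * g a = (\<integral>x. F x * g x \<partial>lborel) + (\<integral>x. K x * f x \<partial>lborel)"
      by (simp add: algebra_simps)
    also have "\<dots> = (\<integral>x. F x * g x + K x * f x \<partial>lborel)" using iKf iFg by simp
    finally show ?thesis
      by (simp add: set_lebesgue_integral_def F_def K_def scaleR_add_right mult.commute)
  qed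
  show ?thesis unfolding has_ac_derivative_def
    using eq i1 i2 cf cg by (auto intro: continuous_intros)
qed

text \<open>The integral is the limit of W(R) - W(-R). Were it nonzero, this difference would stay
  away from 0 for large R, which its integrability forbids.\<close>

lemma has_ac_derivative_integral_eq_0:
  assumes W: "has_ac_derivative W w" and iW: "integrable lborel W" and iw: "integrable lborel w"
  shows "(\<integral>x. w x \<partial>lborel) = 0"
proof (rule ccontr)
  define L where "L = (\<integral>x. w x \<partial>lborel)"
  assume "(\<integral>x. w x \<partial>lborel) \<noteq> 0"
  then have L: "norm L > 0" by (simp add: L_def)
  \<comment> \<open>Working with the difference avoids separate limits of \<open>W\<close> at the
    two ends.\<close>
  define V where "V x = W x - W (- x)" for x
  have iV: "integrable lborel V"
    using iW lborel_integrable_real_affine[OF iW, of "-1" 0] by (simp add: V_def[abs_def])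
  have "((\<lambda>R. \<integral>x. indicat_real {- R<..R} x *\<^sub>R w x \<partial>lborel) \<longlongrightarrow> L) at_top"
    unfolding L_def
  proof (rule integral_dominated_convergence_at_top[where w="\<lambda>x. norm (w x)"])
    show "AE x in lborel. ((\<lambda>R. indicat_real {- R<..R} x *\<^sub>R w x) \<longlongrightarrow> w x) at_top"
    proof (intro AE_I2)
      fix x
      have "eventually (\<lambda>R. indicat_real {- R<..R} x *\<^sub>R w x = w x) at_top"
        using eventually_gt_at_top[of "\<bar>x\<bar>"]
        by (rule eventually_mono) (auto simp: indicator_def)
      then show "((\<lambda>R. indicat_real {- R<..R} x *\<^sub>R w x) \<longlongrightarrow> w x) at_top"
        by (rule tendsto_eventually)
    qed
    show "eventually (\<lambda>R. AE x in lborel. norm (indicat_real {- R<..R} x *\<^sub>R w x) \<le> norm (w x)) at_top"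
      by (simp add: indicator_def)
  qed (use iw in \<open>auto intro!: borel_measurable_integrable\<close>)
  moreover have "(\<integral>x. indicat_real {- R<..R} x *\<^sub>R w x \<partial>lborel) = V R" if "R \<ge> 0" for R
    using has_ac_derivativeD(2)[OF W, of "-R" R] that by (simp add: V_def set_lebesgue_integral_def)
  then have "eventually (\<lambda>R. (\<integral>x. indicat_real {- R<..R} x *\<^sub>R w x \<partial>lborel) = V R) at_top"
    by (intro eventually_mono[OF eventually_ge_at_top[of 0]])
  ultimately have lim: "(V \<longlongrightarrow> L) at_top"
    by (rule Lim_transform_eventually)
  then have "eventually (\<lambda>x. norm (V x) > norm L / 2) at_top"
    using L by (intro order_tendstoD(1)[OF tendsto_norm]) auto
  then obtain R where R: "\<And>x. x \<ge> R \<Longrightarrow> norm (V x) > norm L / 2"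
    unfolding eventually_at_top_linorder by blast
  have "integrable lborel (\<lambda>x. indicat_real {R..} x *\<^sub>R (norm L / 2))"
    by (rule Bochner_Integration.integrable_bound[OF iV]) (auto simp: indicator_def dest!: R)
  then have "integrable lborel (\<lambda>x. (indicat_real {R..} x *\<^sub>R (norm L / 2)) * (2 / norm L))"
    by (rule integrable_mult_left)
  then have "integrable lborel (indicat_real {R..})" using L by simp
  then have "emeasure lborel {R..} < \<infinity>" by (simp add: integrable_indicator_iff)
  moreover have "ennreal n \<le> emeasure lborel {R..}" for n :: nat
  proof -
    have "ennreal n = emeasure lborel {R..R + n}" by simp
    also have "\<dots> \<le> emeasure lborel {R..}" by (rule emeasure_mono) auto
    finally show ?thesis .
  qed
  ultimately show False using ennreal_Ex_less_of_nat[of "emeasure lborel {R..}"]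
    by (auto simp: ennreal_of_nat_eq_real_of_nat not_le[symmetric])
qed

lemma sq_integrable_indicator: "sq_integrable (\<lambda>x. of_real (indicat_real {a<..b} x))"
proof -
  have eq: "(\<lambda>x. (cmod (complex_of_real (indicat_real {a<..b} x)))\<^sup>2) = indicat_real {a<..b}"
    by (auto simp: indicator_def fun_eq_iff)
  show ?thesis
    by (cases "a \<le> b") (simp_all only: sq_integrable_def eq, auto)
qed

lemma sq_integrable_set_integrable:
  assumes "sq_integrable g"
  shows "set_integrable lborel {a<..b} g"
  using integrable_mult_sq_integrable[OF sq_integrable_indicator[of a b] assms]
  by (simp add: set_integrable_def scaleR_conv_of_real)

lemma sq_integral_Ioc_le:
  assumes g: "sq_integrable g" and ab: "a \<le> b"
  shows "(norm (LINT x:{a<..b}|lborel. g x))\<^sup>2 \<le> (b - a) * (norm (abs_L2 g))\<^sup>2"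
proof -
  define i where "i x = complex_of_real (indicat_real {a<..b} x)" for x
  have i: "sq_integrable i" unfolding i_def[abs_def] by (rule sq_integrable_indicator)
  have "(norm (i x))\<^sup>2 = indicat_real {a<..b} x" for x by (simp add: i_def indicator_def)
  then have ni: "(norm (abs_L2 i))\<^sup>2 = b - a"
    using norm_abs_L2[OF i] ab by simp
  define c where "c = (LINT x:{a<..b}|lborel. g x)"
  have "c = (\<integral>x. g x * cnj (i x) \<partial>lborel)"
    by (simp add: c_def set_lebesgue_integral_def i_def scaleR_conv_of_real mult.commute)
  \<comment> \<open>The factor \<open>cnj c\<close> rotates the integral onto the real axis, so that
    the real inner product captures the full modulus.\<close>
  then have "(norm c)\<^sup>2 = Re (\<integral>x. cnj c * g x * cnj (i x) \<partial>lborel)"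
    by (simp only: mult.assoc integral_mult_right_zero) (simp add: mult.commute[of
        "cnj c"] add: cmod_power2 flip: power2_eq_square)
  also have "\<dots> = abs_L2 (\<lambda>x. cnj c * g x) \<bullet> abs_L2 i"
    using i g by (simp add: inner_abs_L2_Re sq_integrable_mult_left)
  also have "\<dots> \<le> norm (abs_L2 (\<lambda>x. cnj c * g x)) * norm (abs_L2 i)"
    by (rule norm_cauchy_schwarz)
  also have "abs_L2 (\<lambda>x. cnj c * g x) = cnj c *\<^sub>C abs_L2 g" using g by (simp add: scaleC_abs_L2)
  also have "norm (cnj c *\<^sub>C abs_L2 g) = norm c * norm (abs_L2 g)" by (simp add: norm_scaleC)
  finally have "norm c * norm c \<le> norm c * (norm (abs_L2 g) * norm (abs_L2 i))"
    by (simp add: power2_eq_square mult_ac)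
  then have "norm c \<le> norm (abs_L2 g) * norm (abs_L2 i)"
    by (cases "norm c = 0") (auto simp: mult_le_cancel_left_pos)
  then have "(norm c)\<^sup>2 \<le> (norm (abs_L2 g) * norm (abs_L2 i))\<^sup>2" by (intro power_mono) auto
  then show ?thesis by (simp add: power_mult_distrib ni c_def mult.commute)
qed

text \<open>Assumes the increment formula only and not \<open>has_ac_derivative\<close>, because
  \<open>has_ac_derivativeI\<close> derives continuity from it.\<close>

lemma Hoelder_of_increments:
  assumes g: "sq_integrable g" and eq: "\<And>a b. a \<le> b \<Longrightarrow> f b - f a = (LINT x:{a<..b}|lborel. g x)"
  shows "norm (f y - f x) \<le> sqrt \<bar>y - x\<bar> * norm (abs_L2 g)"
proof -
  have *: "norm (f y - f x) \<le> sqrt \<bar>y - x\<bar> * norm (abs_L2 g)" if "x \<le> y" for x y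
  proof (rule power2_le_imp_le)
    show "(norm (f y - f x))\<^sup>2 \<le> (sqrt \<bar>y - x\<bar> * norm (abs_L2 g))\<^sup>2"
      using sq_integral_Ioc_le[OF g that] eq[OF that] that by (simp add: power_mult_distrib)
  qed simp
  show ?thesis
  proof (cases "x \<le> y")
    case False
    then show ?thesis using *[of y x] by (simp add: norm_minus_commute abs_minus_commute)
  qed (rule *)
qed

lemma has_ac_derivative_Hoelder:
  assumes "has_ac_derivative f g" "sq_integrable g"
  shows "norm (f y - f x) \<le> sqrt \<bar>y - x\<bar> * norm (abs_L2 g)"
  using assms(2) has_ac_derivativeD(2)[OF assms(1)] by (rule Hoelder_of_increments)

section \<open>Smooth ramps and test functions\<close>

text \<open>\<open>bump 1 0\<close> is the classical bump supported in [0, 1]. The polynomial and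
  the exponent make the family closed under differentiation, so that smoothness of all its members
  follows from one derivative formula.\<close>

definition bump :: "real poly \<Rightarrow> nat \<Rightarrow> real \<Rightarrow> real" where
  "bump p k x = (if 0 < x \<and> x < 1 then poly p x * exp (- 1 / (x * (1 - x))) / (x * (1 - x)) ^ k else 0)"

text \<open>Differentiating \<open>p e\<^sup>-\<^sup>1\<^sup>/\<^sup>q / q\<^sup>k\<close>, where \<open>q = x (1 - x)\<close>, raises \<open>k\<close>
  by 2 and replaces \<open>p\<close> as follows.\<close>

definition bump_deriv_poly :: "real poly \<Rightarrow> nat \<Rightarrow> real poly" where
  "bump_deriv_poly p k = pderiv p * [:0, 1, -1:] ^ 2
      - smult (of_nat k) (p * [:1, -2:] * [:0, 1, -1:]) + p * [:1, -2:]"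

text \<open>From exp(t) \<ge> (t/n)^n with t = 1/q. Taking n = k + 2 leaves two spare powers of
  \<open>q\<close>, which make \<open>bump\<close> vanish quadratically at the ends of its
  support.\<close>

lemma exp_minus_inverse_le:
  fixes q :: real
  assumes "q > 0"
  shows "exp (- 1 / q) / q ^ k \<le> real (k + 2) ^ (k + 2) * q\<^sup>2"
proof -
  define n where "n = k + 2"
  have n: "real n > 0" by (simp add: n_def)
  have "(1 / (q * n)) ^ n \<le> (1 + (1 / q) / n) ^ n"
    using assms by (intro power_mono) (simp_all add: divide_divide_eq_left)
  also have "\<dots> \<le> exp (1 / q)"
  proof (rule exp_ge_one_plus_x_over_n_power_n)
    have "0 \<le> 1 / q" using assms by simp
    with n show "- real n \<le> 1 / q" by linarith
  qed (simp add: n_def)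
  finally have "(1 / (q * n)) ^ n * (q * n) ^ n \<le> exp (1 / q) * (q * n) ^ n"
    using assms by (intro mult_right_mono) auto
  moreover have "(1 / (q * n)) ^ n * (q * n) ^ n = 1"
    using assms n by (simp flip: power_mult_distrib)
  ultimately have "1 \<le> exp (1 / q) * (q * n) ^ n" by simp
  then have "exp (- 1 / q) * 1 \<le> exp (- 1 / q) * (exp (1 / q) * (q * n) ^ n)"
    by (rule mult_left_mono) simp
  also have "\<dots> = (q * n) ^ n"
    by (simp flip: exp_add mult.assoc)
  also have "\<dots> = real n ^ n * q\<^sup>2 * q ^ k"
    by (simp add: power_mult_distrib n_def power_add power2_eq_square)
  finally show ?thesis using assms by (simp add: n_def divide_le_eq)
qed

text \<open>On (0, 1) the product x(1 - x) is at most x and at most 1 - x, so the spare factor from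
  \<open>exp_minus_inverse_le\<close> gives both quadratic bounds. They are what is needed to
  differentiate across the endpoints.\<close>

lemma bump_le:
  obtains C where "\<And>x. \<bar>bump p k x\<bar> \<le> C * x\<^sup>2" "\<And>x. \<bar>bump p k x\<bar> \<le> C * (x - 1)\<^sup>2"
proof -
  have "bounded (poly p ` {0..1})"
    by (intro compact_imp_bounded compact_continuous_image continuous_intros) auto
  then obtain B where B: "\<forall>x\<in>{0..1}. \<bar>poly p x\<bar> \<le> B" unfolding bounded_iff by auto
  have B0: "B \<ge> 0" using B[rule_format, of 0] by simp
  define C where "C = B * real (k + 2) ^ (k + 2)"
  have "C \<ge> 0" using B0 by (simp add: C_def)
  have b: "\<bar>bump p k x\<bar> \<le> C * (x * (1 - x))\<^sup>2" if x: "0 < x" "x < 1" for x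
  proof -
    have q: "x * (1 - x) > 0" using x by simp
    have "\<bar>bump p k x\<bar> = \<bar>poly p x\<bar> * (exp (- 1 / (x * (1 - x))) / (x * (1 - x)) ^ k)"
      using x q by (simp add: bump_def abs_mult)
    also have "\<dots> \<le> B * (real (k + 2) ^ (k + 2) * (x * (1 - x))\<^sup>2)"
      using B x q B0 by (intro mult_mono exp_minus_inverse_le) auto
    finally show ?thesis by (simp add: C_def)
  qed
  have l: "(x * (1 - x))\<^sup>2 \<le> x\<^sup>2" "(x * (1 - x))\<^sup>2 \<le> (x - 1)\<^sup>2" if "0 < x" "x < 1" for x :: real
    using that by (auto simp: abs_mult mult_left_le mult_left_le_one_le simp flip: abs_le_square_iff)
  show thesis
  proof (rule that)
    fix x
    show "\<bar>bump p k x\<bar> \<le> C * x\<^sup>2"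
    proof (cases "0 < x \<and> x < 1")
      case True
      then show ?thesis using b[of x] mult_left_mono[OF l(1)[of x] \<open>C \<ge> 0\<close>] by linarith
    next
      case False
      then have "bump p k x = 0" unfolding bump_def by (rule if_not_P)
      then show ?thesis using \<open>C \<ge> 0\<close> by simp
    qed
    show "\<bar>bump p k x\<bar> \<le> C * (x - 1)\<^sup>2"
    proof (cases "0 < x \<and> x < 1")
      case True
      then show ?thesis using b[of x] mult_left_mono[OF l(2)[of x] \<open>C \<ge> 0\<close>] by linarith
    next
      case False
      then have "bump p k x = 0" unfolding bump_def by (rule if_not_P)
      then show ?thesis using \<open>C \<ge> 0\<close> by simp
    qed
  qed
qed

lemma DERIV_zero_of_quadratic_bound:
  fixes f :: "real \<Rightarrow> real"
  assumes "\<And>x. \<bar>f x\<bar> \<le> C * (x - a)\<^sup>2"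
  shows "(f has_real_derivative 0) (at a)"
proof -
  have fa: "f a = 0" using assms[of a] by simp
  have "((\<lambda>x. (f x - f a) / (x - a)) \<longlongrightarrow> 0) (at a)"
  proof (rule Lim_null_comparison)
    show "\<forall>\<^sub>F x in at a. norm ((f x - f a) / (x - a)) \<le> C * \<bar>x - a\<bar>"
    proof (intro always_eventually allI)
      fix x
      have "\<bar>f x\<bar> \<le> C * \<bar>x - a\<bar> * \<bar>x - a\<bar>"
        using assms[of x] by (simp add: power2_eq_square mult.assoc flip: abs_mult)
      then show "norm ((f x - f a) / (x - a)) \<le> C * \<bar>x - a\<bar>"
        using fa by (cases "x = a") (auto simp: abs_divide pos_divide_le_eq)
    qed
    have "((\<lambda>x. C * \<bar>x - a\<bar>) \<longlongrightarrow> C * \<bar>a - a\<bar>) (at a)" by (intro tendsto_intros)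
    then show "((\<lambda>x. C * \<bar>x - a\<bar>) \<longlongrightarrow> 0) (at a)" by simp
  qed
  then show ?thesis by (simp add: has_field_derivative_iff)
qed

text \<open>Only the endpoints need an argument: there the quadratic bounds force the derivative 0,
  which agrees with the value of \<open>bump\<close> outside the open interval.\<close>

lemma bump_DERIV: "(bump p k has_real_derivative bump (bump_deriv_poly p k) (k + 2) x) (at x)"
proof -
  consider "0 < x \<and> x < 1" | "x = 0" | "x = 1" | "x < 0" | "x > 1" by linarith
  then show ?thesis
  proof cases
    case 1
    have q: "x * (1 - x) \<noteq> 0" using 1 by auto
    define Q where "Q = x * (1 - x)"
    have Q: "Q > 0" using 1 by (simp add: Q_def)
    have dq: "((\<lambda>y. y * (1 - y)) has_real_derivative 1 - 2 * x) (at x)"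
      by (rule derivative_eq_intros refl | simp)+
    have de: "((\<lambda>y. exp (- 1 / (y * (1 - y))))
        has_real_derivative exp (- 1 / Q) * ((1 - 2 * x) / Q\<^sup>2)) (at x)"
      by (rule derivative_eq_intros refl dq | use q in \<open>simp add: Q_def power2_eq_square\<close>)+
    have dk: "((\<lambda>y. (y * (1 - y)) ^ k) has_real_derivative real k * Q ^ k / Q * (1 - 2 * x)) (at x)"
    proof -
      have "real k * ((1 - 2 * x) * Q ^ (k - Suc 0)) = real k * Q ^ k / Q * (1 - 2 * x)"
        using Q by (cases k) auto
      then show ?thesis using DERIV_power[OF dq, of k] unfolding Q_def by simp
    qed
    have "((\<lambda>y. poly p y * exp (- 1 / (y * (1 - y))) / (y * (1 - y)) ^ k) has_real_derivative
        ((poly (pderiv p) x * exp (- 1 / Q) + exp (- 1 / Q) * ((1 - 2 * x) / Q\<^sup>2) * poly p x) * Q ^ k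
          - poly p x * exp (- 1 / Q) * (real k * Q ^ k / Q * (1 - 2 * x))) / (Q ^ k * Q ^ k)) (at x)"
      using DERIV_divide[OF DERIV_mult[OF poly_DERIV[of p] de] dk power_not_zero[OF q]]
      by (simp only: Q_def)
    also have "((poly (pderiv p) x * exp (- 1 / Q)
        + exp (- 1 / Q) * ((1 - 2 * x) / Q\<^sup>2) * poly p x) * Q ^ k
          - poly p x * exp (- 1 / Q) * (real k * Q ^ k / Q * (1 - 2 * x))) / (Q ^ k * Q ^ k)
        = (poly (pderiv p) x * Q\<^sup>2 - real k * (poly p x * (1 - 2 * x) * Q) + poly p x * (1 - 2 * x))
            * exp (- 1 / Q) / Q ^ (k + 2)"
      using Q by (simp add: field_simps power2_eq_square power_add)
    also have "\<dots> = bump (bump_deriv_poly p k) (k + 2) x"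
      using 1 by (simp add: bump_def bump_deriv_poly_def Q_def algebra_simps)
    finally have main: "((\<lambda>y. poly p y * exp (- 1 / (y * (1 - y))) / (y * (1
        - y)) ^ k) has_real_derivative
        bump (bump_deriv_poly p k) (k + 2) x) (at x)" .
    have "eventually (\<lambda>y. y \<in> {0<..<1}) (nhds x)" using 1 by (intro eventually_nhds_in_open) auto
    then have "eventually (\<lambda>y. bump p k y
        = poly p y * exp (- 1 / (y * (1 - y))) / (y * (1 - y)) ^ k) (nhds x)"
      by eventually_elim (simp add: bump_def)
    with main show ?thesis by (subst DERIV_cong_ev[OF refl _ refl]) auto
  next
    case 2
    obtain C where "\<And>x. \<bar>bump p k x\<bar> \<le> C * x\<^sup>2" using bump_le by blast
    then have "(bump p k has_real_derivative 0) (at 0)"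
      by (intro DERIV_zero_of_quadratic_bound[of _ C]) simp
    then show ?thesis using 2 by (simp add: bump_def)
  next
    case 3
    obtain C where "\<And>x. \<bar>bump p k x\<bar> \<le> C * (x - 1)\<^sup>2" using bump_le by blast
    then have "(bump p k has_real_derivative 0) (at 1)" by (rule DERIV_zero_of_quadratic_bound)
    then show ?thesis using 3 by (simp add: bump_def)
  next
    case 4
    have "eventually (\<lambda>y. y \<in> {..<0}) (nhds x)" using 4 by (intro eventually_nhds_in_open) auto
    then have "eventually (\<lambda>y. bump p k y = 0) (nhds x)" by eventually_elim (simp add: bump_def)
    then have "(bump p k has_real_derivative 0) (at x)" by (subst DERIV_cong_ev[OF refl _ refl]) auto
    then show ?thesis using 4 by (simp add: bump_def)
  next
    case 5
    have "eventually (\<lambda>y. y \<in> {1<..}) (nhds x)" using 5 by (intro eventually_nhds_in_open) auto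
    then have "eventually (\<lambda>y. bump p k y = 0) (nhds x)" by eventually_elim (simp add: bump_def)
    then have "(bump p k has_real_derivative 0) (at x)" by (subst DERIV_cong_ev[OF refl _ refl]) auto
    then show ?thesis using 5 by (simp add: bump_def)
  qed
qed

section \<open>Smooth functions, steps and ramps\<close>

text \<open>Asking for the whole sequence of derivatives at once lets closure properties be proved
  by writing down a new sequence.\<close>

definition smooth :: "(real \<Rightarrow> real) \<Rightarrow> bool" where
  "smooth f \<longleftrightarrow> (\<exists>D. D 0 = f \<and> (\<forall>n x. (D n has_real_derivative D (Suc n) x) (at x)))"

lemma smooth_integrate:
  assumes "smooth f'" "\<And>x. (f has_real_derivative f' x) (at x)"
  shows "smooth f"
proof -
  obtain D where D: "D 0 = f'" "\<And>n x. (D n has_real_derivative D (Suc n) x) (at x)"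
    using assms(1) unfolding smooth_def by blast
  have "(case_nat f D n has_real_derivative case_nat f D (Suc n) x) (at x)" for n x
    using D assms(2) by (cases n) auto
  then show ?thesis unfolding smooth_def by (intro exI[of _ "case_nat f D"]) simp
qed

lemma smooth_bump: "smooth (bump p k)"
proof -
  define D where "D = rec_nat (p, k) (\<lambda>_ (p, k). (bump_deriv_poly p k, k + 2))"
  have "((\<lambda>n. bump (fst (D n)) (snd (D n))) n has_real_derivative
      (\<lambda>n. bump (fst (D n)) (snd (D n))) (Suc n) x) (at x)" for n x
    using bump_DERIV[of "fst (D n)" "snd (D n)" x] by (simp add: D_def split_beta)
  then show ?thesis unfolding smooth_def
    by (intro exI[of _ "\<lambda>n. bump (fst (D n)) (snd (D n))"]) (simp add: D_def)
qed

lemma smooth_cmult_affine: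
  assumes "smooth f" shows "smooth (\<lambda>x. c * f (k * (x - a)))"
proof -
  obtain D where D: "D 0 = f" "\<And>n x. (D n has_real_derivative D (Suc n) x) (at x)"
    using assms(1) unfolding smooth_def by blast
  have "((\<lambda>x. c * k ^ n * D n (k * (x - a)))
      has_real_derivative c * k ^ Suc n * D (Suc n) (k * (x - a))) (at x)" for n x
    by (rule derivative_eq_intros refl DERIV_chain2[OF D(2)] | simp)+
  then show ?thesis unfolding smooth_def
    by (intro exI[of _ "\<lambda>n x. c * k ^ n * D n (k * (x - a))"]) (simp add: D)
qed

lemma smooth_add:
  assumes "smooth f" "smooth g" shows "smooth (\<lambda>x. f x + g x)"
proof -
  obtain D E where "D 0 = f" "\<And>n x. (D n has_real_derivative D (Suc n) x) (at x)"
    "E 0 = g" "\<And>n x. (E n has_real_derivative E (Suc n) x) (at x)"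
    using assms unfolding smooth_def by metis
  then show ?thesis unfolding smooth_def
    by (intro exI[of _ "\<lambda>n x. D n x + E n x"]) (auto intro!: derivative_intros)
qed

lemma test_function_smooth:
  assumes "smooth f" and supp: "\<And>x. x \<notin> {a..b} \<Longrightarrow> f x = 0"
  shows "test_function (\<lambda>x. of_real (f x))"
proof -
  obtain D where D: "D 0 = f" "\<And>n x. (D n has_real_derivative D (Suc n) x) (at x)"
    using assms(1) unfolding smooth_def by blast
  have d: "((\<lambda>x. complex_of_real (D n x)) has_vector_derivative of_real (D (Suc n) x)) (at x)" for n x
    using D(2) by (intro has_vector_derivative_of_real) (simp add: has_real_derivative_iff_has_vector_derivative)
  have it: "((\<lambda>f y. vector_derivative f (at y)) ^^ n) (\<lambda>x. complex_of_real (f x))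
      = (\<lambda>x. of_real (D n x))" for n
    using d[THEN vector_derivative_at] by (induction n) (auto simp: D(1))
  have sub: "{x. complex_of_real (f x) \<noteq> 0} \<subseteq> {a..b}" using supp
    by (metis (mono_tags, lifting) mem_Collect_eq of_real_0 subsetI)
  then have "bounded {x. complex_of_real (f x) \<noteq> 0}" using bounded_closed_interval bounded_subset
    by blast
  then have "compact (closure {x. complex_of_real (f x) \<noteq> 0})" by (simp add: compact_closure)
  then show ?thesis
    unfolding test_function_def it using d by (auto intro: differentiableI_vector)
qed

lemma antiderivative_from_right_support:
  fixes f :: "real \<Rightarrow> real"
  assumes c: "continuous_on UNIV f" and z: "\<And>x. x \<le> 0 \<Longrightarrow> f x = 0"
  obtains F where "\<And>x. (F has_real_derivative f x) (at x)" "\<And>x. x \<le> 0 \<Longrightarrow> F x = 0"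
    "\<And>x. F x = integral {-1..x} f"
proof -
  \<comment> \<open>Since \<open>f\<close> vanishes left of 0, any negative base point gives the
    same values; being strictly negative, -1 makes every x \<ge> 0 an interior point of
    [-1, x + 1].\<close>
  define F where "F x = integral {-1..x} f" for x
  have F0: "F x = 0" if "x \<le> 0" for x
    unfolding F_def using that z by (intro integral_unique has_integral_is_0) auto
  have "(F has_real_derivative f x) (at x)" for x
  proof (cases "x < 0")
    case True
    have "eventually (\<lambda>y. y \<in> {..<0}) (nhds x)" using True by (intro eventually_nhds_in_open) auto
    then have "eventually (\<lambda>y. F y = 0) (nhds x)" by eventually_elim (simp add: F0)
    then have "(F has_real_derivative 0) (at x)" by (subst DERIV_cong_ev[OF refl _ refl]) auto
    then show ?thesis using True z by simp
  next
    case False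
    have "((\<lambda>u. integral {-1..u} f) has_vector_derivative f x) (at x within {-1..x+1})"
      using False c by (intro integral_has_vector_derivative) (auto intro: continuous_on_subset)
    moreover have "at x within {-1..x+1} = at x"
      using False by (intro at_within_interior) auto
    ultimately show ?thesis unfolding F_def[abs_def] has_real_derivative_iff_has_vector_derivative
      by simp
  qed
  then show thesis using F0 F_def by (rule that)
qed

text \<open>The bump is integrated and normalised to a step \<open>S\<close>, which is integrated
  again to a ramp \<open>R\<close>. The value \<open>R 1\<close> remains unspecified; it cancels in
  the combinations that have compact support.\<close>

lemma smooth_ramp_exists:
  obtains S R :: "real \<Rightarrow> real" where "smooth R" "\<And>x. (R has_real_derivative S x) (at x)"
    "\<And>x. 0 \<le> S x" "\<And>x. S x \<le> 1" "\<And>x. x \<le> 0 \<Longrightarrow> S x = 0" "\<And>x. x \<ge> 1 \<Longrightarrow> S x = 1"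
    "\<And>x. x \<le> 0 \<Longrightarrow> R x = 0" "\<And>x. x \<ge> 1 \<Longrightarrow> R x = R 1 + (x - 1)" "\<And>x. \<bar>R x - max 0 x\<bar> \<le> 1"
proof -
  define e where "e = bump 1 0"
  have e: "e x = (if 0 < x \<and> x < 1 then exp (- 1 / (x * (1 - x))) else 0)" for x
    by (simp add: e_def bump_def)
  have ce: "continuous_on UNIV e"
    unfolding e_def using bump_DERIV DERIV_isCont by (blast intro: continuous_at_imp_continuous_on)
  obtain Y where Y: "\<And>x. (Y has_real_derivative e x) (at x)" "\<And>x. x \<le> 0 \<Longrightarrow> Y x = 0"
      "\<And>x. Y x = integral {-1..x} e"
    using antiderivative_from_right_support[OF ce] e by auto
  have Ymono: "Y x \<le> Y y" if "x \<le> y" for x y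
    using that by (rule DERIV_nonneg_imp_nondecreasing) (use Y(1) in \<open>auto simp: e intro!: exI\<close>)
  have cY: "continuous_on UNIV Y" using Y(1) DERIV_isCont
    by (blast intro: continuous_at_imp_continuous_on)
  have Yconst: "Y x = Y 1" if "x \<ge> 1" for x
  proof (cases "x = 1")
    case False
    show ?thesis
    proof (rule DERIV_isconst_end[of 1 x Y])
      show "1 < x" using False that by simp
      show "continuous_on {1..x} Y" using cY continuous_on_subset by blast
      show "(Y has_real_derivative 0) (at y)" if "1 < y" for y
        using Y(1)[of y] e[of y] that by simp
    qed
  qed simp
  have Y1: "Y 1 > 0"
  proof -
    have "Y 1 \<noteq> 0"
    proof
      assume "Y 1 = 0"
      moreover have "integral {-1..1} e = 0 \<longleftrightarrow> (\<forall>x\<in>{-1..1}. e x = 0)"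
        by (rule integral_eq_0_iff) (use continuous_on_subset[OF ce] in \<open>auto simp: e\<close>)
      ultimately have "\<forall>x\<in>{-1..1}. e x = 0" using Y(3)[of 1] by simp
      then have "e (1/2) = 0" by auto
      then show False by (simp add: e)
    qed
    then show ?thesis using Ymono[of 0 1] Y(2)[of 0] by simp
  qed
  define S where "S x = Y x / Y 1" for x
  have dS: "(S has_real_derivative e x / Y 1) (at x)" for x
    unfolding S_def[abs_def] by (rule DERIV_cdivide[OF Y(1)])
  have S0: "S x = 0" if "x \<le> 0" for x using Y(2)[OF that] by (simp add: S_def)
  have S1: "S x = 1" if "x \<ge> 1" for x using Yconst[OF that] Y1 by (simp add: S_def)
  have Snn: "0 \<le> S x" "S x \<le> 1" for x
    using Ymono[of 0 x] Ymono[of x 1] Y(2)[of 0] Y(2)[of x] Yconst[of x] Y1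
    by (auto simp: S_def field_simps) (metis Y1 Ymono linorder_le_cases order_less_imp_le Y(2) order_refl)+
  have cS: "continuous_on UNIV S" using dS DERIV_isCont
    by (blast intro: continuous_at_imp_continuous_on)
  obtain R where R: "\<And>x. (R has_real_derivative S x) (at x)" "\<And>x. x \<le> 0 \<Longrightarrow> R x = 0"
    using antiderivative_from_right_support[OF cS S0] by metis
  have Rmono: "R x \<le> R y" if "x \<le> y" for x y
    using that by (rule DERIV_nonneg_imp_nondecreasing) (use R(1) Snn in \<open>blast\<close>)
  have dR: "((\<lambda>x. x - R x) has_real_derivative 1 - S x) (at x)" for x
    by (rule DERIV_diff[OF DERIV_ident R(1)])
  have Rmono': "x - R x \<le> y - R y" if "x \<le> y" for x y
    using that by (rule DERIV_nonneg_imp_nondecreasing) (use dR Snn in \<open>force\<close>)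
  have R1: "R x = R 1 + (x - 1)" if "x \<ge> 1" for x
  proof (cases "x = 1")
    case False
    have "x - R x = 1 - R 1"
    proof (rule DERIV_isconst_end[of 1 x "\<lambda>x. x - R x"])
      show "1 < x" using False that by simp
      have "continuous_on UNIV (\<lambda>x. x - R x)"
        using dR DERIV_isCont by (blast intro: continuous_at_imp_continuous_on)
      then show "continuous_on {1..x} (\<lambda>x. x - R x)" using continuous_on_subset by blast
      show "((\<lambda>x. x - R x) has_real_derivative 0) (at y)" if "1 < y" for y
        using dR[of y] S1[of y] that by simp
    qed
    then show ?thesis by simp
  qed simp
  have "smooth (\<lambda>x. (1 / Y 1) * e (1 * (x - 0)))" unfolding e_def
    by (intro smooth_cmult_affine smooth_bump)
  then have "smooth (\<lambda>x. e x / Y 1)" by simp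
  then have "smooth S" using dS by (rule smooth_integrate)
  then have sR: "smooth R" using R(1) by (rule smooth_integrate)
  \<comment> \<open>Both \<open>R x\<close> and \<open>x - R x\<close> are nondecreasing and vanish
    at 0, so 0 \<le> R x \<le> x on [0, 1]; beyond 1 the difference from x stays constant.\<close>
  have absR: "\<bar>R x - max 0 x\<bar> \<le> 1" for x
  proof -
    consider "x \<le> 0" | "0 \<le> x" "x \<le> 1" | "x \<ge> 1" by linarith
    then show ?thesis
    proof cases
      case 1 then show ?thesis using R(2)[OF 1] by simp
    next
      case 2
      then show ?thesis using Rmono[of 0 x] Rmono'[of 0 x] R(2)[of 0] by auto
    next
      case 3
      then show ?thesis using R1[OF 3] Rmono[of 0 1] Rmono'[of 0 1] R(2)[of 0] by auto
    qed
  qed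
  show thesis
    by (rule that[where R=R and S=S]; fact sR R(1) Snn S0 S1 R(2) R1 absR)
qed


section \<open>Testing weak derivatives against trapezoids\<close>

text \<open>The profiles S((n+1) y) tend to the indicator of y > 0, which is why half-open intervals
  appear. \<open>S\<close> is kept general because the lemma serves for the smooth step and for a
  piecewise linear one.\<close>

lemma step_limit:
  fixes S :: "real \<Rightarrow> real"
  assumes S: "\<And>x. 0 \<le> S x" "\<And>x. S x \<le> 1" "\<And>x. x \<le> 0 \<Longrightarrow> S x = 0" "\<And>x. x \<ge> 1 \<Longrightarrow> S x = 1"
    and Sm[measurable]: "S \<in> borel_measurable borel"
    and f: "sq_integrable f" and st: "s \<le> t"
  shows "(\<lambda>n. \<integral>x. f x * of_real (S (real (Suc n) * (x - s)) - S (real (Suc n) * (x - t))) \<partial>lborel)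
      \<longlonglongrightarrow> (LINT x:{s<..t}|lborel. f x)"
    and "integrable lborel (\<lambda>x. f x * of_real (S (real (Suc n) * (x - s))
        - S (real (Suc n) * (x - t))))"
proof -
  have [measurable]: "f \<in> borel_measurable borel" using f by (rule sq_integrable_measurable)
  \<comment> \<open>Since \<open>Suc n\<close> is at least 1, each profile reaches its final value
    within distance 1 of its jump, so one interval works for all \<open>n\<close>.\<close>
  have bd: "norm (f x * of_real (S (real (Suc n) * (x - s)) - S (real (Suc n) * (x - t))))
      \<le> norm (indicat_real {s - 1<..t + 1} x *\<^sub>R f x)" for n x
  proof (cases "x \<in> {s-1<..t+1}")
    case True
    have "\<bar>S (real (Suc n) * (x - s)) - S (real (Suc n) * (x - t))\<bar> \<le> 1"
      using S(1,2)[of "real (Suc n) * (x - s)"] S(1,2)[of "real (Suc n) * (x - t)"] by linarith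
    then show ?thesis using True
      by (simp add: norm_mult mult_left_le del: of_real_diff)
  next
    case False
    then consider "x \<le> s - 1" | "x > t + 1" by fastforce
    then have "S (real (Suc n) * (x - s)) = S (real (Suc n) * (x - t))"
    proof cases
      case 1
      then have "real (Suc n) * (x - s) \<le> 0" "real (Suc n) * (x - t) \<le> 0"
        using st by (intro mult_nonneg_nonpos; simp)+
      then show ?thesis by (simp only: S(3))
    next
      case 2
      have "1 * 1 \<le> real (Suc n) * (x - s)" "1 * 1 \<le> real (Suc n) * (x - t)"
        using 2 st by (intro mult_mono; simp)+
      then show ?thesis by (simp only: S(4) mult_1)
    qed
    then show ?thesis by simp
  qed
  have int: "integrable lborel (\<lambda>x. indicat_real {s - 1<..t + 1} x *\<^sub>R f x)"
    using sq_integrable_set_integrable[OF f] by (simp add: set_integrable_def)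
  show "integrable lborel (\<lambda>x. f x * of_real (S (real (Suc n) * (x - s)) - S (real (Suc n) * (x - t))))"
    by (rule Bochner_Integration.integrable_bound[OF int]) (use bd in \<open>auto simp del: of_real_diff\<close>)
  have lim: "(\<lambda>n. S (real (Suc n) * y)) \<longlonglongrightarrow> (if y > 0 then 1 else 0)" for y
  proof (cases "y > 0")
    case False
    then have "real (Suc n) * y \<le> 0" for n by (intro mult_nonneg_nonpos) auto
    then show ?thesis using S(3) False by simp
  next
    case True
    obtain N where N: "1 / y < real (Suc N)" using reals_Archimedean2 less_trans
      by (metis lessI of_nat_less_iff)
    have "S (real (Suc n) * y) = 1" if "n \<ge> N" for n
    proof (rule S(4))
      have "1 / y < real (Suc n)" using N that by (simp add: less_le_trans)
      then show "1 \<le> real (Suc n) * y" using True by (simp add: pos_divide_less_eq)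
    qed
    then show ?thesis using True by (intro tendsto_eventually) (auto simp: eventually_sequentially)
  qed
  show "(\<lambda>n. \<integral>x. f x * of_real (S (real (Suc n) * (x - s)) - S (real (Suc n) * (x - t))) \<partial>lborel)
      \<longlonglongrightarrow> (LINT x:{s<..t}|lborel. f x)"
    unfolding set_lebesgue_integral_def
  proof (rule integral_dominated_convergence[where w="\<lambda>x. norm (indicat_real {s - 1<..t
      + 1} x *\<^sub>R f x)"])
    show "AE x in lborel. (\<lambda>n. f x * of_real (S (real (Suc n) * (x - s)) - S (real (Suc n) * (x - t))))
      \<longlonglongrightarrow> indicat_real {s<..t} x *\<^sub>R f x"
    proof (intro AE_I2)
      fix x
      have "(\<lambda>n. f x * of_real (S (real (Suc n) * (x - s)) - S (real (Suc n) * (x - t))))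
         \<longlonglongrightarrow> f x * of_real ((if x - s > 0 then 1 else 0) - (if x - t > 0 then 1 else 0))"
        by (intro tendsto_intros lim)
      also have "f x * of_real ((if x - s > 0 then 1 else 0) - (if x - t > 0 then 1 else 0))
          = indicat_real {s<..t} x *\<^sub>R f x"
        using st by (auto simp: indicator_def)
      finally show "(\<lambda>n. f x * of_real (S (real (Suc n) * (x - s)) - S (real (Suc n) * (x - t))))
         \<longlonglongrightarrow> indicat_real {s<..t} x *\<^sub>R f x" .
    qed
  qed (use bd integrable_norm[OF int] in \<open>auto simp del: of_real_diff norm_scaleR\<close>)
qed

text \<open>A trapezoid with slopes 1 and -1: its derivative is the indicator of (s, s+h] minus that
  of (t, t+h], almost everywhere.\<close>

definition ramp :: "real \<Rightarrow> real \<Rightarrow> real \<Rightarrow> real \<Rightarrow> real" where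
  "ramp s t h x = max 0 (x - s) - max 0 (x - (s + h)) - max 0 (x - t) + max 0 (x - (t + h))"

text \<open>The trapezoid is not a test function. Replacing each corner max(0, x - a) by R((n+1)(x -
  a))/(n+1) gives test functions that converge to it uniformly, while their derivatives converge to
  the two indicators; dominated convergence passes to the limit on both sides.\<close>

lemma weak_derivative_ramp:
  assumes f: "sq_integrable f" and g: "sq_integrable g"
    and weak: "\<And>\<phi>. test_function \<phi> \<Longrightarrow>
     (\<integral>x. f x * vector_derivative \<phi> (at x) \<partial>lborel) = - (\<integral>x. g x * \<phi> x \<partial>lborel)"
    and st: "s \<le> t" and h: "h > 0"
  shows "(LINT x:{s<..s+h}|lborel. f x) - (LINT x:{t<..t+h}|lborel. f x) =
     - (\<integral>x. g x * of_real (ramp s t h x) \<partial>lborel)"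
proof -
  obtain S R :: "real \<Rightarrow> real" where sR: "smooth R" and dR: "\<And>x. (R has_real_derivative S x) (at x)"
    and S: "\<And>x. 0 \<le> S x" "\<And>x. S x \<le> 1" "\<And>x. x \<le> 0 \<Longrightarrow> S x = 0" "\<And>x. x \<ge> 1 \<Longrightarrow> S x = 1"
    and R: "\<And>x. x \<le> 0 \<Longrightarrow> R x = 0" "\<And>x. x \<ge> 1 \<Longrightarrow> R x = R 1 + (x - 1)" "\<And>x. \<bar>R x - max 0 x\<bar> \<le> 1"
    using smooth_ramp_exists by metis
  have [measurable]: "f \<in> borel_measurable borel" "g \<in> borel_measurable borel"
    using f g by (auto intro: sq_integrable_measurable)
  have cR: "continuous_on UNIV R" using dR DERIV_isCont
    by (blast intro: continuous_at_imp_continuous_on)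
  then have [measurable]: "R \<in> borel_measurable borel" by (rule borel_measurable_continuous_onI)
  \<comment> \<open>\<open>S\<close> is the first entry after \<open>R\<close> in a sequence of
    derivatives, hence differentiable and continuous.\<close>
  have Sm[measurable]: "S \<in> borel_measurable borel"
  proof -
    obtain D where D: "D 0 = R" "\<And>n x. (D n has_real_derivative D (Suc n) x) (at x)"
      using sR unfolding smooth_def by blast
    then have "S = D 1" using dR DERIV_unique by (metis One_nat_def ext)
    moreover have "continuous_on UNIV (D 1)" using D DERIV_isCont
      by (blast intro: continuous_at_imp_continuous_on)
    ultimately show ?thesis by (simp add: borel_measurable_continuous_onI)
  qed
  define \<phi> where "\<phi> n x = (1 / real (Suc n)) * R (real (Suc n) * (x - s))
      + (- 1 / real (Suc n)) * R (real (Suc n) * (x - (s + h)))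
     + (- 1 / real (Suc n)) * R (real (Suc n) * (x - t))
         + (1 / real (Suc n)) * R (real (Suc n) * (x - (t + h)))" for n x
  define \<sigma> where "\<sigma> n x = (S (real (Suc n) * (x - s)) - S (real (Suc n) * (x - (s + h))))
     - (S (real (Suc n) * (x - t)) - S (real (Suc n) * (x - (t + h))))" for n x
  have d: "(\<phi> n has_real_derivative \<sigma> n x) (at x)" for n x
  proof -
    have 1: "((\<lambda>x. c / real (Suc n) * R (real (Suc n) * (x - a)))
        has_real_derivative c * S (real (Suc n) * (x - a))) (at x)" for a c
      by (rule derivative_eq_intros refl DERIV_chain2[OF dR] | simp add: field_simps del: of_nat_Suc)+
    have "(\<phi> n has_real_derivative 1 * S (real (Suc n) * (x - s))
        + (- 1) * S (real (Suc n) * (x - (s + h)))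
     + (- 1) * S (real (Suc n) * (x - t)) + 1 * S (real (Suc n) * (x - (t + h)))) (at x)"
      unfolding \<phi>_def[abs_def] by (intro DERIV_add 1)
    moreover have "1 * S (real (Suc n) * (x - s)) + (- 1) * S (real (Suc n) * (x - (s + h)))
     + (- 1) * S (real (Suc n) * (x - t)) + 1 * S (real (Suc n) * (x - (t + h))) = \<sigma> n x"
      by (simp add: \<sigma>_def)
    ultimately show ?thesis by (simp only:)
  qed
  have sm: "smooth (\<phi> n)" for n
    unfolding \<phi>_def[abs_def] by (intro smooth_add smooth_cmult_affine sR)
  have supp: "\<phi> n x = 0" if "x \<notin> {s..t+h+1}" for n x
  proof (cases "x < s")
    case True
    have "real (Suc n) * (x - s) \<le> 0" "real (Suc n) * (x - (s + h)) \<le> 0" "real (Suc n) * (x - t) \<le> 0"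
       "real (Suc n) * (x - (t + h)) \<le> 0"
      using True st h by (intro mult_nonneg_nonpos; simp)+
    then show ?thesis unfolding \<phi>_def by (simp only: R(1))
  next
    case False
    then have x: "x > t + h + 1" using that by auto
    have "1 * 1 \<le> real (Suc n) * (x - s)" "1 * 1 \<le> real (Suc n) * (x - (s + h))" "1 * 1
        \<le> real (Suc n) * (x - t)"
       "1 * 1 \<le> real (Suc n) * (x - (t + h))"
      using x st h by (intro mult_mono; simp)+
    then have eqs: "R (real (Suc n) * (x - s)) = R 1 + (real (Suc n) * (x - s) - 1)"
      "R (real (Suc n) * (x - (s + h))) = R 1 + (real (Suc n) * (x - (s + h)) - 1)"
      "R (real (Suc n) * (x - t)) = R 1 + (real (Suc n) * (x - t) - 1)"
      "R (real (Suc n) * (x - (t + h))) = R 1 + (real (Suc n) * (x - (t + h)) - 1)"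
      by (auto intro: R(2))
    \<comment> \<open>To the right of the support all four ramps are affine. Their signs are +, -,
      -, +, so \<open>R 1\<close> and the constants 1 drop out, and so do the linear parts.\<close>
    then have "\<phi> n x = (1 / real (Suc n)) * (real (Suc n) * (x - s) - real (Suc n) * (x - (s + h))
       - real (Suc n) * (x - t) + real (Suc n) * (x - (t + h)))"
      unfolding \<phi>_def eqs by (simp only: divide_inverse ring_distribs)
    also have "\<dots> = 0" by (simp add: algebra_simps)
    finally show ?thesis .
  qed
  have ramp_lim: "\<bar>\<phi> n x - ramp s t h x\<bar> \<le> 4 * inverse (real (Suc n))" for n x
  proof -
    have 1: "\<bar>1 / real (Suc n) * R (real (Suc n) * y) - max 0 y\<bar> \<le> inverse (real (Suc n))" for y
    proof -
      have "max 0 (real (Suc n) * y) = real (Suc n) * max 0 y"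
        by (simp add: max_def mult_le_0_iff zero_le_mult_iff)
      then have "1 / real (Suc n) * R (real (Suc n) * y) - max 0 y
          = inverse (real (Suc n)) * (R (real (Suc n) * y) - max 0 (real (Suc n) * y))"
        by (simp add: field_simps del: of_nat_Suc)
      then show ?thesis using R(3)[of "real (Suc n) * y"] by (simp add: abs_mult mult_left_le)
    qed
    show ?thesis
      using 1[of "x - s"] 1[of "x - (s + h)"] 1[of "x - t"] 1[of "x - (t + h)"]
      unfolding \<phi>_def ramp_def by (simp add: abs_le_iff)
  qed
  have weak_n: "(\<integral>x. f x * of_real (\<sigma> n x) \<partial>lborel) = - (\<integral>x. g x * of_real (\<phi> n x) \<partial>lborel)" for n
  proof -
    have "vector_derivative (\<lambda>x. complex_of_real (\<phi> n x)) (at x) = of_real (\<sigma> n x)" for x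
      using d by (intro vector_derivative_at has_vector_derivative_of_real)
        (simp add: has_real_derivative_iff_has_vector_derivative)
    with weak[OF test_function_smooth[OF sm[of n] supp[where n=n]]] show ?thesis by simp
  qed
  have "(\<lambda>n. (\<integral>x. f x * of_real (S (real (Suc n) * (x - s)) - S (real (Suc n) * (x - (s + h)))) \<partial>lborel)
       - (\<integral>x. f x * of_real (S (real (Suc n) * (x - t)) - S (real (Suc n) * (x - (t + h)))) \<partial>lborel))
     \<longlonglongrightarrow> (LINT x:{s<..s+h}|lborel. f x) - (LINT x:{t<..t+h}|lborel. f x)"
    using h by (intro tendsto_diff step_limit S f Sm) auto
  moreover have "(\<integral>x. f x * of_real (S (real (Suc n) * (x - s))
      - S (real (Suc n) * (x - (s + h)))) \<partial>lborel)
       - (\<integral>x. f x * of_real (S (real (Suc n) * (x - t)) - S (real (Suc n) * (x - (t + h)))) \<partial>lborel)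
      = (\<integral>x. f x * of_real (\<sigma> n x) \<partial>lborel)" for n
  proof (subst Bochner_Integration.integral_diff[symmetric])
    show "integrable lborel (\<lambda>x. f x * of_real (S (real (Suc n) * (x - s))
        - S (real (Suc n) * (x - (s + h)))))"
      using h by (intro step_limit S f Sm) auto
    show "integrable lborel (\<lambda>x. f x * of_real (S (real (Suc n) * (x - t))
        - S (real (Suc n) * (x - (t + h)))))"
      using h by (intro step_limit S f Sm) auto
  qed (simp add: \<sigma>_def ring_distribs)
  ultimately have lim_f: "(\<lambda>n. \<integral>x. f x * of_real (\<sigma> n x) \<partial>lborel)
     \<longlonglongrightarrow> (LINT x:{s<..s+h}|lborel. f x) - (LINT x:{t<..t+h}|lborel. f x)" by simp
  have lim_r: "(\<lambda>n. \<phi> n x) \<longlonglongrightarrow> ramp s t h x" for x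
  proof (rule Lim_transform2[OF tendsto_const], rule Lim_null_comparison)
    show "\<forall>\<^sub>F n in sequentially. norm (ramp s t h x - \<phi> n x) \<le> 4 * inverse (real (Suc n))"
      using ramp_lim by (simp add: abs_minus_commute)
    show "(\<lambda>n. 4 * inverse (real (Suc n))) \<longlonglongrightarrow> 0"
      using tendsto_mult_right_zero[OF LIMSEQ_inverse_real_of_nat, of 4] by simp
  qed
  \<comment> \<open>In the dominating constant, 4 bounds the distance of \<open>\<phi> n\<close>
    from the trapezoid, and each of the four maxima in \<open>ramp\<close> is at most t + h + 2 - s
    on the enlarged interval.\<close>
  have lim_g: "(\<lambda>n. \<integral>x. g x * of_real (\<phi> n x) \<partial>lborel) \<longlonglongrightarrow> (\<integral>x. g x * of_real (ramp s t h x) \<partial>lborel)"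
  proof (rule integral_dominated_convergence[where w="\<lambda>x. (4
      + 4 * (t + h + 2 - s)) * norm (indicat_real {s - 1<..t + h + 1} x *\<^sub>R g x)"])
    show "(\<lambda>x. g x * of_real (ramp s t h x)) \<in> borel_measurable lborel"
      unfolding ramp_def[abs_def] by measurable
    show "(\<lambda>x. g x * of_real (\<phi> n x)) \<in> borel_measurable lborel" for n
      unfolding \<phi>_def[abs_def] by measurable
    show "integrable lborel (\<lambda>x. (4 + 4 * (t + h + 2 - s)) * norm (indicat_real {s - 1<..t + h
        + 1} x *\<^sub>R g x))"
      using sq_integrable_set_integrable[OF g] unfolding set_integrable_def
      by (intro integrable_mult_right integrable_norm) auto
    show "AE x in lborel. (\<lambda>n. g x * of_real (\<phi> n x)) \<longlonglongrightarrow> g x * of_real (ramp s t h x)"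
      by (intro AE_I2 tendsto_intros lim_r)
    show "AE x in lborel. norm (g x * of_real (\<phi> n x))
        \<le> (4 + 4 * (t + h + 2 - s)) * norm (indicat_real {s - 1<..t + h + 1} x *\<^sub>R g x)" for n
    proof (intro AE_I2)
      fix x
      show "norm (g x * of_real (\<phi> n x))
          \<le> (4 + 4 * (t + h + 2 - s)) * norm (indicat_real {s - 1<..t + h + 1} x *\<^sub>R g x)"
      proof (cases "x \<in> {s - 1<..t + h + 1}")
        case False
        then have "\<phi> n x = 0" by (intro supp) auto
        then show ?thesis using st h by simp
      next
        case True
        have "inverse (real (Suc n)) \<le> 1" by (simp add: field_simps)
        then have "\<bar>\<phi> n x\<bar> \<le> 4 + \<bar>ramp s t h x\<bar>" using ramp_lim[of n x] by linarith
        also have "\<bar>ramp s t h x\<bar> \<le> 4 * (t + h + 2 - s)"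
          using True st h unfolding ramp_def by (auto simp: max_def)
        finally have "\<bar>\<phi> n x\<bar> * norm (g x) \<le> (4 + 4 * (t + h + 2 - s)) * norm (g x)"
          by (intro mult_right_mono) auto
        then show ?thesis using True by (simp add: norm_mult mult.commute)
      qed
    qed
  qed
  have "(\<lambda>n. - (\<integral>x. g x * of_real (\<phi> n x) \<partial>lborel)) \<longlonglongrightarrow> (LINT x:{s<..s+h}|lborel. f x)
      - (LINT x:{t<..t+h}|lborel. f x)"
    using lim_f weak_n by simp
  with tendsto_minus[OF lim_g] show ?thesis using LIMSEQ_unique by blast
qed

section \<open>Weak derivatives of square-integrable functions\<close>

text \<open>Passes from Lebesgue to gauge integrals, for which the differentiation theorem used in
  \<open>Lebesgue_points\<close> is stated.\<close>

lemma LINT_Ioc_eq_integral: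
  assumes g: "sq_integrable g"
  shows "g integrable_on {a..b}" "(LINT x:{a<..b}|lborel. g x) = integral {a..b} g"
proof -
  have [measurable]: "g \<in> borel_measurable borel" using g by (rule sq_integrable_measurable)
  have i: "set_integrable lborel {a..b} g"
    by (rule set_integrable_subset[OF sq_integrable_set_integrable[OF g, of "a - 1" b]]) auto
  show "g integrable_on {a..b}" using set_borel_integral_eq_integral(1)[OF i] .
  have "(LINT x:{a<..b}|lborel. g x) = (LINT x:{a..b}|lborel. g x)"
    unfolding set_lebesgue_integral_def
  proof (rule integral_cong_AE)
    show "AE x in lborel. indicat_real {a<..b} x *\<^sub>R g x = indicat_real {a..b} x *\<^sub>R g x"
      using AE_lborel_singleton[of a] by eventually_elim (auto simp: indicator_def)
  qed measurable
  also have "\<dots> = integral {a..b} g" using set_borel_integral_eq_integral(2)[OF i] .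
  finally show "(LINT x:{a<..b}|lborel. g x) = integral {a..b} g" .
qed

lemma AE_lborel_if_negligible:
  assumes "negligible N"
  shows "AE x in lborel. x \<notin> N"
proof -
  have "N \<in> null_sets lebesgue" using assms by (simp add: negligible_iff_null_sets)
  then have "AE x in lebesgue. x \<notin> N" by (rule AE_not_in)
  then show ?thesis by (simp add: AE_completion_iff)
qed

text \<open>One-sided averages of length 1/(n+1) are exactly what trapezoids of that width produce
  on the side of \<open>f\<close>.\<close>

lemma Lebesgue_points:
  assumes g: "sq_integrable g"
  shows "AE x in lborel. (\<lambda>n. real (Suc n) *\<^sub>R (LINT y:{x<..x + 1 / real (Suc n)}|lborel. g y)) \<longlonglongrightarrow> g x"
proof -
  have "g integrable_on cbox a b" for a b using LINT_Ioc_eq_integral(1)[OF g] by simp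
  then obtain N where N: "negligible N" and
    lim: "\<And>x e. \<lbrakk>x \<notin> N; 0 < e\<rbrakk> \<Longrightarrow> \<exists>d>0. \<forall>h. 0 < h \<and> h < d \<longrightarrow>
         norm (integral (cbox x (x + h *\<^sub>R One)) g /\<^sub>R h ^ DIM(real) - g x) < e"
    using integrable_ccontinuous_explicit by blast
  show ?thesis using AE_lborel_if_negligible[OF N]
  proof (rule AE_mp, intro AE_I2 impI LIMSEQ_I)
    fix x and e :: real assume "x \<notin> N" "0 < e"
    from lim[OF this] obtain d where d: "d > 0"
      "\<And>h. 0 < h \<Longrightarrow> h < d \<Longrightarrow> norm (integral {x..x + h} g /\<^sub>R h - g x) < e" by auto
    obtain M where M: "1 / real (Suc M) < d" using nat_approx_posE[OF d(1)] by blast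
    have "norm (real (Suc n) *\<^sub>R (LINT y:{x<..x + 1 / real (Suc n)}|lborel. g y) - g x) < e"
      if "n \<ge> M" for n
    proof -
      have "1 / real (Suc n) \<le> 1 / real (Suc M)" using that by (intro divide_left_mono) auto
      then have "1 / real (Suc n) < d" using M by simp
      from d(2)[OF _ this] show ?thesis by (simp add: LINT_Ioc_eq_integral(2)[OF g] del: of_nat_Suc)
    qed
    then show "\<exists>no. \<forall>n\<ge>no. norm (real (Suc n) *\<^sub>R (LINT y:{x<..x + 1 / real (Suc n)}|lborel. g y)
        - g x) < e"
      by blast
  qed
qed

lemma LINT_Ioc_add:
  assumes g: "sq_integrable g" and "a \<le> b" "b \<le> c"
  shows "(LINT x:{a<..c}|lborel. g x) = (LINT x:{a<..b}|lborel. g x) + (LINT x:{b<..c}|lborel. g x)"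
proof -
  have "{a<..c} = {a<..b} \<union> {b<..c}" using assms by auto
  then show ?thesis using sq_integrable_set_integrable[OF g] by (simp add: set_integral_Un)
qed

text \<open>Continuity comes for free: for square-integrable \<open>g\<close> the increments are
  Hoelder continuous of exponent 1/2.\<close>

lemma has_ac_derivativeI:
  assumes g: "sq_integrable g" and eq: "\<And>a b. a \<le> b \<Longrightarrow> f b - f a = (LINT x:{a<..b}|lborel. g x)"
  shows "has_ac_derivative f g"
proof -
  note le = Hoelder_of_increments[OF g eq]
  have "(f \<longlongrightarrow> f x) (at x)" for x
  proof (rule LIM_zero_cancel, rule Lim_null_comparison)
    show "\<forall>\<^sub>F y in at x. norm (f y - f x) \<le> sqrt \<bar>y - x\<bar> * norm (abs_L2 g)" using le by simp
    have "((\<lambda>y. sqrt \<bar>y - x\<bar> * norm (abs_L2 g)) \<longlongrightarrow> sqrt \<bar>x - x\<bar> * norm (abs_L2 g)) (at x)"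
      by (intro tendsto_intros)
    then show "((\<lambda>y. sqrt \<bar>y - x\<bar> * norm (abs_L2 g)) \<longlongrightarrow> 0) (at x)" by simp
  qed
  then have "continuous_on UNIV f" by (simp add: continuous_on_def)
  then show ?thesis unfolding has_ac_derivative_def
    using eq sq_integrable_set_integrable[OF g] sq_integrable_measurable[OF g] by blast
qed

text \<open>Take \<open>s\<close> and \<open>t\<close> among the Lebesgue points of \<open>f\<close>
  and trapezoids of width 1/(n+1), scaled by n+1. The left side of
  \<open>weak_derivative_ramp\<close> tends to f(s) - f(t), the right side to minus the integral of
  \<open>g\<close> over (s, t]. So \<open>f\<close> obeys the increment formula on a set of full
  measure.\<close>

lemma weak_derivative_imp_ac:
  assumes f: "sq_integrable f" and g: "sq_integrable g"
    and weak: "\<And>\<phi>. test_function \<phi> \<Longrightarrow>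
     (\<integral>x. f x * vector_derivative \<phi> (at x) \<partial>lborel) = - (\<integral>x. g x * \<phi> x \<partial>lborel)"
  obtains U where "has_ac_derivative U g" "AE x in lborel. f x = U x"
proof -
  define L where "L = {x. (\<lambda>n. real (Suc n) *\<^sub>R (LINT y:{x<..x + 1 / real (Suc n)}|lborel. f y)) \<longlonglongrightarrow> f x}"
  have L: "AE x in lborel. x \<in> L" using Lebesgue_points[OF f] by (simp add: L_def)
  have main: "f t - f s = (LINT x:{s<..t}|lborel. g x)" if s: "s \<in> L" and t: "t \<in> L" and st: "s \<le> t"
    for s t
  proof -
    \<comment> \<open>The clamp of y to [0, 1]. The scaled trapezoid is a difference of two scaled
      clamps, so \<open>step_limit\<close> applies once more.\<close>
    define C where "C y = max 0 y - max 0 (y - 1)" for y :: real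
    have C: "(\<lambda>n. \<integral>x. g x * of_real (C (real (Suc n) * (x - s)) - C (real (Suc n) * (x - t))) \<partial>lborel)
        \<longlonglongrightarrow> (LINT x:{s<..t}|lborel. g x)"
      by (rule step_limit) (use g st in \<open>auto simp: C_def[abs_def] max_def\<close>)
    have eq: "real (Suc n) *\<^sub>R (LINT x:{s<..s + 1 / real (Suc n)}|lborel. f x)
        - real (Suc n) *\<^sub>R (LINT x:{t<..t + 1 / real (Suc n)}|lborel. f x)
       = - (\<integral>x. g x * of_real (C (real (Suc n) * (x - s)) - C (real (Suc n) * (x - t))) \<partial>lborel)" for n
    proof -
      have m: "real (Suc n) * max 0 y = max 0 (real (Suc n) * y)" for y
        by (simp add: max_def mult_le_0_iff zero_le_mult_iff)
      have e: "real (Suc n) * ramp s t (1 / real (Suc n)) x = C (real (Suc n) * (x - s))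
          - C (real (Suc n) * (x - t))" for x
        unfolding ramp_def C_def by (simp add: m ring_distribs del: of_nat_Suc)
      have "g x * of_real (C (real (Suc n) * (x - s)) - C (real (Suc n) * (x - t)))
          = real (Suc n) *\<^sub>R (g x * of_real (ramp s t (1 / real (Suc n)) x))" for x
        unfolding e[symmetric] of_real_mult scaleR_conv_of_real by (rule mult.left_commute)
      then have "(\<integral>x. g x * of_real (C (real (Suc n) * (x - s)) - C (real (Suc n) * (x - t))) \<partial>lborel)
          = real (Suc n) *\<^sub>R (\<integral>x. g x * of_real (ramp s t (1 / real (Suc n)) x) \<partial>lborel)"
        by (simp only: integral_scaleR_right)
      also have "\<dots> = - (real (Suc n) *\<^sub>R ((LINT x:{s<..s + 1 / real (Suc n)}|lborel. f x)
          - (LINT x:{t<..t + 1 / real (Suc n)}|lborel. f x)))"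
        by (subst weak_derivative_ramp[OF f g weak st]) auto
      finally show ?thesis by (simp add: scaleR_diff_right del: of_nat_Suc)
    qed
    have "(\<lambda>n. real (Suc n) *\<^sub>R (LINT x:{s<..s + 1 / real (Suc n)}|lborel. f x)
        - real (Suc n) *\<^sub>R (LINT x:{t<..t + 1 / real (Suc n)}|lborel. f x))
      \<longlonglongrightarrow> f s - f t"
      using s t unfolding L_def by (intro tendsto_diff) auto
    then have "(\<lambda>n. - (\<integral>x. g x * of_real (C (real (Suc n) * (x - s))
        - C (real (Suc n) * (x - t))) \<partial>lborel)) \<longlonglongrightarrow> f s - f t"
      by (simp only: eq)
    from LIMSEQ_unique[OF this tendsto_minus[OF C]] show ?thesis by (simp add: algebra_simps)
  qed
  have "\<exists>s. s \<in> L"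
  proof (rule ccontr)
    assume "\<nexists>s. s \<in> L"
    then have "AE x::real in lborel. False" using L by simp
    then show False by (simp add: AE_iff_null emeasure_lborel_UNIV null_sets_def)
  qed
  then obtain s where s: "s \<in> L" ..
  \<comment> \<open>The increment formula extends \<open>f\<close> from one Lebesgue point in both
    directions, so \<open>U\<close> agrees with \<open>f\<close> on all of \<open>L\<close>.\<close>
  define U where "U x = f s + (if s \<le> x then (LINT y:{s<..x}|lborel. g y) else
      - (LINT y:{x<..s}|lborel. g y))" for x
  have "U b - U a = (LINT x:{a<..b}|lborel. g x)" if "a \<le> b" for a b
    using that LINT_Ioc_add[OF g, of s a b] LINT_Ioc_add[OF g, of a s b] LINT_Ioc_add[OF g, of a b s]
    by (auto simp: U_def)
  then have "has_ac_derivative U g" by (rule has_ac_derivativeI[OF g])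
  moreover have "AE x in lborel. f x = U x"
    using L
  proof (rule AE_mp, intro AE_I2 impI)
    fix x assume "x \<in> L"
    then show "f x = U x" using main[OF s, of x] main[of x s] s by (auto simp: U_def algebra_simps)
  qed
  ultimately show thesis by (rule that)
qed

lemma sq_integrable_continuous_compact:
  assumes c: "continuous_on UNIV f" and supp: "\<And>x. x \<notin> {a<..b} \<Longrightarrow> f x = 0"
  shows "sq_integrable f"
proof -
  have "compact (f ` {a..b})" using c
      by (intro compact_continuous_image) (auto intro: continuous_on_subset)
  then have "bounded (f ` {a..b})" by (rule compact_imp_bounded)
  then obtain B where B: "\<forall>x\<in>{a..b}. norm (f x) \<le> B" unfolding bounded_iff by auto
  have bd: "norm (f x) \<le> max B 0" for x
    using B supp[of x] by (cases "x \<in> {a<..b}") (auto simp: le_max_iff_disj)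
  have "sq_integrable (\<lambda>x. f x * of_real (indicat_real {a<..b} x))"
    using c bd by (intro sq_integrable_mult_bounded sq_integrable_indicator borel_measurable_continuous_onI)
  moreover have "(\<lambda>x. f x * of_real (indicat_real {a<..b} x)) = f"
  proof
    fix x show "f x * of_real (indicat_real {a<..b} x) = f x"
      using supp[of x] by (cases "x \<in> {a<..b}") auto
  qed
  ultimately show ?thesis by simp
qed

lemma test_function_props:
  assumes t: "test_function \<phi>"
  shows "has_ac_derivative \<phi> (\<lambda>x. vector_derivative \<phi> (at x))"
    "sq_integrable \<phi>" "sq_integrable (\<lambda>x. vector_derivative \<phi> (at x))"
        "sq_integrable (\<lambda>x. of_real x * \<phi> x)"
proof -
  define \<phi>' where "\<phi>' x = vector_derivative \<phi> (at x)" for x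
  have d: "(((\<lambda>f y. vector_derivative f (at y)) ^^ n) \<phi>) differentiable (at x)" for n x
    using t unfolding test_function_def by blast
  have d1: "(\<phi> has_vector_derivative \<phi>' x) (at x)" for x
    using d[of 0 x] by (simp add: \<phi>'_def vector_derivative_works)
  have d2: "\<phi>' differentiable (at x)" for x
    using d[of 1 x] by (simp add: \<phi>'_def[abs_def])
  have c1: "continuous_on UNIV \<phi>"
    using d1 by (auto intro!: continuous_at_imp_continuous_on has_vector_derivative_continuous)
  have c2: "continuous_on UNIV \<phi>'"
    using d2 by (auto intro!: continuous_at_imp_continuous_on differentiable_imp_continuous_within)
  have "bounded (closure {x. \<phi> x \<noteq> 0})" using t compact_imp_bounded unfolding test_function_def by blast
  then obtain B where B: "\<forall>x\<in>closure {x. \<phi> x \<noteq> 0}. norm x \<le> B" unfolding bounded_iff by blast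
  \<comment> \<open>The support lies in [-B, B]; the margin 1 makes the half-open interval contain
    it, left endpoint included.\<close>
  have out: "x \<notin> closure {x. \<phi> x \<noteq> 0}" if "x \<notin> {-B-1<..B+1}" for x
  proof
    assume "x \<in> closure {x. \<phi> x \<noteq> 0}"
    with B have "norm x \<le> B" by (rule bspec)
    then show False using that by auto
  qed
  have zero: "\<phi> x = 0" if "x \<notin> closure {x. \<phi> x \<noteq> 0}" for x
    using that closure_subset[of "{x. \<phi> x \<noteq> 0}"] by blast
  have z: "\<phi> x = 0" if "x \<notin> {-B-1<..B+1}" for x
    using zero[OF out[OF that]] .
  have z': "\<phi>' x = 0" if "x \<notin> {-B-1<..B+1}" for x
  proof -
    have "(\<phi> has_vector_derivative 0) (at x)"
    proof (rule has_vector_derivative_transform_within_open)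
      show "((\<lambda>_. 0) has_vector_derivative 0) (at x)" by simp
      show "open (- closure {x. \<phi> x \<noteq> 0})" by (intro open_Compl closed_closure)
      show "x \<in> - closure {x. \<phi> x \<noteq> 0}" unfolding Compl_iff by (rule out[OF that])
      show "0 = \<phi> y" if "y \<in> - closure {x. \<phi> x \<noteq> 0}" for y
        using zero[OF ComplD[OF that]] by (rule sym)
    qed
    then show ?thesis unfolding \<phi>'_def by (rule vector_derivative_at)
  qed
  show "has_ac_derivative \<phi> (\<lambda>x. vector_derivative \<phi> (at x))"
    unfolding \<phi>'_def[symmetric] using d1 c2 by (rule has_ac_derivative_C1)
  show "sq_integrable \<phi>" using c1 z by (rule sq_integrable_continuous_compact)
  show "sq_integrable (\<lambda>x. vector_derivative \<phi> (at x))"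
    unfolding \<phi>'_def[symmetric] using c2 z' by (rule sq_integrable_continuous_compact)
  show "sq_integrable (\<lambda>x. of_real x * \<phi> x)"
    by (rule sq_integrable_continuous_compact[of _ "-B-1"
        "B+1"]) (use z in \<open>auto intro!: continuous_intros c1\<close>)
qed

lemma ac_product_integral:
  assumes f: "has_ac_derivative f f'" "sq_integrable f" "sq_integrable f'"
    and g: "has_ac_derivative g g'" "sq_integrable g" "sq_integrable g'"
  shows "(\<integral>x. f' x * g x \<partial>lborel) + (\<integral>x. f x * g' x \<partial>lborel) = 0"
proof -
  have i: "integrable lborel (\<lambda>x. f' x * g x)" "integrable lborel (\<lambda>x. f x * g' x)"
    using f g by (auto intro: integrable_mult_sq_integrable)
  have "(\<integral>x. f' x * g x + f x * g' x \<partial>lborel) = 0"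
    by (rule has_ac_derivative_integral_eq_0[OF has_ac_derivative_mult[OF f(1) g(1)]])
      (use i f g in \<open>auto intro: integrable_mult_sq_integrable\<close>)
  then show ?thesis using i by simp
qed

lemma has_weak_derivative_abs_L2:
  "sq_integrable f \<Longrightarrow> sq_integrable g \<Longrightarrow> has_weak_derivative (abs_L2 f) (abs_L2 g) \<longleftrightarrow>
    (\<forall>\<phi>. test_function \<phi> \<longrightarrow>
     (\<integral>x. f x * vector_derivative \<phi> (at x) \<partial>lborel) = - (\<integral>x. g x * \<phi> x \<partial>lborel))"
  by (rule has_weak_derivative.abs_eq) (simp_all add: L2_rel_refl_iff)

lemma has_weak_derivative_ac:
  assumes "has_ac_derivative f g" "sq_integrable f" "sq_integrable g"
  shows "has_weak_derivative (abs_L2 f) (abs_L2 g)"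
  using assms ac_product_integral[OF assms test_function_props(1,2,3)]
  by (auto simp: has_weak_derivative_abs_L2 add.commute eq_neg_iff_add_eq_0)

lemma has_weak_derivative_cases:
  assumes "has_weak_derivative u v"
  obtains f g where "has_ac_derivative f g" "sq_integrable f" "sq_integrable g" "u = abs_L2 f" "v
      = abs_L2 g"
proof -
  define f where "f = rep_L2 u"
  define g where "g = rep_L2 v"
  have fg: "sq_integrable f" "u = abs_L2 f" "sq_integrable g" "v = abs_L2 g"
    by (simp_all add: f_def g_def)
  obtain U where U: "has_ac_derivative U g" "AE x in lborel. f x = U x"
  proof (rule weak_derivative_imp_ac[OF fg(1,3)])
    show "(\<integral>x. f x * vector_derivative \<phi> (at x) \<partial>lborel) = - (\<integral>x. g x * \<phi> x \<partial>lborel)"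
      if "test_function \<phi>" for \<phi>
      using assms that unfolding fg(2,4) has_weak_derivative_abs_L2[OF fg(1,3)] by blast
  qed
  have "sq_integrable U"
      using sq_integrable_cong_AE[OF fg(1) U(2)] has_ac_derivative_measurable U(1) by blast
  moreover have "u = abs_L2 U" unfolding fg(2) using fg(1) calculation U(2) by (rule abs_L2_eqI)
  ultimately show thesis using that U(1) fg(3,4) by blast
qed

text \<open>A continuous representative that vanishes almost everywhere vanishes everywhere. All
  interval integrals of its derivative are then 0, and so is the derivative at its Lebesgue points.
  This justifies the definite description in \<open>weak_derivative\<close>.\<close>

lemma has_weak_derivative_zero_unique:
  assumes "has_weak_derivative 0 v" shows "v = 0"
proof -
  obtain f g where fg: "has_ac_derivative f g" "sq_integrable f" "sq_integrable g" "0 = abs_L2 f" "v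
      = abs_L2 g"
    using has_weak_derivative_cases[OF assms] by blast
  have "AE x in lborel. f x = 0"
    using fg(4)[symmetric] unfolding zero_eq_abs_L2 abs_L2_eq_iff[OF fg(2) sq_integrable_zero] .
  then have "{x. f x \<noteq> 0} \<in> null_sets lborel"
    using has_ac_derivative_measurable(1)[OF fg(1)] by (subst (asm) AE_iff_null) auto
  then have "negligible {x. f x \<noteq> 0}"
    by (simp add: negligible_iff_null_sets null_sets_completionI)
  moreover have "open {x. f x \<noteq> 0}"
    using has_ac_derivative_continuous[OF fg(1)] by (intro open_Collect_neq continuous_on_const)
  ultimately have "f x = 0" for x using open_not_negligible by blast
  then have z: "(LINT x:{a<..b}|lborel. g x) = 0" if "a \<le> b" for a b
    using has_ac_derivativeD(2)[OF fg(1) that] by simp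
  have "AE x in lborel. g x = 0"
    using Lebesgue_points[OF fg(3)]
  proof (rule AE_mp, intro AE_I2 impI)
    fix x assume "(\<lambda>n. real (Suc n) *\<^sub>R (LINT y:{x<..x + 1 / real (Suc n)}|lborel. g y)) \<longlonglongrightarrow> g x"
    then show "g x = 0" by (simp add: z LIMSEQ_const_iff)
  qed
  then show ?thesis
    unfolding fg(5) zero_eq_abs_L2 abs_L2_eq_iff[OF fg(3) sq_integrable_zero] .
qed

section \<open>Weak derivatives by duality, and the position operator\<close>

text \<open>Integration by parts on the whole line: boundary terms vanish because the product of the
  representatives and its derivative are integrable.\<close>

lemma has_weak_derivative_inner:
  assumes "has_weak_derivative u u'" "has_weak_derivative w w'"
  shows "u' \<bullet> w + u \<bullet> w' = 0"
proof -
  obtain f f' where f: "has_ac_derivative f f'" "sq_integrable f" "sq_integrable f'" "u = abs_L2 f"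
      "u' = abs_L2 f'"
    using has_weak_derivative_cases[OF assms(1)] .
  obtain g g' where g: "has_ac_derivative g g'" "sq_integrable g" "sq_integrable g'" "w = abs_L2 g"
      "w' = abs_L2 g'"
    using has_weak_derivative_cases[OF assms(2)] .
  have "(\<integral>x. f' x * cnj (g x) \<partial>lborel) + (\<integral>x. f x * cnj (g' x) \<partial>lborel) = 0"
    by (intro ac_product_integral f has_ac_derivative_cnj sq_integrable_cnj g)
  then have "Re (\<integral>x. f' x * cnj (g x) \<partial>lborel) + Re (\<integral>x. f x * cnj (g' x) \<partial>lborel) = 0"
    by (simp only: zero_complex.sel flip: plus_complex.sel)
  then show ?thesis unfolding f(4,5) g(4,5) by (simp only: inner_abs_L2_Re f g)
qed

lemma L2_weighted_abs_L2: "sq_integrable f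
    \<Longrightarrow> abs_L2 f \<in> L2_weighted \<longleftrightarrow> sq_integrable (\<lambda>x. of_real x * f x)"
  unfolding L2_weighted_def mem_Collect_eq
      by (rule in_L2_weighted.abs_eq) (simp_all add: L2_rel_refl_iff)

lemma position_abs_L2:
  assumes "sq_integrable f" "sq_integrable (\<lambda>x. of_real x * f x)"
  shows "position (abs_L2 f) = abs_L2 (\<lambda>x. of_real x * f x)"
proof -
  have "position (abs_L2 f)
      = abs_L2 (if sq_integrable (\<lambda>x. of_real x * f x) then (\<lambda>x. of_real x * f x) else (\<lambda>_. 0))"
    by (rule position.abs_eq) (simp_all add: L2_rel_refl_iff assms(1))
  then show ?thesis using assms(2) by simp
qed

lemma has_weak_derivativeI:
  assumes "\<And>w w'. has_weak_derivative w w' \<Longrightarrow> w \<in> L2_weighted \<Longrightarrow> v \<bullet> w + u \<bullet> w' = 0"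
  shows "has_weak_derivative u v"
proof -
  define f where "f = rep_L2 u"
  define g where "g = rep_L2 v"
  have f: "sq_integrable f" "u = abs_L2 f" and g: "sq_integrable g" "v = abs_L2 g"
    by (simp_all add: f_def g_def)
  have "(\<integral>x. f x * vector_derivative \<phi> (at x) \<partial>lborel) = - (\<integral>x. g x * \<phi> x \<partial>lborel)" if t:
      "test_function \<phi>" for \<phi>
  proof -
    define \<phi>' where "\<phi>' x = vector_derivative \<phi> (at x)" for x
    note tp = test_function_props[OF t, folded \<phi>'_def]
    define I where "I = (\<integral>x. g x * \<phi> x \<partial>lborel) + (\<integral>x. f x * \<phi>' x \<partial>lborel)"
    \<comment> \<open>The inner product sees real parts only; the cases c = 1 and c =
      \<open>\<i>\<close> together determine \<open>I\<close>.\<close>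
    have "Re (c * I) = 0" for c
    proof -
      define \<psi> where "\<psi> x = cnj (c * \<phi> x)" for x
      define \<psi>' where "\<psi>' x = cnj (c * \<phi>' x)" for x
      have ac: "has_ac_derivative \<psi> \<psi>'"
      proof -
        have "has_ac_derivative (\<lambda>x. c) (\<lambda>x. 0)" by (rule has_ac_derivative_C1) auto
        from has_ac_derivative_cnj[OF has_ac_derivative_mult[OF this tp(1)]]
        show ?thesis by (simp add: \<psi>_def[abs_def] \<psi>'_def[abs_def])
      qed
      have sq: "sq_integrable \<psi>" "sq_integrable \<psi>'"
        unfolding \<psi>_def[abs_def] \<psi>'_def[abs_def]
          by (intro sq_integrable_cnj sq_integrable_mult_left tp)+
      have "sq_integrable (\<lambda>x. cnj (c * (of_real x * \<phi> x)))"
        by (intro sq_integrable_cnj sq_integrable_mult_left tp)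
      then have "sq_integrable (\<lambda>x. of_real x * \<psi> x)" by (simp add: \<psi>_def mult_ac)
      then have "abs_L2 \<psi> \<in> L2_weighted" using L2_weighted_abs_L2 sq by blast
      with has_weak_derivative_ac[OF ac sq] have "v \<bullet> abs_L2 \<psi> + u \<bullet> abs_L2 \<psi>' = 0" by (rule assms)
      then have "Re (\<integral>x. g x * cnj (\<psi> x) \<partial>lborel) + Re (\<integral>x. f x * cnj (\<psi>' x) \<partial>lborel) = 0"
        unfolding f(2) g(2) by (simp only: inner_abs_L2_Re f g sq)
      moreover have "g x * cnj (\<psi> x) = c * (g x * \<phi> x)" "f x * cnj (\<psi>' x) = c * (f x * \<phi>' x)" for x
        by (simp_all add: \<psi>_def \<psi>'_def)
      ultimately have "Re (c * (\<integral>x. g x * \<phi> x \<partial>lborel)) + Re (c * (\<integral>x. f x * \<phi>' x \<partial>lborel)) = 0"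
        by (simp only: integral_mult_right_zero)
      then show "Re (c * I) = 0" by (simp only: I_def distrib_left plus_complex.sel)
    qed
    from this[of 1] this[of \<i>] have "I = 0" by (simp add: complex_eq_iff)
    then show ?thesis unfolding I_def \<phi>'_def by (simp add: add_eq_0_iff)
  qed
  then show ?thesis unfolding f(2) g(2) has_weak_derivative_abs_L2[OF f(1) g(1)] by blast
qed

lemma has_weak_derivative_add:
  assumes "has_weak_derivative u u'" "has_weak_derivative v v'"
  shows "has_weak_derivative (u + v) (u' + v')"
proof (rule has_weak_derivativeI)
  fix w w' assume w: "has_weak_derivative w w'"
  show "(u' + v') \<bullet> w + (u + v) \<bullet> w' = 0"
    using has_weak_derivative_inner[OF assms(1) w] has_weak_derivative_inner[OF assms(2) w]
    by (simp add: inner_add_left)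
qed

lemma inner_L2_scaleC_left: "(c *\<^sub>C u) \<bullet> v = u \<bullet> (cnj c *\<^sub>C v)" for u v :: L2
proof -
  obtain f g where f: "sq_integrable f" "u = abs_L2 f" and g: "sq_integrable g" "v = abs_L2 g"
    using L2_cases[of u thesis] L2_cases[of v thesis] by blast
  show ?thesis unfolding f(2) g(2)
    by (simp add: scaleC_abs_L2 inner_abs_L2_Re f g sq_integrable_mult_left mult_ac)
qed

lemma inner_L2_scaleC_right: "u \<bullet> (c *\<^sub>C v) = (cnj c *\<^sub>C u) \<bullet> v" for u v :: L2
  by (simp add: inner_L2_scaleC_left)

lemma has_weak_derivative_scaleC:
  assumes "has_weak_derivative u u'"
  shows "has_weak_derivative (c *\<^sub>C u) (c *\<^sub>C u')"
proof -
  obtain f f' where f: "has_ac_derivative f f'" "sq_integrable f" "sq_integrable f'" "u = abs_L2 f"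
      "u' = abs_L2 f'"
    using has_weak_derivative_cases[OF assms(1)] .
  have "has_ac_derivative (\<lambda>x. c) (\<lambda>x. 0)" by (rule has_ac_derivative_C1) auto
  from has_ac_derivative_mult[OF this f(1)] have "has_ac_derivative (\<lambda>x. c * f x) (\<lambda>x. c * f' x)"
    by simp
  then show ?thesis unfolding f(4,5) scaleC_abs_L2[OF f(2)] scaleC_abs_L2[OF f(3)]
    by (intro has_weak_derivative_ac sq_integrable_mult_left f)
qed

lemma weak_derivative_eq:
  assumes "has_weak_derivative u v" shows "weak_derivative u = v"
  unfolding weak_derivative_def
proof (rule the_equality[where P="has_weak_derivative u", OF assms])
  fix w assume "has_weak_derivative u w"
  from has_weak_derivative_add[OF this has_weak_derivative_scaleC[OF assms, of "-1"]]
  have "has_weak_derivative (u + (-1) *\<^sub>C u) (w + (-1) *\<^sub>C v)" .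
  then have "has_weak_derivative 0 (w - v)" by (simp add: scaleC_minus_left)
  from has_weak_derivative_zero_unique[OF this] show "w = v" by simp
qed

lemma H1_weak_derivative: "u \<in> H1 \<Longrightarrow> has_weak_derivative u (weak_derivative u)"
  unfolding H1_def using weak_derivative_eq by force

lemma L2_weighted_cases:
  assumes "u \<in> L2_weighted"
  obtains f where "sq_integrable f" "sq_integrable (\<lambda>x. of_real x * f x)" "u = abs_L2 f"
    "position u = abs_L2 (\<lambda>x. of_real x * f x)"
proof -
  define f where "f = rep_L2 u"
  have f: "sq_integrable f" "u = abs_L2 f" by (simp_all add: f_def)
  have "sq_integrable (\<lambda>x. of_real x * f x)" using assms L2_weighted_abs_L2[OF f(1)] f(2) by simp
  with f show thesis using that position_abs_L2 by blast
qed

lemma position_symmetric: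
  assumes "u \<in> L2_weighted" "v \<in> L2_weighted"
  shows "position u \<bullet> v = u \<bullet> position v"
proof -
  obtain f where f: "sq_integrable f" "sq_integrable (\<lambda>x. of_real x * f x)" "u = abs_L2 f"
    "position u = abs_L2 (\<lambda>x. of_real x * f x)" using L2_weighted_cases[OF assms(1)] .
  obtain g where g: "sq_integrable g" "sq_integrable (\<lambda>x. of_real x * g x)" "v = abs_L2 g"
    "position v = abs_L2 (\<lambda>x. of_real x * g x)" using L2_weighted_cases[OF assms(2)] .
  have "of_real x * f x * cnj (g x) = f x * cnj (of_real x * g x)" for x by simp
  then show ?thesis unfolding f(4) g(4) unfolding f(3) g(3) by (simp only: inner_abs_L2_Re f g)
qed

lemma position_add:
  assumes "u \<in> L2_weighted" "v \<in> L2_weighted"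
  shows "u + v \<in> L2_weighted" "position (u + v) = position u + position v"
proof -
  obtain f where f: "sq_integrable f" "sq_integrable (\<lambda>x. of_real x * f x)" "u = abs_L2 f"
    "position u = abs_L2 (\<lambda>x. of_real x * f x)" using L2_weighted_cases[OF assms(1)] .
  obtain g where g: "sq_integrable g" "sq_integrable (\<lambda>x. of_real x * g x)" "v = abs_L2 g"
    "position v = abs_L2 (\<lambda>x. of_real x * g x)" using L2_weighted_cases[OF assms(2)] .
  have s: "sq_integrable (\<lambda>x. f x + g x)" "sq_integrable (\<lambda>x. of_real x * (f x + g x))"
    using sq_integrable_add f g by (simp_all add: distrib_left)
  show "u + v \<in> L2_weighted" unfolding f(3) g(3) using s f g
    by (simp add: plus_abs_L2 L2_weighted_abs_L2)
  show "position (u + v) = position u + position v"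
    unfolding f(4) g(4) unfolding f(3) g(3) plus_abs_L2[OF f(1) g(1)] plus_abs_L2[OF f(2) g(2)] position_abs_L2[OF s]
    by (simp add: distrib_left)
qed

lemma position_scaleC:
  assumes "u \<in> L2_weighted"
  shows "c *\<^sub>C u \<in> L2_weighted" "position (c *\<^sub>C u) = c *\<^sub>C position u"
proof -
  obtain f where f: "sq_integrable f" "sq_integrable (\<lambda>x. of_real x * f x)" "u = abs_L2 f"
    "position u = abs_L2 (\<lambda>x. of_real x * f x)" using L2_weighted_cases[OF assms(1)] .
  have e: "of_real x * (c * f x) = c * (of_real x * f x)" for x by simp
  have s: "sq_integrable (\<lambda>x. c * f x)" "sq_integrable (\<lambda>x. of_real x * (c * f x))"
    unfolding e by (intro sq_integrable_mult_left f)+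
  show "c *\<^sub>C u \<in> L2_weighted" unfolding f(3) using s f by (simp add: scaleC_abs_L2 L2_weighted_abs_L2)
  show "position (c *\<^sub>C u) = c *\<^sub>C position u"
    unfolding f(4) unfolding f(3) scaleC_abs_L2[OF f(1)] scaleC_abs_L2[OF f(2)] position_abs_L2[OF s]
    by (simp only: e)
qed

section \<open>Multiplication operators\<close>

definition mult_op :: "(real \<Rightarrow> complex) \<Rightarrow> L2 \<Rightarrow> L2" where
  "mult_op b u = abs_L2 (\<lambda>x. b x * rep_L2 u x)"

locale bounded_multiplier =
  fixes b :: "real \<Rightarrow> complex" and C :: real
  assumes measurable_b: "b \<in> borel_measurable borel" and bound_b: "norm (b x) \<le> C"
begin

lemma sq_integrable_mult: "sq_integrable f \<Longrightarrow> sq_integrable (\<lambda>x. b x * f x)"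
  using sq_integrable_mult_bounded(1) measurable_b bound_b by blast

lemma mult_op_abs_L2:
  assumes "sq_integrable f" shows "mult_op b (abs_L2 f) = abs_L2 (\<lambda>x. b x * f x)"
  unfolding mult_op_def
proof (rule abs_L2_eqI)
  show "AE x in lborel. b x * rep_L2 (abs_L2 f) x = b x * f x"
    using rep_abs_L2[OF assms] by eventually_elim simp
qed (simp_all add: sq_integrable_mult assms)

lemma norm_mult_op_le: "norm (mult_op b u) \<le> C * norm u"
  using norm_abs_L2_mult_bounded[of "rep_L2 u" b C] measurable_b bound_b by (simp add: mult_op_def)

lemma mult_op_scaleC: "mult_op b (c *\<^sub>C u) = c *\<^sub>C mult_op b u"
proof -
  obtain f where f: "sq_integrable f" "u = abs_L2 f" using L2_cases .
  show ?thesis unfolding f(2)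
    by (simp add: scaleC_abs_L2 mult_op_abs_L2 f(1) sq_integrable_mult sq_integrable_mult_left mult.left_commute)
qed

lemma mult_op_add: "mult_op b (u + v) = mult_op b u + mult_op b v"
proof -
  obtain f where f: "sq_integrable f" "u = abs_L2 f" using L2_cases .
  obtain g where g: "sq_integrable g" "v = abs_L2 g" using L2_cases .
  show ?thesis unfolding f(2) g(2)
    by (simp add: plus_abs_L2 mult_op_abs_L2 f(1) g(1) sq_integrable_mult sq_integrable_add distrib_left)
qed

lemma bounded_linear_mult_op: "bounded_linear (mult_op b)"
proof (rule bounded_linear_intro)
  show "mult_op b (u + v) = mult_op b u + mult_op b v" for u v by (rule mult_op_add)
  show "mult_op b (r *\<^sub>R u) = r *\<^sub>R mult_op b u" for r u
    using mult_op_scaleC[of "of_real r" u] by (simp add: scaleC_of_real)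
  show "norm (mult_op b u) \<le> norm u * C" for u
    using norm_mult_op_le[of u] by (simp add: mult.commute)
qed

end

text \<open>Multiplication by x has no bounded inverse, but that by x + i has one, namely
  multiplication by \<open>b\<close>. Hence X n = b (x X n + i X n), an identity that survives the
  limit and identifies \<open>v\<close> with x u.\<close>

lemma position_closed:
  assumes X: "\<And>n. X n \<in> L2_weighted" "X \<longlonglongrightarrow> u" "(\<lambda>n. position (X n)) \<longlonglongrightarrow> v"
  shows "u \<in> L2_weighted" "position u = v"
proof -
  define b where "b x = inverse (of_real x + \<i>)" for x
  have nz: "of_real x + \<i> \<noteq> 0" for x by (simp add: complex_eq_iff)
  interpret bounded_multiplier b 1
  proof
    have "continuous_on UNIV b" unfolding b_def[abs_def] by (intro continuous_intros) (use nz in auto)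
    then show "b \<in> borel_measurable borel" by (rule borel_measurable_continuous_onI)
    fix x
    have "1 \<le> norm (of_real x + \<i>)" using abs_Im_le_cmod[of "of_real x + \<i>"] by simp
    then show "norm (b x) \<le> 1" by (simp add: b_def norm_inverse inverse_le_1_iff)
  qed
  have X_eq: "mult_op b (position (X n) + \<i> *\<^sub>C X n) = X n" for n
  proof -
    obtain f where f: "sq_integrable f" "sq_integrable (\<lambda>x. of_real x * f x)" "X n = abs_L2 f"
      "position (X n) = abs_L2 (\<lambda>x. of_real x * f x)" using L2_weighted_cases[OF X(1)] .
    have "b x * (of_real x * f x + \<i> * f x) = f x" for x
      using nz[of x] by (simp add: b_def field_simps)
    then show ?thesis unfolding f(4) unfolding f(3)
      by (simp add: scaleC_abs_L2 plus_abs_L2 mult_op_abs_L2 f sq_integrable_mult_left sq_integrable_add)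
  qed
  have "(\<lambda>n. position (X n) + \<i> *\<^sub>C X n) \<longlonglongrightarrow> v + \<i> *\<^sub>C u"
    by (intro tendsto_add tendsto_scaleC X)
  from bounded_linear.tendsto[OF bounded_linear_mult_op this]
  have "X \<longlonglongrightarrow> mult_op b (v + \<i> *\<^sub>C u)" by (simp only: X_eq)
  then have u: "u = mult_op b (v + \<i> *\<^sub>C u)" using X(2) LIMSEQ_unique by blast
  define f where "f = rep_L2 u"
  define g where "g = rep_L2 v"
  have f: "sq_integrable f" "u = abs_L2 f" and g: "sq_integrable g" "v = abs_L2 g"
    by (simp_all add: f_def g_def)
  have "abs_L2 f = abs_L2 (\<lambda>x. b x * (g x + \<i> * f x))"
    using u unfolding f(2) g(2)
    by (simp add: scaleC_abs_L2 plus_abs_L2 mult_op_abs_L2 f(1) g(1) sq_integrable_mult_left sq_integrable_add)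
  then have "AE x in lborel. f x = b x * (g x + \<i> * f x)"
    by (subst (asm) abs_L2_eq_iff) (intro f g sq_integrable_mult sq_integrable_add sq_integrable_mult_left)+
  then have ae: "AE x in lborel. g x = of_real x * f x"
  proof eventually_elim
    case (elim x)
    then have "(of_real x + \<i>) * f x = (of_real x + \<i>) * (b x * (g x + \<i> * f x))" by (rule arg_cong)
    also have "\<dots> = g x + \<i> * f x" using nz[of x] by (simp add: b_def)
    finally show ?case by (simp add: distrib_right)
  qed
  have sq: "sq_integrable (\<lambda>x. of_real x * f x)"
    by (rule sq_integrable_cong_AE[OF g(1) ae]) (use sq_integrable_measurable[OF f(1)] in measurable)
  show "u \<in> L2_weighted" unfolding f(2) using sq L2_weighted_abs_L2[OF f(1)] by simp
  show "position u = v" unfolding f(2) g(2) position_abs_L2[OF f(1) sq]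
    by (rule abs_L2_eqI[OF sq g(1)]) (use ae in eventually_elim, simp)
qed

text \<open>The dual characterisation involves \<open>u\<close> and \<open>v\<close> only through
  inner products with fixed elements, which are continuous.\<close>

lemma has_weak_derivative_closed:
  assumes X: "\<And>n. has_weak_derivative (X n) (Y n)" "X \<longlonglongrightarrow> u" "Y \<longlonglongrightarrow> v"
  shows "has_weak_derivative u v"
proof (rule has_weak_derivativeI)
  fix w w' assume w: "has_weak_derivative w w'"
  have "(\<lambda>n. Y n \<bullet> w + X n \<bullet> w') \<longlonglongrightarrow> v \<bullet> w + u \<bullet> w'"
    by (intro tendsto_intros X)
  moreover have "Y n \<bullet> w + X n \<bullet> w' = 0" for n using has_weak_derivative_inner[OF X(1) w] .
  ultimately show "v \<bullet> w + u \<bullet> w' = 0" by (simp add: LIMSEQ_const_iff)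
qed

section \<open>The domain of the operator\<close>

lemma domD_cases:
  assumes "u \<in> domD"
  obtains f g where "has_ac_derivative f g" "sq_integrable f" "sq_integrable g"
      "sq_integrable (\<lambda>x. of_real x * f x)"
    "u = abs_L2 f" "weak_derivative u = abs_L2 g" "position u = abs_L2 (\<lambda>x. of_real x * f x)"
proof -
  have u: "u \<in> H1" "u \<in> L2_weighted" using assms by (simp_all add: domD_def)
  obtain f g where f: "has_ac_derivative f g" "sq_integrable f" "sq_integrable g" "u = abs_L2 f"
      "weak_derivative u = abs_L2 g"
    using has_weak_derivative_cases[OF H1_weak_derivative[OF u(1)]] .
  have "sq_integrable (\<lambda>x. of_real x * f x)" using u(2) L2_weighted_abs_L2[OF f(2)] f(4) by simp
  with f show thesis using that position_abs_L2 by blast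
qed

lemma domD_weak: "u \<in> domD \<Longrightarrow> has_weak_derivative u (weak_derivative u)"
  by (simp add: domD_def H1_weak_derivative)

lemma domD_weighted: "u \<in> domD \<Longrightarrow> u \<in> L2_weighted"
  by (simp add: domD_def)

lemma domDI:
  assumes "has_weak_derivative u v" "u \<in> L2_weighted"
  shows "u \<in> domD" "weak_derivative u = v"
  using assms weak_derivative_eq by (auto simp: domD_def H1_def)

lemma domD_add:
  assumes "u \<in> domD" "v \<in> domD"
  shows "u + v \<in> domD" "weak_derivative (u + v) = weak_derivative u + weak_derivative v"
    "position (u + v) = position u + position v"
  using domDI[OF has_weak_derivative_add[OF assms[THEN domD_weak]] position_add(1)] position_add(2)
    assms[THEN domD_weighted] by auto

lemma domD_scaleC:
  assumes "u \<in> domD"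
  shows "c *\<^sub>C u \<in> domD" "weak_derivative (c *\<^sub>C u) = c *\<^sub>C weak_derivative u"
    "position (c *\<^sub>C u) = c *\<^sub>C position u"
  using domDI[OF has_weak_derivative_scaleC[OF assms[THEN domD_weak]] position_scaleC(1)] position_scaleC(2)
    assms[THEN domD_weighted] by auto

lemma domD_zero: "0 \<in> domD" "weak_derivative 0 = 0" "position 0 = 0"
proof -
  have "has_ac_derivative (\<lambda>x. 0) (\<lambda>x. 0)" by (rule has_ac_derivative_C1) auto
  from has_weak_derivative_ac[OF this] have "has_weak_derivative 0 0"
    by (simp add: sq_integrable_zero flip: zero_eq_abs_L2)
  moreover have "(0::L2) \<in> L2_weighted"
    using L2_weighted_abs_L2[OF sq_integrable_zero]
      by (simp add: sq_integrable_zero flip: zero_eq_abs_L2)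
  ultimately show "0 \<in> domD" "weak_derivative 0 = 0" using domDI by auto
  show "position 0 = 0" using position_abs_L2[OF sq_integrable_zero]
    by (simp add: sq_integrable_zero flip: zero_eq_abs_L2)
qed

lemma domD_closed:
  assumes "\<And>n. X n \<in> domD" "X \<longlonglongrightarrow> u" "(\<lambda>n. weak_derivative (X n)) \<longlonglongrightarrow> v" "(\<lambda>n. position (X n)) \<longlonglongrightarrow> w"
  shows "u \<in> domD" "weak_derivative u = v" "position u = w"
  using domDI[OF has_weak_derivative_closed[OF assms(1)[THEN domD_weak] assms(2,3)]
      position_closed(1)[OF assms(1)[THEN domD_weighted] assms(2,4)]]
    position_closed(2)[OF assms(1)[THEN domD_weighted] assms(2,4)] by auto

text \<open>The integral of the derivative of x f(x) cnj(g(x)) is 0. The third summand is the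
  commutator of d/dx and x.\<close>

lemma weak_derivative_position_inner:
  assumes "u \<in> domD" "v \<in> domD"
  shows "weak_derivative u \<bullet> position v + position u \<bullet> weak_derivative v + u \<bullet> v = 0"
proof -
  obtain f f' where f: "has_ac_derivative f f'" "sq_integrable f" "sq_integrable f'"
      "sq_integrable (\<lambda>x. of_real x * f x)"
    "u = abs_L2 f" "weak_derivative u = abs_L2 f'" "position u = abs_L2 (\<lambda>x. of_real x * f x)"
    using domD_cases[OF assms(1)] .
  obtain g g' where g: "has_ac_derivative g g'" "sq_integrable g" "sq_integrable g'"
      "sq_integrable (\<lambda>x. of_real x * g x)"
    "v = abs_L2 g" "weak_derivative v = abs_L2 g'" "position v = abs_L2 (\<lambda>x. of_real x * g x)"
    using domD_cases[OF assms(2)] .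
  have x: "has_ac_derivative (\<lambda>x. of_real x) (\<lambda>x. 1)"
    by (rule has_ac_derivative_C1) (auto intro!: derivative_eq_intros)
  have sx: "sq_integrable (\<lambda>x. cnj (of_real x * g x))" by (intro sq_integrable_cnj g)
  have i1: "integrable lborel (\<lambda>x. f' x * cnj (of_real x * g x))"
    by (intro integrable_mult_sq_integrable f sx)
  have i2: "integrable lborel (\<lambda>x. f x * cnj (g x))" and i3:
      "integrable lborel (\<lambda>x. of_real x * f x * cnj (g' x))"
    by (intro integrable_mult_sq_integrable f sq_integrable_cnj g)+
  have W: "has_ac_derivative (\<lambda>x. f x * (of_real x * cnj (g x)))
      (\<lambda>x. f' x * (of_real x * cnj (g x)) + f x * (1 * cnj (g x) + of_real x * cnj (g' x)))"
    by (intro has_ac_derivative_mult f x has_ac_derivative_cnj g)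
  \<comment> \<open>The factor x is attached to the function that is not differentiated, so every
    term is a product of two square-integrable functions.\<close>
  have e: "(\<lambda>x. f' x * (of_real x * cnj (g x)) + f x * (1 * cnj (g x) + of_real x * cnj (g' x)))
     = (\<lambda>x. f' x * cnj (of_real x * g x) + of_real x * f x * cnj (g' x) + f x * cnj (g x))"
    by (simp add: fun_eq_iff algebra_simps)
  have "(\<integral>x. f' x * cnj (of_real x * g x) + of_real x * f x * cnj (g' x) + f x * cnj (g x) \<partial>lborel) = 0"
  proof (rule has_ac_derivative_integral_eq_0[OF W[unfolded e]])
    show "integrable lborel (\<lambda>x. f x * (of_real x * cnj (g x)))"
      using integrable_mult_sq_integrable[OF f(2) sx] by simp
    show "integrable lborel (\<lambda>x. f' x * cnj (of_real x * g x) + of_real x * f x * cnj (g' x)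
        + f x * cnj (g x))"
      by (intro Bochner_Integration.integrable_add i1 i2 i3)
  qed
  then have "(\<integral>x. f' x * cnj (of_real x * g x) \<partial>lborel) + (\<integral>x. of_real x * f x * cnj (g' x) \<partial>lborel)
     + (\<integral>x. f x * cnj (g x) \<partial>lborel) = 0"
    by (simp only: Bochner_Integration.integral_add Bochner_Integration.integrable_add i1 i2 i3)
  then have "Re (\<integral>x. f' x * cnj (of_real x * g x) \<partial>lborel)
      + Re (\<integral>x. of_real x * f x * cnj (g' x) \<partial>lborel)
     + Re (\<integral>x. f x * cnj (g x) \<partial>lborel) = 0"
    by (simp only: zero_complex.sel flip: plus_complex.sel)
  then show ?thesis unfolding f(6,7) g(6,7) unfolding f(5) g(5) by (simp only: inner_abs_L2_Re f g)
qed

section \<open>Components of the operator\<close>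

lemma vector_4:
  "(vector [x,y,z,w] :: 'a::zero ^ 4) $ 1 = x" "(vector [x,y,z,w] :: 'a ^ 4) $ 2 = y"
  "(vector [x,y,z,w] :: 'a ^ 4) $ 3 = z" "(vector [x,y,z,w] :: 'a ^ 4) $ 4 = w"
  unfolding vector_def by simp_all

definition first_order :: "complex \<Rightarrow> complex \<Rightarrow> L2 \<Rightarrow> L2" where
  "first_order a b u = a *\<^sub>C weak_derivative u + b *\<^sub>C position u"

text \<open>With \<open>p = - i e\<^sup>-\<^sup>i\<^sup>\<theta>\<^sup>/\<^sup>2 d/dx\<close> and \<open>q = e\<^sup>i\<^sup>\<theta>\<^sup>/\<^sup>2 x\<close>, the ladder operators \<open>p \<plusminus> i q\<close> are
  \<open>first_order A (\<plusminus>B)\<close> for the following \<open>A\<close> and \<open>B\<close>.\<close>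

definition Acoeff :: "real \<Rightarrow> complex" where "Acoeff \<theta> = - \<i> * exp (- \<i> * of_real \<theta> / 2)"
definition Bcoeff :: "real \<Rightarrow> complex" where "Bcoeff \<theta> = \<i> * exp (\<i> * of_real \<theta> / 2)"

lemma cnj_coeffs: "cnj (Acoeff \<theta>) = - Acoeff (- \<theta>)" "cnj (Bcoeff \<theta>) = - Bcoeff (- \<theta>)"
  by (simp_all add: Acoeff_def Bcoeff_def exp_cnj)

text \<open>The half angles add up to full phases in the squares and cancel in the mixed
  products.\<close>

lemma coeff_products:
  "Acoeff \<theta> * Acoeff \<theta> = - cis (- \<theta>)" "Bcoeff \<theta> * Bcoeff \<theta> = - cis \<theta>" "Acoeff \<theta> * Bcoeff \<theta> = 1"
      "Bcoeff \<theta> * Acoeff \<theta> = 1"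
proof -
  have e: "exp x * exp y = exp (x + y)" for x y :: complex by (simp add: exp_add)
  have "- \<i> * exp (- \<i> * of_real \<theta> / 2) * (- \<i> * exp (- \<i> * of_real \<theta> / 2)) =
      - (exp (- \<i> * of_real \<theta> / 2) * exp (- \<i> * of_real \<theta> / 2))"
    by (simp add: algebra_simps)
  also have "\<dots> = - cis (- \<theta>)" unfolding e cis_conv_exp by (simp add: field_simps)
  finally show "Acoeff \<theta> * Acoeff \<theta> = - cis (- \<theta>)" unfolding Acoeff_def .
  have "\<i> * exp (\<i> * of_real \<theta> / 2) * (\<i> * exp (\<i> * of_real \<theta> / 2)) =
      - (exp (\<i> * of_real \<theta> / 2) * exp (\<i> * of_real \<theta> / 2))"
    by (simp add: algebra_simps)
  also have "\<dots> = - cis \<theta>" unfolding e cis_conv_exp by (simp add: field_simps)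
  finally show "Bcoeff \<theta> * Bcoeff \<theta> = - cis \<theta>" unfolding Bcoeff_def .
  have "- \<i> * exp (- \<i> * of_real \<theta> / 2) * (\<i> * exp (\<i> * of_real \<theta> / 2))
      = exp (- \<i> * of_real \<theta> / 2) * exp (\<i> * of_real \<theta> / 2)"
    by (simp add: algebra_simps)
  also have "\<dots> = 1" unfolding e by simp
  finally show "Acoeff \<theta> * Bcoeff \<theta> = 1" unfolding Acoeff_def Bcoeff_def .
  then show "Bcoeff \<theta> * Acoeff \<theta> = 1" by (simp only: mult.commute)
qed

lemma norm_coeffs: "norm (Acoeff \<theta>) = 1" "norm (Bcoeff \<theta>) = 1"
  by (simp_all add: Acoeff_def Bcoeff_def norm_mult)

lemma Acoeff_nz: "Acoeff \<theta> \<noteq> 0"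
  using norm_coeffs(1)[of \<theta>] by auto

text \<open>\<open>alpha1\<close> and \<open>alpha2\<close> couple components 1, 4 and 2, 3, while
  \<open>alpha3\<close> couples 1, 3 and 2, 4. The alternating signs of \<open>Bcoeff\<close> and
  \<open>m\<close> come from \<open>sigma2\<close> and \<open>sigma3\<close>.\<close>

lemma op_H_components:
  "op_H m \<theta> u $ 1 = first_order (Acoeff \<theta>) (Bcoeff \<theta>) (u $ 4) + m *\<^sub>R u $ 3"
  "op_H m \<theta> u $ 2 = first_order (Acoeff \<theta>) (- Bcoeff \<theta>) (u $ 3) - m *\<^sub>R u $ 4"
  "op_H m \<theta> u $ 3 = first_order (Acoeff \<theta>) (Bcoeff \<theta>) (u $ 2) + m *\<^sub>R u $ 1"
  "op_H m \<theta> u $ 4 = first_order (Acoeff \<theta>) (- Bcoeff \<theta>) (u $ 1) - m *\<^sub>R u $ 2"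
  by (simp_all add: op_H_def first_order_def Acoeff_def Bcoeff_def mat_apply_def sum_4 alpha1_def alpha2_def alpha3_def
      dirac_block_def sigma1_def sigma2_def sigma3_def vector_4 scaleC_vec_def scaleC_scaleC scaleC_minus_left
      scaleC_minus_right scaleC_of_real mult.commute)

lemma first_order_add:
  "u \<in> domD \<Longrightarrow> v \<in> domD \<Longrightarrow> first_order a b (u + v) = first_order a b u + first_order a b v"
  by (simp add: first_order_def domD_add scaleC_add_right)

lemma first_order_scaleC:
  "u \<in> domD \<Longrightarrow> first_order a b (c *\<^sub>C u) = c *\<^sub>C first_order a b u"
  by (simp add: first_order_def domD_scaleC scaleC_add_right scaleC_scaleC mult.commute)

lemma first_order_zero: "first_order a b 0 = 0"
  by (simp add: first_order_def domD_zero)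

lemma norm_first_order:
  "norm (first_order a b u) \<le> norm a * norm (weak_derivative u) + norm b * norm (position u)"
  unfolding first_order_def by (rule order_trans[OF norm_triangle_ineq]) (simp add: norm_scaleC)

lemma scaleC_scaleR: "c *\<^sub>C (r *\<^sub>R u) = r *\<^sub>R (c *\<^sub>C u)" for u :: "'a::complex_normed_vector"
  by (simp add: scaleC_scaleC mult.commute flip: scaleC_of_real)

lemma scaleC_vec_nth: "(c *\<^sub>C u) $ i = c *\<^sub>C (u $ i)"
  by (simp add: scaleC_vec_def)

lemma linear_operator_op_H: "linear_operator dom_H (op_H m \<theta>)"
proof -
  have "op_H m \<theta> (u + v) = op_H m \<theta> u + op_H m \<theta> v" if "u \<in> dom_H" "v \<in> dom_H" for u v
    using that unfolding vec_eq_iff forall_4 dom_H_def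
    by (simp add: op_H_components first_order_add scaleR_add_right)
  moreover have "op_H m \<theta> (c *\<^sub>C u) = c *\<^sub>C op_H m \<theta> u" if "u \<in> dom_H" for u c
    using that unfolding vec_eq_iff forall_4 dom_H_def
    by (simp add: op_H_components scaleC_vec_nth first_order_scaleC scaleC_add_right scaleC_diff_right scaleC_scaleR)
  ultimately show ?thesis
    unfolding linear_operator_def by (simp add: dom_H_def domD_zero domD_add domD_scaleC scaleC_vec_nth)
qed

section \<open>The a priori estimate\<close>

text \<open>Splits a complex phase inside the real inner product. For u = v the imaginary
  contribution vanishes by \<open>inner_i_self\<close>.\<close>

lemma inner_scaleC_scaleC:
  fixes u v :: L2
  shows "(c *\<^sub>C u) \<bullet> (d *\<^sub>C v) = Re (c * cnj d) * (u \<bullet> v) + Im (c * cnj d) * ((\<i> *\<^sub>C u) \<bullet> v)"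
proof -
  have "(c *\<^sub>C u) \<bullet> (d *\<^sub>C v) = ((c * cnj d) *\<^sub>C u) \<bullet> v"
    by (simp add: inner_L2_scaleC_right scaleC_scaleC mult.commute)
  also have "(c * cnj d) *\<^sub>C u = (of_real (Re (c * cnj d)) + of_real (Im (c * cnj d)) * \<i>) *\<^sub>C u"
    by (subst complex_eq[of "c * cnj d"]) (simp only: mult.commute)
  also have "\<dots> = Re (c * cnj d) *\<^sub>R u + Im (c * cnj d) *\<^sub>R (\<i> *\<^sub>C u)"
    by (simp only: scaleC_add_left scaleC_of_real flip: scaleC_scaleC)
  finally show ?thesis by (simp add: inner_add_left)
qed

lemma inner_i_self: "(\<i> *\<^sub>C u) \<bullet> u = 0" for u :: L2
  using inner_L2_scaleC_left[of \<i> u u] by (simp add: scaleC_minus_left inner_commute)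

text \<open>By \<open>cnj_coeffs\<close>, conjugation turns the coefficients at the opposite angle
  into minus those at \<theta>. The diagonal products are then \<open>cis (- \<theta>)\<close> and
  \<open>cis \<theta>\<close>, both of real part \<open>cos \<theta>\<close>, and the mixed ones are
  real; \<open>weak_derivative_position_inner\<close> evaluates the latter as \<sigma> times the
  squared norm.\<close>

lemma inner_ladder:
  assumes u: "u \<in> domD" and \<sigma>: "\<sigma> = 1 \<or> \<sigma> = - 1"
  shows "first_order (Acoeff \<theta>) (of_real \<sigma> * Bcoeff \<theta>) u \<bullet> first_order (Acoeff (- \<theta>)) (of_real \<sigma> * Bcoeff (- \<theta>)) u
    = cos \<theta> * ((norm (weak_derivative u))\<^sup>2 + (norm (position u))\<^sup>2) + \<sigma> * (norm u)\<^sup>2"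
proof -
  have c: "Acoeff \<theta> * cnj (Acoeff (- \<theta>)) = cis (- \<theta>)" "Acoeff \<theta> * cnj (of_real \<sigma> * Bcoeff (- \<theta>)) =
      - of_real \<sigma>"
    "of_real \<sigma> * Bcoeff \<theta> * cnj (Acoeff (- \<theta>)) = - of_real \<sigma>"
        "of_real \<sigma> * Bcoeff \<theta> * cnj (of_real \<sigma> * Bcoeff (- \<theta>)) = cis \<theta>"
    using \<sigma> by (auto simp: cnj_coeffs coeff_products)
  have "weak_derivative u \<bullet> position u + position u \<bullet> weak_derivative u + u \<bullet> u = 0"
    using weak_derivative_position_inner[OF u u] .
  then have "2 * (weak_derivative u \<bullet> position u) = - (norm u)\<^sup>2"
    by (simp add: inner_commute power2_norm_eq_inner)
  moreover have "first_order (Acoeff \<theta>) (of_real \<sigma> * Bcoeff \<theta>) u \<bullet> first_order (Acoeff (- \<theta>)) (of_real \<sigma> * Bcoeff (- \<theta>)) u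
     = cos \<theta> * (weak_derivative u \<bullet> weak_derivative u) + cos \<theta> * (position u \<bullet> position u)
         - \<sigma> * (2 * (weak_derivative u \<bullet> position u))"
    unfolding first_order_def inner_add_left inner_add_right inner_scaleC_scaleC c
    by (simp add: inner_i_self inner_commute[of "position u" "weak_derivative u"])
  ultimately show ?thesis by (simp add: power2_norm_eq_inner algebra_simps)
qed

text \<open>The derivative is skew and the position operator symmetric. Together with
  \<open>cnj_coeffs\<close> this exchanges the two ladder operators and reverses the angle.\<close>

lemma inner_first_order_adjoint:
  assumes u: "u \<in> domD" and v: "v \<in> domD"
  shows "first_order a b u \<bullet> v = u \<bullet> first_order (- cnj a) (cnj b) v"
proof -
  have "weak_derivative u \<bullet> (cnj a *\<^sub>C v) + u \<bullet> weak_derivative (cnj a *\<^sub>C v) = 0"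
    by (intro has_weak_derivative_inner domD_weak domD_scaleC u v)
  then have "weak_derivative u \<bullet> (cnj a *\<^sub>C v) = - (u \<bullet> (cnj a *\<^sub>C weak_derivative v))"
    using v by (simp add: domD_scaleC add_eq_0_iff2)
  moreover have "position u \<bullet> (cnj b *\<^sub>C v) = u \<bullet> position (cnj b *\<^sub>C v)"
    by (intro position_symmetric domD_weighted domD_scaleC u v)
  ultimately show ?thesis using v
    by (simp add: first_order_def inner_add_left inner_add_right inner_L2_scaleC_left domD_scaleC scaleC_minus_left inner_diff_right)
qed

text \<open>All cross terms cancel: the \<open>p\<^sub>k\<close>, \<open>q\<^sub>k\<close> are the ladder operators applied to the components
  \<open>u\<^sub>k\<close>, primes mark the adjoint angle, and \<open>c\<^sub>k = i \<lambda> u\<^sub>k\<close>.\<close>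

lemma inner_sum_cancel:
  fixes u1 u2 u3 u4 :: "'a::real_inner" and m l :: real
  assumes "p4 \<bullet> u3 = u4 \<bullet> q3'" "q3 \<bullet> u4 = u3 \<bullet> p4'" "p2 \<bullet> u1 = u2 \<bullet> q1'" "q1 \<bullet> u2 = u1 \<bullet> p2'"
    and "p4 \<bullet> c1 = - (c4 \<bullet> q1')" "q1 \<bullet> c4 = - (c1 \<bullet> p4')" "p2 \<bullet> c3 = - (c2 \<bullet> q3')" "q3 \<bullet> c2 =
        - (c3 \<bullet> p2')"
    and "u3 \<bullet> c1 = - (c3 \<bullet> u1)" "u1 \<bullet> c3 = - (c1 \<bullet> u3)" "u4 \<bullet> c2 = - (c4 \<bullet> u2)" "u2 \<bullet> c4 = - (c2 \<bullet> u4)"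
    and "c1 \<bullet> c1 = l * (u1 \<bullet> u1)" "c2 \<bullet> c2 = l * (u2 \<bullet> u2)" "c3 \<bullet> c3 = l * (u3 \<bullet> u3)" "c4 \<bullet> c4
        = l * (u4 \<bullet> u4)"
  shows "(p4 + m *\<^sub>R u3 - c1) \<bullet> (p4' + m *\<^sub>R u3 - c1) + (q3 - m *\<^sub>R u4 - c2) \<bullet> (q3' - m *\<^sub>R u4 - c2)
     + (p2 + m *\<^sub>R u1 - c3) \<bullet> (p2' + m *\<^sub>R u1 - c3) + (q1 - m *\<^sub>R u2 - c4) \<bullet> (q1' - m *\<^sub>R u2 - c4)
    = p4 \<bullet> p4' + q3 \<bullet> q3' + p2 \<bullet> p2' + q1 \<bullet> q1' + (m * m + l) * (u1 \<bullet> u1 + u2 \<bullet> u2 + u3 \<bullet> u3 + u4 \<bullet> u4)"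
proof -
  note c = inner_commute[of u3 p4'] inner_commute[of u4 q3'] inner_commute[of u1 p2'] inner_commute[of u2 q1']
    inner_commute[of c1 u3] inner_commute[of c2 u4] inner_commute[of c3 u1] inner_commute[of c4 u2]
    inner_commute[of c1 p4'] inner_commute[of c2 q3'] inner_commute[of c3 p2'] inner_commute[of c4 q1']
  show ?thesis
    unfolding inner_add_left inner_add_right inner_diff_left inner_diff_right inner_scaleR_left inner_scaleR_right assms
    unfolding c by (simp add: algebra_simps)
qed

definition shifted :: "real \<Rightarrow> real \<Rightarrow> real \<Rightarrow> L2 ^ 4 \<Rightarrow> L2 ^ 4" where
  "shifted m \<theta> l u = op_H m \<theta> u - (\<i> * of_real l) *\<^sub>C u"

text \<open>Controls derivative and position separately, which both closedness and compactness need;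
  for the parameters of \<open>a_priori\<close> it is equivalent on \<open>dom_H\<close> to the norm
  of \<open>shifted\<close>.\<close>

definition graph_norm :: "L2 ^ 4 \<Rightarrow> real" where
  "graph_norm u = (\<Sum>k\<in>UNIV. norm (weak_derivative (u $ k)) + norm (position (u $ k)) + norm (u $ k))"

lemma shifted_components:
  "shifted m \<theta> l u $ 1 = first_order (Acoeff \<theta>) (Bcoeff \<theta>) (u $ 4) + m *\<^sub>R u $ 3
      - (\<i> * of_real l) *\<^sub>C u $ 1"
  "shifted m \<theta> l u $ 2 = first_order (Acoeff \<theta>) (- Bcoeff \<theta>) (u $ 3) - m *\<^sub>R u $ 4
      - (\<i> * of_real l) *\<^sub>C u $ 2"
  "shifted m \<theta> l u $ 3 = first_order (Acoeff \<theta>) (Bcoeff \<theta>) (u $ 2) + m *\<^sub>R u $ 1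
      - (\<i> * of_real l) *\<^sub>C u $ 3"
  "shifted m \<theta> l u $ 4 = first_order (Acoeff \<theta>) (- Bcoeff \<theta>) (u $ 1) - m *\<^sub>R u $ 2
      - (\<i> * of_real l) *\<^sub>C u $ 4"
  by (simp_all add: shifted_def op_H_components scaleC_vec_nth)

text \<open>Components 2 and 4 meet the ladder operator with sign +, components 1 and 3 the one with
  sign -; this produces the signed squares at the end.\<close>

lemma inner_shifted:
  assumes "u \<in> dom_H"
  shows "shifted m \<theta> l u \<bullet> shifted m (- \<theta>) l u =
    (\<Sum>k\<in>UNIV. cos \<theta> * ((norm (weak_derivative (u $ k)))\<^sup>2 + (norm (position (u $ k)))\<^sup>2)
        + (m\<^sup>2 + l\<^sup>2) * (norm (u $ k))\<^sup>2)
    + ((norm (u $ 4))\<^sup>2 + (norm (u $ 2))\<^sup>2 - (norm (u $ 3))\<^sup>2 - (norm (u $ 1))\<^sup>2)"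
proof -
  have d: "u $ k \<in> domD" for k using assms by (simp add: dom_H_def)
  define z where "z = \<i> * of_real l"
  \<comment> \<open>The shift is purely imaginary, so multiplication by it is skew; this makes its
    cross terms with the operator cancel.\<close>
  have z: "cnj z = - z" by (simp add: z_def)
  define P where "P t = first_order (Acoeff t) (Bcoeff t)" for t
  define Q where "Q t = first_order (Acoeff t) (- Bcoeff t)" for t
  have PQ: "P \<theta> v \<bullet> w = v \<bullet> Q (- \<theta>) w" and QP: "Q \<theta> v \<bullet> w = v \<bullet> P (- \<theta>) w" if "v \<in> domD" "w \<in> domD"
    for v w
    using inner_first_order_adjoint[OF that] by (simp_all add: P_def Q_def cnj_coeffs)
  have zl: "v \<bullet> (z *\<^sub>C w) = - ((z *\<^sub>C v) \<bullet> w)" for v w :: L2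
    by (simp add: inner_L2_scaleC_right z scaleC_minus_left)
  have PQz: "P \<theta> v \<bullet> (z *\<^sub>C w) = - ((z *\<^sub>C v) \<bullet> Q (- \<theta>) w)" and QPz: "Q \<theta> v \<bullet> (z *\<^sub>C w) =
      - ((z *\<^sub>C v) \<bullet> P (- \<theta>) w)"
    if "v \<in> domD" "w \<in> domD" for v w
  proof -
    show "P \<theta> v \<bullet> (z *\<^sub>C w) = - ((z *\<^sub>C v) \<bullet> Q (- \<theta>) w)"
      unfolding PQ[OF that(1) domD_scaleC(1)[OF that(2)]]
        unfolding Q_def first_order_scaleC[OF that(2)] by (rule zl)
    show "Q \<theta> v \<bullet> (z *\<^sub>C w) = - ((z *\<^sub>C v) \<bullet> P (- \<theta>) w)"
      unfolding QP[OF that(1) domD_scaleC(1)[OF that(2)]]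
        unfolding P_def first_order_scaleC[OF that(2)] by (rule zl)
  qed
  have zz: "(z *\<^sub>C v) \<bullet> (z *\<^sub>C v) = l\<^sup>2 * (v \<bullet> v)" for v :: L2
    by (simp add: inner_scaleC_scaleC z_def power2_eq_square)
  have PP: "P \<theta> v \<bullet> P (- \<theta>) v = cos \<theta> * ((norm (weak_derivative v))\<^sup>2 + (norm (position v))\<^sup>2)
      + (norm v)\<^sup>2"
    and QQ: "Q \<theta> v \<bullet> Q (- \<theta>) v = cos \<theta> * ((norm (weak_derivative v))\<^sup>2 + (norm (position v))\<^sup>2)
        - (norm v)\<^sup>2"
    if "v \<in> domD" for v
    using inner_ladder[OF that, of 1 \<theta>] inner_ladder[OF that, of "-1" \<theta>] by (simp_all add: P_def Q_def)
  have "shifted m \<theta> l u \<bullet> shifted m (- \<theta>) l u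
     = P \<theta> (u$4) \<bullet> P (- \<theta>) (u$4) + Q \<theta> (u$3) \<bullet> Q (- \<theta>) (u$3) + P \<theta> (u$2) \<bullet> P (- \<theta>) (u$2)
         + Q \<theta> (u$1) \<bullet> Q (- \<theta>) (u$1)
      + (m * m + l\<^sup>2) * (u$1 \<bullet> u$1 + u$2 \<bullet> u$2 + u$3 \<bullet> u$3 + u$4 \<bullet> u$4)"
    unfolding inner_vec_def sum_4 shifted_components P_def[symmetric] Q_def[symmetric] z_def[symmetric]
    by (rule inner_sum_cancel; (rule PQ QP PQz QPz zl zz); rule d)
  also have "\<dots> = (\<Sum>k\<in>UNIV. cos \<theta> * ((norm (weak_derivative (u $ k)))\<^sup>2
      + (norm (position (u $ k)))\<^sup>2) + (m\<^sup>2 + l\<^sup>2) * (norm (u $ k))\<^sup>2)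
    + ((norm (u $ 4))\<^sup>2 + (norm (u $ 2))\<^sup>2 - (norm (u $ 3))\<^sup>2 - (norm (u $ 1))\<^sup>2)"
    unfolding sum_4 PP[OF d] QQ[OF d] power2_norm_eq_inner by (simp add: algebra_simps power2_eq_square)
  finally show ?thesis .
qed

lemma norm_vec_le_sum: "norm u \<le> (\<Sum>k\<in>UNIV. norm (u $ k))" for u :: "L2 ^ 4"
  unfolding norm_vec_def by (rule L2_set_le_sum) simp

text \<open>Needed for the second factor after the Cauchy-Schwarz inequality in
  \<open>a_priori\<close>, there at the angle -\<theta>.\<close>

lemma norm_shifted_le:
  "norm (shifted m \<theta> l u) \<le> (1 + \<bar>m\<bar> + \<bar>l\<bar>) * graph_norm u"
proof -
  have fo: "norm (first_order (Acoeff \<theta>) (Bcoeff \<theta>) v) \<le> norm (weak_derivative v) + norm (position v)"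
    "norm (first_order (Acoeff \<theta>) (- Bcoeff \<theta>) v) \<le> norm (weak_derivative v) + norm (position v)" for v
    using norm_first_order[of "Acoeff \<theta>" "Bcoeff \<theta>" v] norm_first_order[of "Acoeff \<theta>" "- Bcoeff \<theta>" v]
    by (simp_all add: norm_coeffs)
  have t: "norm (a + m *\<^sub>R b - (\<i> * of_real l) *\<^sub>C c) \<le> norm a + \<bar>m\<bar> * norm b + \<bar>l\<bar> * norm c"
    "norm (a - m *\<^sub>R b - (\<i> * of_real l) *\<^sub>C c) \<le> norm a + \<bar>m\<bar> * norm b + \<bar>l\<bar> * norm c" for a b c :: L2
  proof -
    have *: "norm (x - (\<i> * of_real l) *\<^sub>C c) \<le> norm x + \<bar>l\<bar> * norm c" for x
      using norm_triangle_ineq4[of x "(\<i> * of_real l) *\<^sub>C c"] by (simp add: norm_scaleC norm_mult)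
    show "norm (a + m *\<^sub>R b - (\<i> * of_real l) *\<^sub>C c) \<le> norm a + \<bar>m\<bar> * norm b + \<bar>l\<bar> * norm c"
      using *[of "a + m *\<^sub>R b"] norm_triangle_ineq[of a "m *\<^sub>R b"] by simp
    show "norm (a - m *\<^sub>R b - (\<i> * of_real l) *\<^sub>C c) \<le> norm a + \<bar>m\<bar> * norm b + \<bar>l\<bar> * norm c"
      using *[of "a - m *\<^sub>R b"] norm_triangle_ineq4[of a "m *\<^sub>R b"] by simp
  qed
  have "norm (shifted m \<theta> l u) \<le> (\<Sum>k\<in>UNIV. norm (shifted m \<theta> l u $ k))" by (rule norm_vec_le_sum)
  also have "\<dots> \<le> (\<Sum>k\<in>UNIV. norm (weak_derivative (u $ k)) + norm (position (u $ k))
      + (\<bar>m\<bar> + \<bar>l\<bar>) * norm (u $ k))"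
    unfolding sum_4 shifted_components
    using order_trans[OF t(1) add_right_mono[OF add_right_mono[OF fo(1)]], of "u$4" "u$3" "u$1"]
      order_trans[OF t(2) add_right_mono[OF add_right_mono[OF fo(2)]], of "u$3" "u$4" "u$2"]
      order_trans[OF t(1) add_right_mono[OF add_right_mono[OF fo(1)]], of "u$2" "u$1" "u$3"]
      order_trans[OF t(2) add_right_mono[OF add_right_mono[OF fo(2)]], of "u$1" "u$2" "u$4"]
    by (simp add: distrib_right)
  also have "\<dots> \<le> (\<Sum>k\<in>UNIV. (1 + \<bar>m\<bar> + \<bar>l\<bar>) * (norm (weak_derivative (u $ k))
      + norm (position (u $ k)) + norm (u $ k)))"
  proof (rule sum_mono)
    fix k
    have "1 * a + 1 * b + (\<bar>m\<bar> + \<bar>l\<bar>) * c \<le> (1 + \<bar>m\<bar> + \<bar>l\<bar>) * a + (1 + \<bar>m\<bar> + \<bar>l\<bar>) * b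
        + (1 + \<bar>m\<bar> + \<bar>l\<bar>) * c"
      if "a \<ge> 0" "b \<ge> 0" "c \<ge> 0" for a b c :: real
      using that by (intro add_mono mult_right_mono) auto
    then show "norm (weak_derivative (u $ k)) + norm (position (u $ k)) + (\<bar>m\<bar> + \<bar>l\<bar>) * norm (u $ k)
      \<le> (1 + \<bar>m\<bar> + \<bar>l\<bar>) * (norm (weak_derivative (u $ k)) + norm (position (u $ k)) + norm (u $ k))"
      by (simp add: distrib_left)
  qed
  finally show ?thesis by (simp add: graph_norm_def sum_distrib_left)
qed

lemma graph_norm_nonneg: "0 \<le> graph_norm u"
  unfolding graph_norm_def by (intro sum_nonneg) simp

lemma norms_le_graph_norm:
  "norm (weak_derivative (u $ k)) \<le> graph_norm u" "norm (position (u $ k)) \<le> graph_norm u"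
  "norm (u $ k) \<le> graph_norm u"
proof -
  have *: "norm (weak_derivative (u $ k)) + norm (position (u $ k)) + norm (u $ k) \<le> graph_norm u"
    unfolding graph_norm_def by (rule member_le_sum) auto
  then show "norm (weak_derivative (u $ k)) \<le> graph_norm u" "norm (position (u $ k)) \<le> graph_norm u"
  "norm (u $ k) \<le> graph_norm u" using norm_ge_zero[of "weak_derivative (u $ k)"] norm_ge_zero[of
      "position (u $ k)"] norm_ge_zero[of "u $ k"]
    by linarith+
qed

text \<open>12 = 4 * 3: a sum over four components, each with three summands, is squared.\<close>

lemma graph_norm_sq_le:
  "(graph_norm u)\<^sup>2 \<le> 12 * (\<Sum>k\<in>UNIV. (norm (weak_derivative (u $ k)))\<^sup>2
      + (norm (position (u $ k)))\<^sup>2 + (norm (u $ k))\<^sup>2)"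
proof -
  have "(graph_norm u)\<^sup>2 \<le> (\<Sum>k\<in>UNIV. (norm (weak_derivative (u $ k)) + norm (position (u $ k))
      + norm (u $ k))\<^sup>2) * real (card (UNIV :: 4 set))"
    unfolding graph_norm_def by (rule sum_squared_le_sum_of_squares) 
  also have "\<dots> \<le> (\<Sum>k\<in>UNIV. 3 * ((norm (weak_derivative (u $ k)))\<^sup>2 + (norm (position (u $ k)))\<^sup>2
      + (norm (u $ k))\<^sup>2)) * real (card (UNIV :: 4 set))"
  proof (intro mult_right_mono sum_mono)
    fix k
    have "(a + b + c)\<^sup>2 \<le> 3 * (a\<^sup>2 + b\<^sup>2 + c\<^sup>2)" for a b c :: real
      using zero_le_power2[of "a - b"] zero_le_power2[of "a - c"] zero_le_power2[of "b - c"]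
      by (simp add: power2_eq_square algebra_simps)
    then show "(norm (weak_derivative (u $ k)) + norm (position (u $ k)) + norm (u $ k))\<^sup>2
      \<le> 3 * ((norm (weak_derivative (u $ k)))\<^sup>2 + (norm (position (u $ k)))\<^sup>2 + (norm (u $ k))\<^sup>2)" .
  qed simp
  also have "\<dots> = 12 * (\<Sum>k\<in>UNIV. (norm (weak_derivative (u $ k)))\<^sup>2 + (norm (position (u $ k)))\<^sup>2
      + (norm (u $ k))\<^sup>2)"
    by (simp only: sum_distrib_left[symmetric]) simp
  finally show ?thesis .
qed

text \<open>The pairing dominates the squared graph norm and is at most
  norm(\<open>shifted m \<theta> l u\<close>) times norm(\<open>shifted m (- \<theta>) l u\<close>).
  The second factor is again bounded by the graph norm, one power of which cancels.\<close>

lemma a_priori: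
  assumes \<theta>: "\<bar>\<theta>\<bar> < pi / 2" and l: "l\<^sup>2 \<ge> 2"
  obtains M where "M > 0" "\<And>u. u \<in> dom_H \<Longrightarrow> graph_norm u \<le> M * norm (shifted m \<theta> l u)"
proof -
  have cos: "cos \<theta> > 0" using \<theta> by (intro cos_gt_zero_pi) auto
  define C where "C = 1 + \<bar>m\<bar> + \<bar>l\<bar>"
  have C: "C > 0" by (simp add: C_def)
  have "graph_norm u \<le> (12 * C / cos \<theta>) * norm (shifted m \<theta> l u)" if u: "u \<in> dom_H" for u
  proof -
    \<comment> \<open>The signed squares in \<open>inner_shifted\<close> cost at most 1 per
      component, and m^2 + l^2 - 1 \<ge> 1 \<ge> cos \<theta> is left for the squared norm: this is
      where l^2 \<ge> 2 enters.\<close>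
    have "cos \<theta> * (a + b + c) \<le> cos \<theta> * (a + b) + (m\<^sup>2 + l\<^sup>2 - 1) * c" if "c \<ge> 0" for a b c :: real
    proof -
      have "cos \<theta> \<le> m\<^sup>2 + l\<^sup>2 - 1" using l cos_le_one[of \<theta>] zero_le_power2[of m] by linarith
      from mult_right_mono[OF this that] show ?thesis by (simp add: algebra_simps)
    qed
    then have "cos \<theta> * (\<Sum>k\<in>UNIV. (norm (weak_derivative (u $ k)))\<^sup>2 + (norm (position (u $ k)))\<^sup>2
        + (norm (u $ k))\<^sup>2)
      \<le> (\<Sum>k\<in>UNIV. cos \<theta> * ((norm (weak_derivative (u $ k)))\<^sup>2 + (norm (position (u $ k)))\<^sup>2)
          + (m\<^sup>2 + l\<^sup>2 - 1) * (norm (u $ k))\<^sup>2)"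
      unfolding sum_distrib_left by (intro sum_mono) simp
    also have "\<dots> \<le> shifted m \<theta> l u \<bullet> shifted m (- \<theta>) l u"
      unfolding inner_shifted[OF u] sum_4 by (simp add: left_diff_distrib)
    also have "\<dots> \<le> norm (shifted m \<theta> l u) * norm (shifted m (- \<theta>) l u)" by (rule norm_cauchy_schwarz)
    also have "\<dots> \<le> norm (shifted m \<theta> l u) * (C * graph_norm u)"
      unfolding C_def by (intro mult_left_mono norm_shifted_le) auto
    finally have e: "cos \<theta> * (\<Sum>k\<in>UNIV. (norm (weak_derivative (u $ k)))\<^sup>2
        + (norm (position (u $ k)))\<^sup>2 + (norm (u $ k))\<^sup>2)
       \<le> norm (shifted m \<theta> l u) * (C * graph_norm u)" .
    have "cos \<theta> * (graph_norm u)\<^sup>2 \<le> cos \<theta> * (12 * (\<Sum>k\<in>UNIV. (norm (weak_derivative (u $ k)))\<^sup>2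
        + (norm (position (u $ k)))\<^sup>2 + (norm (u $ k))\<^sup>2))"
      using graph_norm_sq_le cos by (intro mult_left_mono) auto
    also have "\<dots> \<le> 12 * (norm (shifted m \<theta> l u) * (C * graph_norm u))" using e by simp
    finally have "graph_norm u * (cos \<theta> * graph_norm u)
        \<le> graph_norm u * (12 * C * norm (shifted m \<theta> l u))"
      by (simp add: power2_eq_square mult_ac)
    then have "cos \<theta> * graph_norm u \<le> 12 * C * norm (shifted m \<theta> l u)"
      using graph_norm_nonneg[of u] C by (cases "graph_norm u = 0") (auto simp: mult_le_cancel_left)
    then show ?thesis using cos by (simp add: field_simps)
  qed
  then show thesis using that[of "12 * C / cos \<theta>"] C cos by simp
qed

section \<open>Closedness\<close>

lemma linear_shifted:
  assumes "u \<in> dom_H" "v \<in> dom_H"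
  shows "shifted m \<theta> l (u + v) = shifted m \<theta> l u + shifted m \<theta> l v"
    "shifted m \<theta> l (c *\<^sub>C u) = c *\<^sub>C shifted m \<theta> l u"
    "shifted m \<theta> l (u - v) = shifted m \<theta> l u - shifted m \<theta> l v" "u - v \<in> dom_H"
proof -
  note L = linear_operator_op_H[of m \<theta>, unfolded linear_operator_def]
  have add: "shifted m \<theta> l (u + v) = shifted m \<theta> l u + shifted m \<theta> l v" if "u \<in> dom_H" "v \<in> dom_H"
    for u v
    using L that by (simp add: shifted_def scaleC_add_right)
  have sc: "shifted m \<theta> l (c *\<^sub>C u) = c *\<^sub>C shifted m \<theta> l u" if "u \<in> dom_H" for u c
    using L that by (simp add: shifted_def scaleC_diff_right scaleC_scaleC mult.commute)
  show "shifted m \<theta> l (u + v) = shifted m \<theta> l u + shifted m \<theta> l v" "shifted m \<theta> l (c *\<^sub>C u)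
      = c *\<^sub>C shifted m \<theta> l u"
    using add sc assms by auto
  have d: "(-1) *\<^sub>C v \<in> dom_H" using L assms by blast
  have e: "u - v = u + (-1) *\<^sub>C v" by (simp add: scaleC_minus_left)
  show "u - v \<in> dom_H" using L assms d unfolding e by blast
  show "shifted m \<theta> l (u - v) = shifted m \<theta> l u - shifted m \<theta> l v"
    unfolding e add[OF assms(1) d] sc[OF assms(2)] by (simp add: scaleC_minus_left)
qed

lemma domD_diff:
  assumes "u \<in> domD" "v \<in> domD"
  shows "weak_derivative (u - v) = weak_derivative u - weak_derivative v" "position (u - v)
      = position u - position v"
proof -
  have e: "u - v = u + (-1) *\<^sub>C v" by (simp add: scaleC_minus_left)
  show "weak_derivative (u - v) = weak_derivative u - weak_derivative v" "position (u - v)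
      = position u - position v"
    unfolding e domD_add(2,3)[OF assms(1) domD_scaleC(1)[OF assms(2)]] domD_scaleC(2,3)[OF assms(2)]
    by (simp_all add: scaleC_minus_left)
qed

text \<open>The estimate, applied to differences, makes components, derivatives and positions Cauchy
  separately, and \<open>domD_closed\<close> identifies the limits. It serves both for the
  closedness of the operator and for that of the range.\<close>

lemma shifted_Cauchy_limit:
  assumes \<theta>: "\<bar>\<theta>\<bar> < pi / 2" and l: "l\<^sup>2 \<ge> 2"
    and X: "\<And>n. X n \<in> dom_H" and C: "Cauchy (\<lambda>n. shifted m \<theta> l (X n))"
  obtains u where "u \<in> dom_H" "X \<longlonglongrightarrow> u" "(\<lambda>n. op_H m \<theta> (X n)) \<longlonglongrightarrow> op_H m \<theta> u"
proof -
  obtain M where M: "M > 0" "\<And>u. u \<in> dom_H \<Longrightarrow> graph_norm u \<le> M * norm (shifted m \<theta> l u)"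
    using a_priori[OF \<theta> l] by metis
  have XD: "X n $ k \<in> domD" for n k using X[of n] by (simp add: dom_H_def)
  have small: "\<exists>N. \<forall>i\<ge>N. \<forall>j\<ge>N. graph_norm (X i - X j) < e" if e: "e > 0" for e
  proof -
    have "e / M > 0" using e M(1) by simp
    then obtain N where N: "\<forall>i\<ge>N. \<forall>j\<ge>N. norm (shifted m \<theta> l (X i) - shifted m \<theta> l (X j)) < e / M"
      using C unfolding Cauchy_iff by blast
    have "graph_norm (X i - X j) < e" if "i \<ge> N" "j \<ge> N" for i j
    proof -
      have "graph_norm (X i - X j) \<le> M * norm (shifted m \<theta> l (X i) - shifted m \<theta> l (X j))"
        using M(2)[OF linear_shifted(4)[OF X X, of i j]] by (simp add: linear_shifted(3)[OF X X])
      also have "\<dots> < M * (e / M)" using N that M(1) by (intro mult_strict_left_mono) auto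
      finally show ?thesis using M(1) by simp
    qed
    then show ?thesis by blast
  qed
  have conv: "\<exists>y. (\<lambda>n. F (X n $ k)) \<longlonglongrightarrow> y"
    if F: "\<And>i j. norm (F (X i $ k) - F (X j $ k)) \<le> graph_norm (X i - X j)" for F :: "L2 \<Rightarrow> L2" and k
  proof -
    have "Cauchy (\<lambda>n. F (X n $ k))"
      unfolding Cauchy_iff using small F by (meson order_le_less_trans)
    then show ?thesis using Cauchy_convergent convergent_def by blast
  qed
  have "\<exists>y. (\<lambda>n. weak_derivative (X n $ k)) \<longlonglongrightarrow> y" for k
    by (rule conv) (simp only: domD_diff(1)[OF XD XD, symmetric] norms_le_graph_norm flip: vector_minus_component)
  then obtain v where v: "\<And>k. (\<lambda>n. weak_derivative (X n $ k)) \<longlonglongrightarrow> v k" by metis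
  have "\<exists>y. (\<lambda>n. position (X n $ k)) \<longlonglongrightarrow> y" for k
    by (rule conv) (simp only: domD_diff(2)[OF XD XD, symmetric] norms_le_graph_norm flip: vector_minus_component)
  then obtain w where w: "\<And>k. (\<lambda>n. position (X n $ k)) \<longlonglongrightarrow> w k" by metis
  have "\<exists>y. (\<lambda>n. X n $ k) \<longlonglongrightarrow> y" for k
    using conv[of "\<lambda>x. x" k] norms_le_graph_norm(3)[of _ k] by (simp flip: vector_minus_component)
  then obtain u where u: "\<And>k. (\<lambda>n. X n $ k) \<longlonglongrightarrow> u k" by metis
  define U where "U = (\<chi> k. u k)"
  have Uk: "U $ k = u k" for k by (simp add: U_def)
  note D = domD_closed[OF XD u v w]
  have "U \<in> dom_H" using D(1) by (simp add: dom_H_def Uk)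
  moreover have "X \<longlonglongrightarrow> U" by (rule vec_tendstoI) (simp add: Uk u)
  moreover have "(\<lambda>n. op_H m \<theta> (X n)) \<longlonglongrightarrow> op_H m \<theta> U"
  proof (rule vec_tendstoI)
    fix i :: 4
    have fo: "(\<lambda>n. first_order a b (X n $ k)) \<longlonglongrightarrow> first_order a b (U $ k)" for a b k
      unfolding first_order_def Uk D(2,3) by (intro tendsto_add tendsto_scaleC v w)
    have uk: "(\<lambda>n. X n $ k) \<longlonglongrightarrow> U $ k" for k using u Uk by simp
    have "\<forall>i. (\<lambda>n. op_H m \<theta> (X n) $ i) \<longlonglongrightarrow> op_H m \<theta> U $ i"
      unfolding forall_4 op_H_components
          by (intro conjI tendsto_add tendsto_diff tendsto_scaleR tendsto_const fo uk)
    then show "(\<lambda>n. op_H m \<theta> (X n) $ i) \<longlonglongrightarrow> op_H m \<theta> U $ i" ..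
  qed
  ultimately show thesis by (rule that)
qed

lemma closed_operator_op_H:
  assumes \<theta>: "\<bar>\<theta>\<bar> < pi / 2"
  shows "closed_operator dom_H (op_H m \<theta>)"
  unfolding closed_operator_def
proof (intro conjI linear_operator_op_H)
  show "closed {(u, op_H m \<theta> u) |u. u \<in> dom_H}"
    unfolding closed_sequential_limits
  proof (intro allI impI, elim conjE)
    fix Z z assume Z: "\<forall>n. Z n \<in> {(u, op_H m \<theta> u) |u. u \<in> dom_H}" and lim: "Z \<longlonglongrightarrow> z"
    define X where "X n = fst (Z n)" for n
    have X: "X n \<in> dom_H" and Zn: "snd (Z n) = op_H m \<theta> (X n)" for n
      using Z by (auto simp: X_def dest!: spec[of _ n])
    have limX: "X \<longlonglongrightarrow> fst z" and limH: "(\<lambda>n. op_H m \<theta> (X n)) \<longlonglongrightarrow> snd z"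
      using tendsto_fst[OF lim] tendsto_snd[OF lim] by (simp_all add: X_def[abs_def] Zn[unfolded X_def])
    \<comment> \<open>Convergence of X and of its images makes the shifted images converge; the
      shift 2 is a convenient value with l^2 \<ge> 2.\<close>
    have "(\<lambda>n. shifted m \<theta> 2 (X n)) \<longlonglongrightarrow> snd z - (\<i> * of_real 2) *\<^sub>C fst z"
      unfolding shifted_def by (intro tendsto_diff tendsto_scaleC limX limH)
    then have "Cauchy (\<lambda>n. shifted m \<theta> 2 (X n))" by (rule LIMSEQ_imp_Cauchy)
    then obtain u where u: "u \<in> dom_H" "X \<longlonglongrightarrow> u" "(\<lambda>n. op_H m \<theta> (X n)) \<longlonglongrightarrow> op_H m \<theta> u"
      using shifted_Cauchy_limit[where X=X and m=m and l=2, OF \<theta> _ X] by auto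
    have "fst z = u" "snd z = op_H m \<theta> u" using LIMSEQ_unique limX limH u by blast+
    then have "z = (u, op_H m \<theta> u)" by (simp add: prod_eq_iff)
    then show "z \<in> {(u, op_H m \<theta> u) |u. u \<in> dom_H}" using u(1) by blast
  qed
qed

section \<open>Surjectivity\<close>

text \<open>A minimising sequence is Cauchy by the parallelogram law, since midpoints stay in
  \<open>S\<close>. Orthogonality for the real inner product is what
  \<open>orthogonal_range_zero\<close> asks for.\<close>

lemma orthogonal_projection:
  fixes S :: "'a::{real_inner, complete_space} set"
  assumes S: "subspace S" and cl: "closed S"
  obtains y where "y \<in> S" "\<And>z. z \<in> S \<Longrightarrow> (x - y) \<bullet> z = 0"
proof -
  define d where "d = (INF y\<in>S. (norm (x - y))\<^sup>2)"
  have bdd: "bdd_below ((\<lambda>y. (norm (x - y))\<^sup>2) ` S)" by (rule bdd_belowI2[of _ 0]) simp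
  have ne: "S \<noteq> {}" using subspace_0[OF S] by blast
  have d_le: "d \<le> (norm (x - y))\<^sup>2" if "y \<in> S" for y
    unfolding d_def by (rule cINF_lower[OF bdd that])
  have "\<exists>y\<in>S. (norm (x - y))\<^sup>2 < d + 1 / real (Suc n)" for n
    using cINF_less_iff[OF ne bdd, of "d + 1 / real (Suc n)"] by (simp add: d_def)
  then obtain Y where Y: "\<And>n. Y n \<in> S" "\<And>n. (norm (x - Y n))\<^sup>2 < d + 1 / real (Suc n)" by metis
  have par: "(norm (Y i - Y j))\<^sup>2 \<le> 2 * (1 / real (Suc i)) + 2 * (1 / real (Suc j))" for i j
  proof -
    define a where "a = x - Y i"
    define b where "b = x - Y j"
    have "(1/2) *\<^sub>R (Y i + Y j) \<in> S" using S Y by (intro subspace_mul subspace_add)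
    from d_le[OF this] have "d \<le> (norm ((1/2) *\<^sub>R (a + b)))\<^sup>2"
      by (simp add: a_def b_def algebra_simps flip: scaleR_2)
    then have "4 * d \<le> (norm (a + b))\<^sup>2" by (simp add: power_divide)
    moreover have "(norm (a - b))\<^sup>2 + (norm (a + b))\<^sup>2 = 2 * (norm a)\<^sup>2 + 2 * (norm b)\<^sup>2"
      by (simp add: power2_norm_eq_inner inner_add_left inner_add_right inner_diff_left inner_diff_right)
    moreover have "(norm (a - b))\<^sup>2 = (norm (Y i - Y j))\<^sup>2"
      by (simp add: a_def b_def norm_minus_commute)
    ultimately show ?thesis using Y(2)[of i, folded a_def] Y(2)[of j, folded b_def] by linarith
  qed
  have "Cauchy Y"
    unfolding Cauchy_iff
  proof (intro allI impI)
    fix e :: real assume "e > 0"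
    then obtain N where N: "1 / real (Suc N) < e\<^sup>2 / 4" using nat_approx_posE[of "e\<^sup>2 / 4"] by auto
    have "norm (Y i - Y j) < e" if "i \<ge> N" "j \<ge> N" for i j
    proof (rule power2_less_imp_less)
      have "1 / real (Suc i) \<le> 1 / real (Suc N)" "1 / real (Suc j) \<le> 1 / real (Suc N)"
        using that by (auto intro!: divide_left_mono)
      then show "(norm (Y i - Y j))\<^sup>2 < e\<^sup>2" using par[of i j] N by simp
    qed (use \<open>e > 0\<close> in simp)
    then show "\<exists>N. \<forall>i\<ge>N. \<forall>j\<ge>N. norm (Y i - Y j) < e" by blast
  qed
  then obtain y where y: "Y \<longlonglongrightarrow> y" using Cauchy_convergent convergent_def by blast
  have yS: "y \<in> S" using cl Y(1) y closed_sequentially by blast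
  have yd: "(norm (x - y))\<^sup>2 \<le> d"
  proof (rule LIMSEQ_le)
    show "(\<lambda>n. (norm (x - Y n))\<^sup>2) \<longlonglongrightarrow> (norm (x - y))\<^sup>2" by (intro tendsto_intros y)
    have "(\<lambda>n. d + inverse (real (Suc n))) \<longlonglongrightarrow> d + 0"
      by (intro tendsto_add tendsto_const LIMSEQ_inverse_real_of_nat)
    then show "(\<lambda>n. d + 1 / real (Suc n)) \<longlonglongrightarrow> d" by (simp add: inverse_eq_divide)
    show "\<exists>N. \<forall>n\<ge>N. (norm (x - Y n))\<^sup>2 \<le> d + 1 / real (Suc n)" using Y(2) less_imp_le by blast
  qed
  have "(x - y) \<bullet> z = 0" if z: "z \<in> S" for z
  proof (cases "z = 0")
    case False
    \<comment> \<open>The minimiser of the quadratic polynomial norm(x - y - t z)^2 in t.\<close>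
    define t where "t = ((x - y) \<bullet> z) / (z \<bullet> z)"
    have "(norm (x - y))\<^sup>2 \<le> (norm (x - (y + t *\<^sub>R z)))\<^sup>2"
      by (rule order_trans[OF yd d_le], intro subspace_add subspace_mul S yS z)
    also have "\<dots> = (norm (x - y))\<^sup>2 - 2 * t * ((x - y) \<bullet> z) + t * t * (z \<bullet> z)"
      unfolding power2_norm_eq_inner
      by (simp add: inner_add_left inner_add_right inner_diff_left inner_diff_right inner_commute algebra_simps)
    finally have "2 * t * ((x - y) \<bullet> z) \<le> t * (t * (z \<bullet> z))" by simp
    also have "t * (z \<bullet> z) = (x - y) \<bullet> z" using False by (simp add: t_def)
    finally have "((x - y) \<bullet> z) * ((x - y) \<bullet> z) / (z \<bullet> z) \<le> 0" by (simp add: t_def)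
    moreover have "z \<bullet> z > 0" using False by simp
    ultimately have "((x - y) \<bullet> z) * ((x - y) \<bullet> z) \<le> 0" by (simp add: divide_le_0_iff)
    then show ?thesis using mult_eq_0_iff zero_le_square[of "(x - y) \<bullet> z"] by (metis order_antisym)
  qed simp
  then show thesis using that yS by blast
qed

text \<open>As \<open>y\<close> is already in the weighted space, the position term can be moved
  onto it; what remains says that \<open>cnj a *\<^sub>C y\<close> has a weak derivative in
  \<open>L2\<close>.\<close>

lemma first_order_adjoint_regular:
  assumes a: "a \<noteq> 0" and y: "y \<in> L2_weighted"
    and h: "\<And>\<psi>. \<psi> \<in> domD \<Longrightarrow> y \<bullet> first_order a b \<psi> = h \<bullet> \<psi>"
  shows "y \<in> domD" "first_order (- cnj a) (cnj b) y = h"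
proof -
  have "has_weak_derivative (cnj a *\<^sub>C y) (- (h - cnj b *\<^sub>C position y))"
  proof (rule has_weak_derivativeI)
    fix w w' assume w: "has_weak_derivative w w'" "w \<in> L2_weighted"
    have "y \<bullet> (a *\<^sub>C w' + b *\<^sub>C position w) = h \<bullet> w"
      using h[OF domDI(1)[OF w]] domDI(2)[OF w] by (simp add: first_order_def)
    moreover have "y \<bullet> (b *\<^sub>C position w) = (cnj b *\<^sub>C position y) \<bullet> w"
      using position_symmetric[OF position_scaleC(1)[OF y, of "cnj b"] w(2)]
      by (simp add: inner_L2_scaleC_right position_scaleC(2)[OF y])
    ultimately show "- (h - cnj b *\<^sub>C position y) \<bullet> w + cnj a *\<^sub>C y \<bullet> w' = 0"
      by (simp add: inner_add_right inner_diff_left inner_L2_scaleC_right)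
  qed
  from has_weak_derivative_scaleC[OF this, of "inverse (cnj a)"]
  have "has_weak_derivative y (inverse (cnj a) *\<^sub>C (- (h - cnj b *\<^sub>C position y)))"
    using a by (simp add: scaleC_scaleC)
  from domDI[OF this y] show "y \<in> domD" "first_order (- cnj a) (cnj b) y = h"
    using a by (simp_all add: first_order_def scaleC_scaleC scaleC_minus_left scaleC_minus_right)
qed

lemma axis_dom_H:
  assumes "\<psi> \<in> domD"
  shows "axis k \<psi> \<in> dom_H"
  using assms by (auto simp: dom_H_def axis_def domD_zero)

text \<open>Test vectors with a single nonzero component split the system into four scalar
  identities, to each of which \<open>first_order_adjoint_regular\<close> applies.\<close>

lemma shifted_adjoint_regular:
  assumes y: "\<And>k. y $ k \<in> L2_weighted"
    and g: "\<And>v. v \<in> dom_H \<Longrightarrow> y \<bullet> shifted m \<theta> l v = g \<bullet> v"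
  shows "y \<in> dom_H" "shifted m (- \<theta>) (- l) y = g"
proof -
  define z where "z = \<i> * of_real l"
  have z: "cnj z = - z" by (simp add: z_def)
  have zl: "v \<bullet> (z *\<^sub>C w) = - ((z *\<^sub>C v) \<bullet> w)" for v w :: L2
    by (simp add: inner_L2_scaleC_right z scaleC_minus_left)
  have ax: "axis k \<psi> $ j = (if j = k then \<psi> else 0)" for k j and \<psi> :: L2
    by (simp add: axis_def)
  note comp = inner_vec_def sum_4 shifted_components z_def[symmetric]
  \<comment> \<open>The facts are numbered by the test component: component k of the test vector is
    differentiated in row 5 - k.\<close>
  have 4: "y $ 1 \<bullet> first_order (Acoeff \<theta>) (Bcoeff \<theta>) \<psi> = (g $ 4 + m *\<^sub>R y $ 2 - z *\<^sub>C y $ 4) \<bullet> \<psi>"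
    if "\<psi> \<in> domD" for \<psi>
    using g[OF axis_dom_H[OF that, of 4]] unfolding comp
    by (simp add: ax first_order_zero inner_diff_right inner_add_right inner_diff_left inner_add_left zl)
  have 3: "y $ 2 \<bullet> first_order (Acoeff \<theta>) (- Bcoeff \<theta>) \<psi> = (g $ 3 - m *\<^sub>R y $ 1 - z *\<^sub>C y $ 3) \<bullet> \<psi>"
    if "\<psi> \<in> domD" for \<psi>
    using g[OF axis_dom_H[OF that, of 3]] unfolding comp
    by (simp add: ax first_order_zero inner_diff_right inner_add_right inner_diff_left inner_add_left zl)
  have 2: "y $ 3 \<bullet> first_order (Acoeff \<theta>) (Bcoeff \<theta>) \<psi> = (g $ 2 + m *\<^sub>R y $ 4 - z *\<^sub>C y $ 2) \<bullet> \<psi>"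
    if "\<psi> \<in> domD" for \<psi>
    using g[OF axis_dom_H[OF that, of 2]] unfolding comp
    by (simp add: ax first_order_zero inner_diff_right inner_add_right inner_diff_left inner_add_left zl)
  have 1: "y $ 4 \<bullet> first_order (Acoeff \<theta>) (- Bcoeff \<theta>) \<psi> = (g $ 1 - m *\<^sub>R y $ 3 - z *\<^sub>C y $ 1) \<bullet> \<psi>"
    if "\<psi> \<in> domD" for \<psi>
    using g[OF axis_dom_H[OF that, of 1]] unfolding comp
    by (simp add: ax first_order_zero inner_diff_right inner_add_right inner_diff_left inner_add_left zl)
  note R1 = first_order_adjoint_regular[OF Acoeff_nz y 4, simplified cnj_coeffs complex_cnj_minus minus_minus]
  note R2 = first_order_adjoint_regular[OF Acoeff_nz y 3, simplified cnj_coeffs complex_cnj_minus minus_minus]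
  note R3 = first_order_adjoint_regular[OF Acoeff_nz y 2, simplified cnj_coeffs complex_cnj_minus minus_minus]
  note R4 = first_order_adjoint_regular[OF Acoeff_nz y 1, simplified cnj_coeffs complex_cnj_minus minus_minus]
  show "y \<in> dom_H" unfolding dom_H_def mem_Collect_eq forall_4 using R1(1) R2(1) R3(1) R4(1) by blast
  show "shifted m (- \<theta>) (- l) y = g"
    unfolding vec_eq_iff forall_4 shifted_components
    using R1(2) R2(2) R3(2) R4(2) by (simp add: z_def scaleC_minus_left)
qed


section \<open>Rational cut-off functions\<close>

text \<open>Decays fast enough that its product with x is bounded by 1/c, tends to 1 as c tends to
  0, and has a derivative bounded by c.\<close>

definition cutoff :: "real \<Rightarrow> real \<Rightarrow> complex" where
  "cutoff c x = of_real (1 / (1 + (c * x)\<^sup>2))"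

definition cutoff' :: "real \<Rightarrow> real \<Rightarrow> complex" where
  "cutoff' c x = of_real (- (2 * c * (c * x)) / (1 + (c * x)\<^sup>2)\<^sup>2)"

lemma cutoff_denominator: "1 + (c * x)\<^sup>2 > (0::real)" "\<bar>c * x\<bar> * 2 \<le> 1 + (c * x)\<^sup>2"
proof -
  show "1 + (c * x)\<^sup>2 > 0" using zero_le_power2[of "c * x"] by linarith
  have "0 \<le> (\<bar>c * x\<bar> - 1)\<^sup>2" by simp
  then show "\<bar>c * x\<bar> * 2 \<le> 1 + (c * x)\<^sup>2" unfolding power2_diff by simp
qed

lemma cutoff_has_ac_derivative: "has_ac_derivative (cutoff c) (cutoff' c)"
proof (rule has_ac_derivative_C1)
  fix x
  have "((\<lambda>x. 1 / (1 + (c * x)\<^sup>2)) has_real_derivative - (2 * c * (c * x)) / (1 + (c * x)\<^sup>2)\<^sup>2) (at x)"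
    by (rule derivative_eq_intros refl | use cutoff_denominator(1)[of c x] in \<open>simp add: power2_eq_square\<close>)+
  then show "(cutoff c has_vector_derivative cutoff' c x) (at x)"
    unfolding cutoff_def[abs_def] cutoff'_def
    by (intro has_vector_derivative_of_real) (simp add: has_real_derivative_iff_has_vector_derivative)
next
  have "1 + (c * x)\<^sup>2 \<noteq> 0" for x using cutoff_denominator(1)[of c x] by linarith
  then show "continuous_on UNIV (cutoff' c)"
    unfolding cutoff'_def[abs_def] by (intro continuous_intros) auto
qed

lemma cutoff_bounds:
  assumes "c > 0"
  shows "norm (cutoff c x) \<le> 1" "norm (cutoff' c x) \<le> c" "norm (of_real x * cutoff c x) \<le> 1 / c"
proof -
  define D where "D = 1 + (c * x)\<^sup>2"
  have D: "D \<ge> 1" "\<bar>c * x\<bar> * 2 \<le> D" using cutoff_denominator(2)[of c x] by (simp_all add: D_def)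
  show "norm (cutoff c x) \<le> 1" unfolding cutoff_def D_def[symmetric] norm_of_real using D by simp
  have "\<bar>2 * c * (c * x)\<bar> = c * (\<bar>c * x\<bar> * 2)" using assms by (simp add: abs_mult)
  also have "\<dots> \<le> c * (D * D)"
  proof (rule mult_left_mono)
    have "D * 1 \<le> D * D" using D by (intro mult_left_mono) auto
    with D(2) show "\<bar>c * x\<bar> * 2 \<le> D * D" by linarith
  qed (use assms in simp)
  finally have "\<bar>2 * c * (c * x)\<bar> / (D * D) \<le> c" using D by (simp add: divide_le_eq)
  then show "norm (cutoff' c x) \<le> c"
    unfolding cutoff'_def D_def[symmetric] norm_of_real unfolding power2_eq_square using D
      by (simp add: abs_divide)
  have "\<bar>x\<bar> * c \<le> D" using D assms by (simp add: abs_mult mult.commute)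
  then have "\<bar>x\<bar> * c / (D * c) \<le> D / (D * c)" using D assms by (intro divide_right_mono) auto
  then have "\<bar>x\<bar> / D \<le> 1 / c" using D assms by simp
  then show "norm (of_real x * cutoff c x) \<le> 1 / c"
    unfolding cutoff_def D_def[symmetric] norm_mult norm_of_real using D by (simp add: abs_divide)
qed

lemma cutoff_multiplier:
  assumes "c > 0"
  shows "bounded_multiplier (cutoff c) 1" "bounded_multiplier (cutoff' c) c"
    "bounded_multiplier (\<lambda>x. of_real x * cutoff c x) (1 / c)"
proof -
  note m = has_ac_derivative_measurable[OF cutoff_has_ac_derivative[of c]]
  show "bounded_multiplier (cutoff c) 1" using m(1) cutoff_bounds(1)[OF assms]
    by (rule bounded_multiplier.intro)
  show "bounded_multiplier (cutoff' c) c" using m(2) cutoff_bounds(2)[OF assms]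
    by (rule bounded_multiplier.intro)
  have "(\<lambda>x. of_real x * cutoff c x) \<in> borel_measurable borel" using m(1) by measurable
  then show "bounded_multiplier (\<lambda>x. of_real x * cutoff c x) (1 / c)"
    using cutoff_bounds(3)[OF assms] by (rule bounded_multiplier.intro)
qed

lemma mult_op_inner_real:
  assumes "bounded_multiplier b C" and real: "\<And>x. cnj (b x) = b x"
  shows "mult_op b u \<bullet> v = u \<bullet> mult_op b v"
proof -
  interpret bounded_multiplier b C by fact
  obtain f where f: "sq_integrable f" "u = abs_L2 f" using L2_cases .
  obtain g where g: "sq_integrable g" "v = abs_L2 g" using L2_cases .
  have "b x * f x * cnj (g x) = f x * cnj (b x * g x)" for x by (simp add: real)
  then show ?thesis unfolding f(2) g(2)
    by (simp only: mult_op_abs_L2 f(1) g(1) inner_abs_L2_Re sq_integrable_mult)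
qed

lemma cutoff_real: "cnj (cutoff c x) = cutoff c x" "cnj (cutoff' c x) = cutoff' c x"
  by (simp_all add: cutoff_def cutoff'_def)

text \<open>Brings an arbitrary element of \<open>L2\<close> within the reach of
  \<open>shifted_adjoint_regular\<close>.\<close>

lemma cutoff_weighted:
  assumes "c > 0" shows "mult_op (cutoff c) u \<in> L2_weighted"
proof -
  obtain f where f: "sq_integrable f" "u = abs_L2 f" using L2_cases .
  have "sq_integrable (\<lambda>x. of_real x * cutoff c x * f x)"
    by (rule bounded_multiplier.sq_integrable_mult[OF cutoff_multiplier(3)[OF assms] f(1)])
  then show ?thesis unfolding f(2) bounded_multiplier.mult_op_abs_L2[OF cutoff_multiplier(1)[OF assms] f(1)]
    using bounded_multiplier.sq_integrable_mult[OF cutoff_multiplier(1)[OF assms] f(1)]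
    by (simp add: L2_weighted_abs_L2 mult.assoc)
qed

text \<open>Multiplication commutes with position, so the commutator comes from the derivative alone
  and is multiplication by \<open>cutoff'\<close>.\<close>

lemma cutoff_domD:
  assumes c: "c > 0" and u: "u \<in> domD"
  shows "mult_op (cutoff c) u \<in> domD"
    "mult_op (cutoff c) (first_order a b u) = first_order a b (mult_op (cutoff c) u)
        - a *\<^sub>C mult_op (cutoff' c) u"
proof -
  interpret X: bounded_multiplier "cutoff c" 1 using cutoff_multiplier(1)[OF c] .
  interpret X': bounded_multiplier "cutoff' c" c using cutoff_multiplier(2)[OF c] .
  obtain f g where f: "has_ac_derivative f g" "sq_integrable f" "sq_integrable g"
      "sq_integrable (\<lambda>x. of_real x * f x)"
    "u = abs_L2 f" "weak_derivative u = abs_L2 g" "position u = abs_L2 (\<lambda>x. of_real x * f x)"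
    using domD_cases[OF u] .
  have s: "sq_integrable (\<lambda>x. cutoff c x * f x)" "sq_integrable (\<lambda>x. cutoff' c x * f x)"
      "sq_integrable (\<lambda>x. cutoff c x * g x)"
    by (intro X.sq_integrable_mult X'.sq_integrable_mult f)+
  have "has_weak_derivative (abs_L2 (\<lambda>x. cutoff c x * f x)) (abs_L2 (\<lambda>x. cutoff' c x * f x
      + cutoff c x * g x))"
    by (intro has_weak_derivative_ac has_ac_derivative_mult cutoff_has_ac_derivative f s sq_integrable_add)
  then have w: "has_weak_derivative (mult_op (cutoff c) u) (mult_op (cutoff' c) u
      + mult_op (cutoff c) (weak_derivative u))"
    unfolding f(6) unfolding f(5) by (simp add: X.mult_op_abs_L2 X'.mult_op_abs_L2 f plus_abs_L2 s)
  note D = domDI[OF w cutoff_weighted[OF c]]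
  show "mult_op (cutoff c) u \<in> domD" by (rule D(1))
  have "position (mult_op (cutoff c) u) = mult_op (cutoff c) (position u)"
    unfolding f(7) X.mult_op_abs_L2[OF f(4)] unfolding f(5) X.mult_op_abs_L2[OF f(2)]
    using X.sq_integrable_mult[OF f(4)] by (subst position_abs_L2) (simp_all add: s mult.left_commute)
  then show "mult_op (cutoff c) (first_order a b u) = first_order a b (mult_op (cutoff c) u)
      - a *\<^sub>C mult_op (cutoff' c) u"
    by (simp add: first_order_def D(2) X.mult_op_add X.mult_op_scaleC scaleC_add_right)
qed

text \<open>The cut-offs tend to 1 pointwise and are bounded by 1, so the norms converge to that of
  \<open>w\<close> while the bounds tend to 0.\<close>

lemma cutoff_limit_zero:
  assumes "\<And>n. norm (mult_op (cutoff (1 / real (Suc n))) w) \<le> B / real (Suc n)"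
  shows "w = 0"
proof -
  obtain f where f: "sq_integrable f" "w = abs_L2 f" using L2_cases .
  have [measurable]: "f \<in> borel_measurable borel" using f(1) by (rule sq_integrable_measurable)
  have [measurable]: "cutoff c \<in> borel_measurable borel" for c
    using has_ac_derivative_measurable[OF cutoff_has_ac_derivative] by blast
  have eq: "(norm (mult_op (cutoff (1 / real (Suc n))) w))\<^sup>2
      = (\<integral>x. (norm (cutoff (1 / real (Suc n)) x * f x))\<^sup>2 \<partial>lborel)" for n
  proof -
    interpret bounded_multiplier "cutoff (1 / real (Suc n))" 1 by (rule cutoff_multiplier) simp
    show ?thesis unfolding f(2) mult_op_abs_L2[OF f(1)]
      by (rule norm_abs_L2[OF sq_integrable_mult[OF f(1)]])
  qed
  have "(\<lambda>n. \<integral>x. (norm (cutoff (1 / real (Suc n)) x * f x))\<^sup>2 \<partial>lborel) \<longlonglongrightarrow> (\<integral>x. (norm (f x))\<^sup>2 \<partial>lborel)"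
  proof (rule integral_dominated_convergence[where w="\<lambda>x. (norm (f x))\<^sup>2"])
    show "integrable lborel (\<lambda>x. (norm (f x))\<^sup>2)" using f(1) by (simp add: sq_integrable_def)
    show "AE x in lborel. (\<lambda>n. (norm (cutoff (1 / real (Suc n)) x * f x))\<^sup>2) \<longlonglongrightarrow> (norm (f x))\<^sup>2"
    proof (intro AE_I2)
      fix x
      have l0: "(\<lambda>n. 1 / real (Suc n) * x) \<longlonglongrightarrow> 0"
        using tendsto_mult[OF LIMSEQ_inverse_real_of_nat tendsto_const[of x]]
          by (simp add: inverse_eq_divide)
      have "(\<lambda>n. (norm (cutoff (1 / real (Suc n)) x * f x))\<^sup>2)
          \<longlonglongrightarrow> (norm (of_real (1 / (1 + 0\<^sup>2)) * f x))\<^sup>2"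
        unfolding cutoff_def by (intro tendsto_intros l0) simp
      then show "(\<lambda>n. (norm (cutoff (1 / real (Suc n)) x * f x))\<^sup>2) \<longlonglongrightarrow> (norm (f x))\<^sup>2" by simp
    qed
    show "AE x in lborel. norm ((norm (cutoff (1 / real (Suc n)) x * f x))\<^sup>2) \<le> (norm (f x))\<^sup>2" for n
      using cutoff_bounds(1)[of "1 / real (Suc n)"]
      by (intro AE_I2) (simp add: norm_mult mult_left_le_one_le power_mono del: of_nat_Suc)
  qed measurable
  then have lim: "(\<lambda>n. (norm (mult_op (cutoff (1 / real (Suc n))) w))\<^sup>2) \<longlonglongrightarrow> (norm w)\<^sup>2"
    unfolding eq unfolding f(2) norm_abs_L2[OF f(1)] .
  have "(\<lambda>n. (B * inverse (real (Suc n)))\<^sup>2) \<longlonglongrightarrow> (B * 0)\<^sup>2"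
    by (intro tendsto_intros LIMSEQ_inverse_real_of_nat)
  moreover have "(norm (mult_op (cutoff (1 / real (Suc n))) w))\<^sup>2 \<le> (B * inverse (real (Suc n)))\<^sup>2"
    for n
    using assms[of n] by (intro power_mono) (simp_all add: divide_inverse)
  ultimately have "(norm w)\<^sup>2 \<le> (B * 0)\<^sup>2" using LIMSEQ_le[OF lim] by blast
  then show "w = 0" by simp
qed

text \<open>Cutting off an element orthogonal to the range puts it into the domain, at the price of a small
  commutator; the a priori estimate for the adjoint angle then forces it to vanish.\<close>

lemma orthogonal_range_zero:
  assumes \<theta>: "\<bar>\<theta>\<bar> < pi / 2" and l: "l\<^sup>2 \<ge> 2"
    and w: "\<And>v. v \<in> dom_H \<Longrightarrow> w \<bullet> shifted m \<theta> l v = 0"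
  shows "w = 0"
proof -
  have "\<bar>- \<theta>\<bar> < pi / 2" "(- l)\<^sup>2 \<ge> 2" using \<theta> l by simp_all
  then obtain M where M: "M > 0" "\<And>u. u \<in> dom_H \<Longrightarrow> graph_norm u \<le> M * norm (shifted m (- \<theta>) (- l) u)"
    using a_priori by metis
  define W where "W = (\<Sum>k\<in>UNIV. norm (w $ k))"
  have bound: "norm (mult_op (cutoff c) (w $ k)) \<le> M * (c * W)" if c: "c > 0" for c k
  proof -
    interpret X: bounded_multiplier "cutoff c" 1 using cutoff_multiplier(1)[OF c] .
    interpret X': bounded_multiplier "cutoff' c" c using cutoff_multiplier(2)[OF c] .
    define X where "X = mult_op (cutoff c)"
    define X' where "X' = mult_op (cutoff' c)"
    define A where "A = Acoeff \<theta>"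
    define y :: "L2 ^ 4" where "y = (\<chi> k. X (w $ k))"
    \<comment> \<open>The commutator terms, moved onto \<open>w\<close>: the scalar \<open>A\<close>
      becomes \<open>cnj A\<close>, and the order is reversed because component k of a vector is
      differentiated in row 5 - k.\<close>
    define g :: "L2 ^ 4" where "g = vector [- X' (cnj A *\<^sub>C w $ 4), - X' (cnj A *\<^sub>C w $ 3),
        - X' (cnj A *\<^sub>C w $ 2), - X' (cnj A *\<^sub>C w $ 1)]"
    have yk: "y $ k = X (w $ k)" for k by (simp add: y_def)
    have Xlin: "X (u + v) = X u + X v" "X (u - v) = X u - X v" "X (r *\<^sub>R u) = r *\<^sub>R X u"
        "X (d *\<^sub>C u) = d *\<^sub>C X u" for u v r d
      unfolding X_def using X.bounded_linear_mult_op X.mult_op_scaleC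
      by (auto simp: linear_add linear_diff linear_scale dest!: bounded_linear.linear)
    have "y \<bullet> shifted m \<theta> l v = g \<bullet> v" if v: "v \<in> dom_H" for v
    proof -
      have vD: "v $ k \<in> domD" for k using v by (simp add: dom_H_def)
      define Xv :: "L2 ^ 4" where "Xv = (\<chi> k. X (v $ k))"
      have Xvk: "Xv $ k = X (v $ k)" for k by (simp add: Xv_def)
      have "Xv \<in> dom_H" using cutoff_domD(1)[OF c vD] by (simp add: dom_H_def Xvk X_def)
      note w0 = w[OF this]
      have Xfo: "X (first_order a b (v $ k)) = first_order a b (X (v $ k)) - a *\<^sub>C X' (v $ k)" for a b k
        unfolding X_def X'_def by (rule cutoff_domD(2)[OF c vD])
      have sym: "X u \<bullet> v = u \<bullet> X v" "X' u \<bullet> v = u \<bullet> X' v" for u v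
        unfolding X_def X'_def
        using mult_op_inner_real[OF cutoff_multiplier(1)[OF c] cutoff_real(1)] mult_op_inner_real[OF cutoff_multiplier(2)[OF c] cutoff_real(2)] by auto
      \<comment> \<open>The cut-off is symmetric, so it moves onto the value of
        \<open>shifted\<close>; commuting it further inside leaves a pairing of \<open>w\<close>
        with the range, which is 0, and the commutators.\<close>
      have "y \<bullet> shifted m \<theta> l v = w \<bullet> shifted m \<theta> l Xv
         - (w $ 1 \<bullet> (A *\<^sub>C X' (v $ 4)) + w $ 2 \<bullet> (A *\<^sub>C X' (v $ 3)) + w $ 3 \<bullet> (A *\<^sub>C X' (v $ 2))
             + w $ 4 \<bullet> (A *\<^sub>C X' (v $ 1)))"
        unfolding inner_vec_def sum_4 yk sym shifted_components Xlin Xfo Xvk A_def[symmetric]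
        by (simp add: inner_add_right inner_diff_right)
      also have "\<dots> = g \<bullet> v"
        unfolding w0 by (simp add: inner_vec_def sum_4 g_def vector_4 sym inner_L2_scaleC_right)
      finally show ?thesis .
    qed
    moreover have "y $ k \<in> L2_weighted" for k unfolding yk X_def by (rule cutoff_weighted[OF c])
    ultimately have y: "y \<in> dom_H" "shifted m (- \<theta>) (- l) y = g"
      using shifted_adjoint_regular[of y m \<theta> l g] by auto
    have "norm (X' (cnj A *\<^sub>C w $ k)) \<le> c * norm (w $ k)" for k
      using X'.norm_mult_op_le[of "cnj A *\<^sub>C w $ k"] by (simp add: X'_def norm_scaleC A_def norm_coeffs)
    from this[of 1] this[of 2] this[of 3] this[of 4] have "norm g \<le> c * W"
      using norm_vec_le_sum[of g] unfolding W_def sum_4 by (simp add: g_def vector_4 distrib_left)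
    have "norm (X (w $ k)) \<le> graph_norm y" using norms_le_graph_norm(3)[of y k] by (simp add: yk)
    also have "\<dots> \<le> M * norm g" using M(2)[OF y(1)] by (simp add: y(2))
    also have "\<dots> \<le> M * (c * W)" using M(1) \<open>norm g \<le> c * W\<close> by (intro mult_left_mono) auto
    finally show ?thesis by (simp add: X_def)
  qed
  have "w $ k = 0" for k
  proof (rule cutoff_limit_zero)
    show "norm (mult_op (cutoff (1 / real (Suc n))) (w $ k)) \<le> M * W / real (Suc n)" for n
      using bound[of "1 / real (Suc n)" k] by simp
  qed
  then show ?thesis by (simp add: vec_eq_iff)
qed

lemma bij_betw_shifted:
  assumes \<theta>: "\<bar>\<theta>\<bar> < pi / 2" and l: "l\<^sup>2 \<ge> 2"
  shows "bij_betw (shifted m \<theta> l) dom_H UNIV"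
proof -
  obtain M where M: "M > 0" "\<And>u. u \<in> dom_H \<Longrightarrow> graph_norm u \<le> M * norm (shifted m \<theta> l u)"
    using a_priori[OF \<theta> l] by metis
  have "inj_on (shifted m \<theta> l) dom_H"
  proof (rule inj_onI)
    fix u v assume uv: "u \<in> dom_H" "v \<in> dom_H" "shifted m \<theta> l u = shifted m \<theta> l v"
    have "graph_norm (u - v) \<le> 0"
      using M(2)[OF linear_shifted(4)[OF uv(1,2)]] uv(3) by (simp add: linear_shifted(3)[OF uv(1,2)])
    then have "norm ((u - v) $ k) \<le> 0" for k using norms_le_graph_norm(3)[of "u - v" k] by linarith
    then show "u = v" by (simp add: vec_eq_iff)
  qed
  moreover have "shifted m \<theta> l ` dom_H = UNIV"
  proof -
    define S where "S = shifted m \<theta> l ` dom_H"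
    note L = linear_operator_op_H[of m \<theta>, unfolded linear_operator_def]
    have "subspace S"
    proof (rule subspaceI)
      have "shifted m \<theta> l 0 = 0" using linear_shifted(2)[of 0 0 m \<theta> l 0] L by simp
      then show "0 \<in> S" unfolding S_def using L by (metis imageI)
      show "x + y \<in> S" if "x \<in> S" "y \<in> S" for x y
        using that L unfolding S_def by (auto simp flip: linear_shifted(1))
      show "c *\<^sub>R x \<in> S" if "x \<in> S" for c x
        using that L unfolding S_def by (auto simp flip: scaleC_of_real linear_shifted(2))
    qed
    moreover have "closed S"
      unfolding closed_sequential_limits
    proof (intro allI impI, elim conjE)
      fix Z z assume Z: "\<forall>n. Z n \<in> S" and lim: "Z \<longlonglongrightarrow> z"
      have "\<forall>n. \<exists>x. x \<in> dom_H \<and> Z n = shifted m \<theta> l x" using Z by (auto simp: S_def)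
      then obtain X where X: "\<And>n. X n \<in> dom_H" "\<And>n. Z n = shifted m \<theta> l (X n)" by metis
      have Z_eq: "Z = (\<lambda>n. shifted m \<theta> l (X n))" using X by auto
      have "Cauchy (\<lambda>n. shifted m \<theta> l (X n))" using LIMSEQ_imp_Cauchy[OF lim] by (simp only: Z_eq)
      then obtain u where u: "u \<in> dom_H" "X \<longlonglongrightarrow> u" "(\<lambda>n. op_H m \<theta> (X n)) \<longlonglongrightarrow> op_H m \<theta> u"
        using shifted_Cauchy_limit[where X=X and m=m and l=l, OF \<theta> l X(1)] by auto
      have "Z \<longlonglongrightarrow> shifted m \<theta> l u"
        unfolding Z_eq unfolding shifted_def by (intro tendsto_diff tendsto_scaleC u)
      then have "z = shifted m \<theta> l u" using lim LIMSEQ_unique by blast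
      then show "z \<in> S" using u(1) by (simp add: S_def)
    qed
    ultimately have "x \<in> S" for x
    proof -
      obtain y where y: "y \<in> S" "\<And>z. z \<in> S \<Longrightarrow> (x - y) \<bullet> z = 0"
        using orthogonal_projection[OF \<open>subspace S\<close> \<open>closed S\<close>, of x] by blast
      have "x - y = 0" by (rule orthogonal_range_zero[OF \<theta> l]) (use y(2) in \<open>auto simp: S_def\<close>)
      then show "x \<in> S" using y(1) by simp
    qed
    then show ?thesis unfolding S_def by blast
  qed
  ultimately show ?thesis by (simp add: bij_betw_def)
qed

section \<open>Compactness\<close>

text \<open>One representative for each value of \<open>r\<close> forms a finite net, so total
  boundedness reduces to finding a finite code that determines elements up to
  \<open>e\<close>.\<close>

lemma compact_closure_if_finitely_classified:
  fixes S :: "'a::complete_space set"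
  assumes "\<And>e. e > 0 \<Longrightarrow> \<exists>r::'a \<Rightarrow> 'b. finite (r ` S) \<and> (\<forall>u\<in>S. \<forall>v\<in>S. r u = r v \<longrightarrow> dist u v < e)"
  shows "compact (closure S)"
  unfolding compact_eq_totally_bounded
proof (intro conjI allI impI)
  show "complete (closure S)" by (simp add: complete_eq_closed)
  fix e :: real assume "e > 0"
  then obtain r :: "'a \<Rightarrow> 'b" where r: "finite (r ` S)" "\<And>u v. u \<in> S \<Longrightarrow> v \<in> S \<Longrightarrow> r u = r v
      \<Longrightarrow> dist u v < e / 2"
    using assms[of "e / 2"] by auto
  define k where "k = inv_into S r ` (r ` S)"
  have k: "finite k" using r(1) by (simp add: k_def)
  have "S \<subseteq> (\<Union>x\<in>k. cball x (e / 2))"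
  proof
    fix u assume u: "u \<in> S"
    have "inv_into S r (r u) \<in> S" "r (inv_into S r (r u)) = r u"
      using u by (auto intro: inv_into_into f_inv_into_f)
    then have "u \<in> cball (inv_into S r (r u)) (e / 2)" using r(2)[OF _ u] by (simp add: less_imp_le)
    then show "u \<in> (\<Union>x\<in>k. cball x (e / 2))" using u by (auto simp: k_def)
  qed
  then have "closure S \<subseteq> (\<Union>x\<in>k. cball x (e / 2))"
    using k by (intro closure_minimal closed_UN) auto
  also have "\<dots> \<subseteq> (\<Union>x\<in>k. ball x e)" using \<open>e > 0\<close> by (intro UN_mono) (auto simp: subset_eq)
  finally show "\<exists>k. finite k \<and> closure S \<subseteq> (\<Union>x\<in>k. ball x e)" using k by blast
qed

definition domD_ball :: "real \<Rightarrow> L2 set" where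
  "domD_ball B = {u \<in> domD. norm u \<le> B \<and> norm (weak_derivative u) \<le> B \<and> norm (position u) \<le> B}"

text \<open>If |f(0)| exceeded 2B, the Hoelder estimate would keep |f| at or above |f(0)| - B > B on
  [0, 1], and the norm of \<open>f\<close> would exceed B.\<close>

lemma ac_pointwise_bound:
  assumes f: "has_ac_derivative f g" "sq_integrable f" "sq_integrable g"
    and B: "norm (abs_L2 f) \<le> B" "norm (abs_L2 g) \<le> B"
  shows "norm (f x) \<le> (2 + sqrt \<bar>x\<bar>) * B"
proof -
  have hoelder: "norm (f y - f x) \<le> sqrt \<bar>y - x\<bar> * B" for x y
    using has_ac_derivative_Hoelder[OF f(1,3), of y x] mult_left_mono[OF B(2), of "sqrt \<bar>y - x\<bar>"]
      by simp
  have B0: "B \<ge> 0" using B(1) norm_ge_zero order_trans by blast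
  have "norm (f 0) \<le> 2 * B"
  proof (rule ccontr)
    assume "\<not> norm (f 0) \<le> 2 * B"
    then have k: "norm (f 0) - B > B" by simp
    have i: "integrable lborel (\<lambda>x. (norm (f x))\<^sup>2)" using f(2) by (simp add: sq_integrable_def)
    have "(norm (f 0) - B)\<^sup>2 = (\<integral>x. indicat_real {0..1::real} x *\<^sub>R (norm (f 0) - B)\<^sup>2 \<partial>lborel)"
      by simp
    also have "\<dots> \<le> (\<integral>x. (norm (f x))\<^sup>2 \<partial>lborel)"
    proof (rule integral_mono[OF _ i])
      show "integrable lborel (\<lambda>x. indicat_real {0..1::real} x *\<^sub>R (norm (f 0) - B)\<^sup>2)"
        by (intro integrable_scaleR_left integrable_real_indicator) auto
      fix x
      show "indicat_real {0..1::real} x *\<^sub>R (norm (f 0) - B)\<^sup>2 \<le> (norm (f x))\<^sup>2"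
      proof (cases "x \<in> {0..1}")
        case True
        then have "sqrt \<bar>0 - x\<bar> * B \<le> 1 * B" using B0 by (intro mult_right_mono) auto
        then have "norm (f 0) - B \<le> norm (f x)"
          using hoelder[of 0 x] norm_triangle_ineq2[of "f 0" "f x"] by simp
        then have "(norm (f 0) - B)\<^sup>2 \<le> (norm (f x))\<^sup>2" using k B0 by (intro power_mono) auto
        then show ?thesis using True by simp
      qed simp
    qed
    also have "\<dots> = (norm (abs_L2 f))\<^sup>2" using f(2) by (simp only: norm_abs_L2)
    also have "\<dots> \<le> B\<^sup>2" using B(1) by (intro power_mono) auto
    finally have "norm (f 0) - B \<le> B" using B0 by (rule power2_le_imp_le)
    then show False using k by simp
  qed
  moreover have "norm (f x) \<le> norm (f 0) + sqrt \<bar>x\<bar> * B"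
    using hoelder[of x 0] norm_triangle_ineq2[of "f x" "f 0"] by simp
  ultimately show ?thesis by (simp add: distrib_right)
qed

text \<open>Where |x| > R, |f|^2 is at most |x f|^2 / R^2; where |x| \<le> R, the uniform bound is
  integrated over length 2R.\<close>

lemma norm_sq_le_local_plus_tail:
  assumes f: "sq_integrable f" "sq_integrable (\<lambda>x. of_real x * f x)" and R: "R > 0"
    and loc: "\<And>x. \<bar>x\<bar> \<le> R \<Longrightarrow> norm (f x) \<le> \<kappa>"
  shows "(norm (abs_L2 f))\<^sup>2 \<le> 2 * R * \<kappa>\<^sup>2 + (norm (abs_L2 (\<lambda>x. of_real x * f x)))\<^sup>2 / R\<^sup>2"
proof -
  have i: "integrable lborel (\<lambda>x. (norm (of_real x * f x))\<^sup>2)" using f(2)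
    by (simp add: sq_integrable_def)
  have i1: "integrable lborel (\<lambda>x. indicat_real {-R..R} x *\<^sub>R \<kappa>\<^sup>2)"
    using R by (intro integrable_scaleR_left integrable_real_indicator) auto
  have i2: "integrable lborel (\<lambda>x. (norm (of_real x * f x))\<^sup>2 / R\<^sup>2)" using i by simp
  have "(norm (abs_L2 f))\<^sup>2 = (\<integral>x. (norm (f x))\<^sup>2 \<partial>lborel)" by (rule norm_abs_L2[OF f(1)])
  also have "\<dots> \<le> (\<integral>x. indicat_real {-R..R} x *\<^sub>R \<kappa>\<^sup>2 + (norm (of_real x * f x))\<^sup>2 / R\<^sup>2 \<partial>lborel)"
  proof (rule integral_mono)
    show "integrable lborel (\<lambda>x. (norm (f x))\<^sup>2)" using f(1) by (simp add: sq_integrable_def)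
    show "integrable lborel (\<lambda>x. indicat_real {-R..R} x *\<^sub>R \<kappa>\<^sup>2 + (norm (of_real x * f x))\<^sup>2 / R\<^sup>2)"
      by (rule Bochner_Integration.integrable_add[OF i1 i2])
    fix x
    show "(norm (f x))\<^sup>2 \<le> indicat_real {-R..R} x *\<^sub>R \<kappa>\<^sup>2 + (norm (of_real x * f x))\<^sup>2 / R\<^sup>2"
    proof (cases "\<bar>x\<bar> \<le> R")
      case True
      then have "(norm (f x))\<^sup>2 \<le> \<kappa>\<^sup>2" using loc by (intro power_mono) auto
      moreover have "indicat_real {-R..R} x = 1" using True by (auto simp: indicator_def)
      ultimately show ?thesis by (simp add: add_increasing2)
    next
      case False
      then have "R\<^sup>2 \<le> x\<^sup>2" using R by (simp add: abs_le_square_iff[symmetric])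
      then have "R\<^sup>2 * (norm (f x))\<^sup>2 \<le> x\<^sup>2 * (norm (f x))\<^sup>2" by (intro mult_right_mono) auto
      then have "(norm (f x))\<^sup>2 \<le> (norm (of_real x * f x))\<^sup>2 / R\<^sup>2"
        using R by (simp add: norm_mult power_mult_distrib pos_le_divide_eq mult.commute)
      moreover have "0 \<le> indicat_real {-R..R} x *\<^sub>R \<kappa>\<^sup>2" by simp
      ultimately show ?thesis by linarith
    qed
  qed
  also have "\<dots> = 2 * R * \<kappa>\<^sup>2 + (norm (abs_L2 (\<lambda>x. of_real x * f x)))\<^sup>2 / R\<^sup>2"
    using R by (simp only: Bochner_Integration.integral_add[OF i1 i2] norm_abs_L2[OF f(2)]) simp
  finally show ?thesis .
qed

text \<open>A quantitative Arzela-Ascoli argument: the code of an element consists of the rounded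
  values of its continuous representative on a finite grid. The pointwise bound leaves finitely many
  codes, and Hoelder continuity spreads closeness from the grid to the interval.\<close>

lemma domD_ball_finitely_classified:
  assumes e: "e > 0"
  shows "\<exists>r::L2 \<Rightarrow> (real \<Rightarrow> int \<times> int). finite (r ` domD_ball B) \<and>
    (\<forall>u\<in>domD_ball B. \<forall>v\<in>domD_ball B. r u = r v \<longrightarrow> dist u v < e)"
proof -
  define ok where "ok u f g \<longleftrightarrow> has_ac_derivative f g \<and> sq_integrable f \<and> sq_integrable g
      \<and> sq_integrable (\<lambda>x. of_real x * f x)
     \<and> u = abs_L2 f \<and> norm (abs_L2 f) \<le> B \<and> norm (abs_L2 g) \<le> B
         \<and> norm (abs_L2 (\<lambda>x. of_real x * f x)) \<le> B" for u f g
  have "\<exists>f g. ok u f g" if u: "u \<in> domD_ball B" for u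
  proof -
    have uD: "u \<in> domD" and n: "norm u \<le> B" "norm (weak_derivative u) \<le> B" "norm (position u) \<le> B"
      using u by (simp_all add: domD_ball_def)
    obtain f g where f: "has_ac_derivative f g" "sq_integrable f" "sq_integrable g"
        "sq_integrable (\<lambda>x. of_real x * f x)"
      "u = abs_L2 f" "weak_derivative u = abs_L2 g" "position u = abs_L2 (\<lambda>x. of_real x * f x)"
      using domD_cases[OF uD] .
    note n' = n(1)[unfolded f(5)] n(2)[unfolded f(6)] n(3)[unfolded f(7)]
    have "ok u f g" unfolding ok_def by (intro conjI f n')
    then show ?thesis by blast
  qed
  then obtain F G where ok: "\<And>u. u \<in> domD_ball B \<Longrightarrow> ok u (F u) (G u)" by metis
  note FG = ok[unfolded ok_def]
  show ?thesis
  proof (cases "domD_ball B = {}")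
    case False
    then obtain u0 where "u0 \<in> domD_ball B" by blast
    then have B0: "B \<ge> 0" using order_trans[OF norm_ge_zero[of u0], of B] by (auto simp: domD_ball_def)
    \<comment> \<open>\<open>R\<close> makes the tail small, then \<open>\<kappa>\<close> the contribution of \<open>[-R, R]\<close>; part of \<open>\<kappa>\<close> is spent
       on the mesh \<open>\<delta>\<close> of the grid through the Hoelder estimate, part on the rounding of the values.\<close>
    define R where "R = 4 * (B + 1) / e"
    have R: "R > 0" using e B0 by (simp add: R_def)
    define \<kappa> where "\<kappa> = e / (2 * sqrt R)"
    have \<kappa>: "\<kappa> > 0" using e R by (simp add: \<kappa>_def)
    define \<delta> where "\<delta> = (\<kappa> / (8 * (B + 1)))\<^sup>2"
    have \<delta>: "\<delta> > 0" using \<kappa> B0 by (simp add: \<delta>_def)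
    have sqrt_\<delta>: "2 * (sqrt \<delta> * B) \<le> \<kappa> / 4"
    proof -
      have "sqrt \<delta> = \<kappa> / (8 * (B + 1))" using \<kappa> B0 by (simp add: \<delta>_def)
      moreover have "\<kappa> / (8 * (B + 1)) * B \<le> \<kappa> / (8 * (B + 1)) * (B + 1)" using \<kappa> B0
        by (intro mult_left_mono) auto
      moreover have "\<kappa> / (8 * (B + 1)) * (B + 1) = \<kappa> / 8" using B0 by (simp add: field_simps)
      ultimately have "sqrt \<delta> * B \<le> \<kappa> / 8" by (simp only:)
      then show ?thesis by simp
    qed
    obtain P where P: "finite P" "{-R..R} \<subseteq> (\<Union>x\<in>P. ball x \<delta>)"
      using compact_Icc[of "-R" R] \<delta> unfolding compact_eq_totally_bounded by blast
    define q where "q z = (\<lfloor>Re z / (\<kappa> / 8)\<rfloor>, \<lfloor>Im z / (\<kappa> / 8)\<rfloor>)" for z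
    \<comment> \<open>The restriction to \<open>P\<close> matters: codes are
      \<open>undefined\<close> elsewhere, so they lie in a finite \<open>PiE\<close>.\<close>
    define r where "r u = (\<lambda>p\<in>P. q (F u p))" for u
    have q: "norm (z - w) \<le> \<kappa> / 4" if "q z = q w" for z w
    proof -
      have fl: "\<bar>a - b\<bar> \<le> \<kappa> / 8" if "\<lfloor>a / (\<kappa> / 8)\<rfloor> = \<lfloor>b / (\<kappa> / 8)\<rfloor>" for a b
      proof -
        have "\<bar>a / (\<kappa> / 8) - b / (\<kappa> / 8)\<bar> \<le> 1" using that by linarith
        then have "\<bar>(a - b) / (\<kappa> / 8)\<bar> \<le> 1" by (simp only: diff_divide_distrib)
        then have "\<bar>a - b\<bar> / \<bar>\<kappa> / 8\<bar> \<le> 1" by (simp only: abs_divide[of "a - b" "\<kappa> / 8"])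
        moreover have "\<bar>\<kappa> / 8\<bar> > 0" using \<kappa> by simp
        ultimately have "\<bar>a - b\<bar> \<le> 1 * \<bar>\<kappa> / 8\<bar>" by (simp only: pos_divide_le_eq)
        then show ?thesis using \<kappa> by simp
      qed
      have "norm (z - w) \<le> \<bar>Re (z - w)\<bar> + \<bar>Im (z - w)\<bar>" by (rule cmod_le)
      also have "\<dots> \<le> \<kappa> / 8 + \<kappa> / 8" using that fl[of "Re z" "Re w"] fl[of "Im z" "Im w"]
        by (simp add: q_def)
      finally show ?thesis by simp
    qed
    have "finite (r ` domD_ball B)"
    proof (rule finite_subset)
      \<comment> \<open>One bound for all grid points: the pointwise bounds are nonnegative, so
        their sum dominates each.\<close>
      define N where "N = (\<Sum>p\<in>P. (2 + sqrt \<bar>p\<bar>) * B)"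
      define K where "K = \<lceil>N / (\<kappa> / 8)\<rceil> + 1"
      show "finite (PiE P (\<lambda>_. {-K..K} \<times> {-K..K}))" using P(1) by (intro finite_PiE) auto
      show "r ` domD_ball B \<subseteq> PiE P (\<lambda>_. {-K..K} \<times> {-K..K})"
      proof (intro image_subsetI)
        fix u assume u: "u \<in> domD_ball B"
        have "q (F u p) \<in> {-K..K} \<times> {-K..K}" if p: "p \<in> P" for p
        proof -
          have "norm (F u p) \<le> (2 + sqrt \<bar>p\<bar>) * B" using FG[OF u]
            by (intro ac_pointwise_bound[of _ "G u"]) auto
          also have "\<dots> \<le> N" unfolding N_def using P(1) p B0 by (intro member_le_sum) auto
          finally have n: "\<bar>Re (F u p)\<bar> \<le> N" "\<bar>Im (F u p)\<bar> \<le> N"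
            using abs_Re_le_cmod[of "F u p"] abs_Im_le_cmod[of "F u p"] by linarith+
          have "-K \<le> \<lfloor>a / (\<kappa> / 8)\<rfloor> \<and> \<lfloor>a / (\<kappa> / 8)\<rfloor> \<le> K" if "\<bar>a\<bar> \<le> N" for a
          proof -
            have "\<bar>a / (\<kappa> / 8)\<bar> \<le> N / (\<kappa> / 8)" using that \<kappa> by (simp add: abs_divide divide_right_mono)
            then show ?thesis unfolding K_def by linarith
          qed
          then show ?thesis using n by (simp add: q_def)
        qed
        then show "r u \<in> PiE P (\<lambda>_. {-K..K} \<times> {-K..K})" by (simp add: r_def restrict_PiE_iff)
      qed
    qed
    moreover have "dist u v < e" if u: "u \<in> domD_ball B" and v: "v \<in> domD_ball B" and ruv: "r u
        = r v" for u v
    proof -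
      note Fu = FG[OF u] and Fv = FG[OF v]
      define f where "f x = F u x - F v x" for x
      have s: "sq_integrable f" unfolding f_def[abs_def] using Fu Fv by (intro sq_integrable_diff) auto
      have xe: "(\<lambda>x. of_real x * f x) = (\<lambda>x. of_real x * F u x - of_real x * F v x)"
        by (simp add: f_def fun_eq_iff right_diff_distrib)
      have sx: "sq_integrable (\<lambda>x. of_real x * f x)" unfolding xe using Fu Fv
        by (intro sq_integrable_diff) auto
      have uv: "u - v = abs_L2 f"
        using Fu Fv diff_abs_L2[of "F u" "F v"] unfolding f_def[abs_def] by metis
      have "abs_L2 (\<lambda>x. of_real x * f x) = abs_L2 (\<lambda>x. of_real x * F u x)
          - abs_L2 (\<lambda>x. of_real x * F v x)"
        unfolding xe using Fu Fv by (intro diff_abs_L2[symmetric]) auto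
      then have tail: "norm (abs_L2 (\<lambda>x. of_real x * f x)) \<le> 2 * B"
        using Fu Fv norm_triangle_ineq4[of "abs_L2 (\<lambda>x. of_real x * F u x)"
            "abs_L2 (\<lambda>x. of_real x * F v x)"] by simp
      have loc: "norm (f x) \<le> \<kappa>" if x: "\<bar>x\<bar> \<le> R" for x
      proof -
        have "x \<in> {-R..R}" using x by auto
        then obtain p where p: "p \<in> P" "x \<in> ball p \<delta>" using P(2) by blast
        have hl: "norm (F w x - F w p) \<le> sqrt \<delta> * B" if "w \<in> domD_ball B" for w
        proof -
          have "norm (F w x - F w p) \<le> sqrt \<bar>x - p\<bar> * norm (abs_L2 (G w))"
            using FG[OF that] by (intro has_ac_derivative_Hoelder) auto
          also have "\<dots> \<le> sqrt \<delta> * B"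
            using p(2) FG[OF that] by (intro mult_mono) (auto simp: dist_real_def)
          finally show ?thesis .
        qed
        have "q (F u p) = q (F v p)" using fun_cong[OF ruv, of p] p(1) by (simp add: r_def)
        then have "norm (F u p - F v p) \<le> \<kappa> / 4" by (rule q)
        moreover have fx: "f x = (F u x - F u p) - (F v x - F v p) + (F u p - F v p)"
          by (simp add: f_def)
        have "norm (f x) \<le> norm (F u x - F u p) + norm (F v x - F v p) + norm (F u p - F v p)"
          unfolding fx by (rule order_trans[OF norm_triangle_ineq add_right_mono[OF norm_triangle_ineq4]])
        ultimately show ?thesis using hl[OF u] hl[OF v] sqrt_\<delta> \<kappa> by linarith
      qed
      \<comment> \<open>With the chosen \<kappa> the local part is e^2/2, and \<open>R\<close>,
        built from B + 1 so as to be positive, keeps the tail at most e^2/4; their sum is strictly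
        below e^2.\<close>
      have "(norm (u - v))\<^sup>2 \<le> 2 * R * \<kappa>\<^sup>2 + (norm (abs_L2 (\<lambda>x. of_real x * f x)))\<^sup>2 / R\<^sup>2"
        unfolding uv by (rule norm_sq_le_local_plus_tail[OF s sx R loc])
      also have "\<dots> \<le> 2 * R * \<kappa>\<^sup>2 + (2 * B)\<^sup>2 / R\<^sup>2"
        using tail by (intro add_left_mono divide_right_mono power_mono) auto
      also have "2 * R * \<kappa>\<^sup>2 = e\<^sup>2 / 2" using R
        by (simp add: \<kappa>_def power_divide power_mult_distrib field_simps)
      also have "(2 * B)\<^sup>2 / R\<^sup>2 \<le> (e / 2)\<^sup>2"
      proof -
        have "2 * B / R = e / 2 * (B / (B + 1))" using e B0 by (simp add: R_def field_simps)
        also have "\<dots> \<le> e / 2 * 1" using e B0 by (intro mult_left_mono) auto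
        finally show ?thesis unfolding power_divide[symmetric] using B0 R by (intro power_mono) auto
      qed
      finally have "(norm (u - v))\<^sup>2 \<le> e\<^sup>2 / 2 + (e / 2)\<^sup>2" by simp
      also have "\<dots> < e\<^sup>2" using e by (simp add: power_divide)
      finally have "norm (u - v) < e" by (rule power2_less_imp_less) (use e in simp)
      then show ?thesis by (simp add: dist_norm)
    qed
    ultimately show ?thesis by blast
  qed simp
qed

text \<open>The four components are coded separately, each to accuracy e/4.\<close>

lemma compact_closure_graph_bounded:
  assumes S: "S \<subseteq> dom_H" and B: "\<And>u. u \<in> S \<Longrightarrow> graph_norm u \<le> B"
  shows "compact (closure S)"
proof (rule compact_closure_if_finitely_classified)
  fix e :: real assume e: "e > 0"
  have Sk: "u $ k \<in> domD_ball B" if "u \<in> S" for u k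
    using S B[OF that] norms_le_graph_norm[of u k] that by (fastforce simp: domD_ball_def dom_H_def)
  obtain r :: "L2 \<Rightarrow> real \<Rightarrow> int \<times> int" where r: "finite (r ` domD_ball B)"
     "\<And>u v. u \<in> domD_ball B \<Longrightarrow> v \<in> domD_ball B \<Longrightarrow> r u = r v \<Longrightarrow> dist u v < e / 4"
    using domD_ball_finitely_classified[of "e / 4" B] e by auto
  define rr where "rr u = (r (u $ 1), r (u $ 2), r (u $ 3), r (u $ 4))" for u :: "L2 ^ 4"
  show "\<exists>r :: L2 ^ 4 \<Rightarrow> (real \<Rightarrow> int \<times> int) \<times> (real \<Rightarrow> int \<times> int) \<times> (real \<Rightarrow> int \<times> int) \<times> (real \<Rightarrow> int \<times> int).
     finite (r ` S) \<and> (\<forall>u\<in>S. \<forall>v\<in>S. r u = r v \<longrightarrow> dist u v < e)"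
  proof (intro exI conjI ballI impI)
    show "finite (rr ` S)"
    proof (rule finite_subset)
      show "rr ` S \<subseteq> r ` domD_ball B \<times> r ` domD_ball B \<times> r ` domD_ball B \<times> r ` domD_ball B"
        using Sk by (auto simp: rr_def)
    qed (use r(1) in simp)
    fix u v assume uv: "u \<in> S" "v \<in> S" "rr u = rr v"
    have "norm (u - v) \<le> (\<Sum>k\<in>UNIV. norm ((u - v) $ k))" by (rule norm_vec_le_sum)
    also have "\<dots> < e"
      using r(2)[OF Sk[OF uv(1)] Sk[OF uv(2)]] uv(3) unfolding sum_4
      by (simp add: rr_def dist_norm) (smt (verit) field_sum_of_halves)
    finally show "dist u v < e" by (simp add: dist_norm)
  qed
qed

section \<open>The resolvent\<close>

text \<open>Bijectivity is the only hypothesis, so the lemma serves both to show that 2i is in the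
  resolvent set and to treat arbitrary points of that set.\<close>

lemma resolvent_props:
  assumes bij: "bij_betw (\<lambda>u. op_H m \<theta> u - z *\<^sub>C u) dom_H UNIV"
  shows "resolvent dom_H (op_H m \<theta>) z f \<in> dom_H"
    "op_H m \<theta> (resolvent dom_H (op_H m \<theta>) z f) - z *\<^sub>C resolvent dom_H (op_H m \<theta>) z f = f"
    "linear_operator UNIV (resolvent dom_H (op_H m \<theta>) z)"
proof -
  define K where "K u = op_H m \<theta> u - z *\<^sub>C u" for u
  define R where "R = resolvent dom_H (op_H m \<theta>) z"
  have R_def': "R = the_inv_into dom_H K" by (simp add: R_def resolvent_def K_def[abs_def])
  have bij: "inj_on K dom_H" "K ` dom_H = UNIV" using bij by (simp_all add: bij_betw_def K_def[abs_def])
  have Rd: "R f \<in> dom_H" for f unfolding R_def'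
    by (rule the_inv_into_into[OF bij(1)]) (use bij(2) in auto)
  have KR: "K (R f) = f" for f unfolding R_def'
    by (rule f_the_inv_into_f[OF bij(1)]) (use bij(2) in auto)
  have eqI: "R f = u" if "u \<in> dom_H" "K u = f" for u f
    using inj_onD[OF bij(1), of "R f" u] that Rd KR by simp
  show "resolvent dom_H (op_H m \<theta>) z f \<in> dom_H" using Rd unfolding R_def .
  show "op_H m \<theta> (resolvent dom_H (op_H m \<theta>) z f) - z *\<^sub>C resolvent dom_H (op_H m \<theta>) z f = f"
    using KR unfolding R_def K_def .
  note L = linear_operator_op_H[of m \<theta>, unfolded linear_operator_def]
  have "R (f + g) = R f + R g" for f g
    by (rule eqI) (use L Rd KR in \<open>simp_all add: K_def scaleC_add_right algebra_simps\<close>)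
  moreover have "R (c *\<^sub>C f) = c *\<^sub>C R f" for c f
  proof (rule eqI)
    show "c *\<^sub>C R f \<in> dom_H" using L Rd by blast
    have "K (c *\<^sub>C R f) = c *\<^sub>C K (R f)"
      using L Rd by (simp add: K_def scaleC_diff_right scaleC_scaleC mult.commute)
    then show "K (c *\<^sub>C R f) = c *\<^sub>C f" by (simp add: KR)
  qed
  ultimately show "linear_operator UNIV (resolvent dom_H (op_H m \<theta>) z)"
    unfolding linear_operator_def R_def by simp
qed

lemma resolvent_set_nonempty:
  assumes \<theta>: "\<bar>\<theta>\<bar> < pi / 2"
  shows "\<i> * of_real 2 \<in> resolvent_set dom_H (op_H m \<theta>)"
proof -
  define z where "z = \<i> * complex_of_real 2"
  have K: "shifted m \<theta> 2 = (\<lambda>u. op_H m \<theta> u - z *\<^sub>C u)" by (simp add: shifted_def[abs_def] z_def)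
  have bij: "bij_betw (\<lambda>u. op_H m \<theta> u - z *\<^sub>C u) dom_H UNIV"
    using bij_betw_shifted[OF \<theta>, of 2 m] unfolding K by simp
  note R = resolvent_props[OF bij]
  obtain M where M: "M > 0" "\<And>u. u \<in> dom_H \<Longrightarrow> graph_norm u \<le> M * norm (shifted m \<theta> 2 u)"
    using a_priori[OF \<theta>, of 2 m] by auto
  have "bounded_linear (resolvent dom_H (op_H m \<theta>) z)"
  proof (rule bounded_linear_intro)
    show "resolvent dom_H (op_H m \<theta>) z (f + g) = resolvent dom_H (op_H m \<theta>) z f
        + resolvent dom_H (op_H m \<theta>) z g" for f g
      using R(3) unfolding linear_operator_def by simp
    show "resolvent dom_H (op_H m \<theta>) z (r *\<^sub>R f) = r *\<^sub>R resolvent dom_H (op_H m \<theta>) z f" for r f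
      using R(3) unfolding linear_operator_def by (simp flip: scaleC_of_real)
    fix f
    define u where "u = resolvent dom_H (op_H m \<theta>) z f"
    have "norm u \<le> (\<Sum>k\<in>UNIV. norm (u $ k))" by (rule norm_vec_le_sum)
    also have "\<dots> \<le> graph_norm u" unfolding graph_norm_def by (intro sum_mono) simp
    also have "\<dots> \<le> M * norm (shifted m \<theta> 2 u)" unfolding u_def by (rule M(2)[OF R(1)])
    also have "shifted m \<theta> 2 u = f" unfolding K u_def by (rule R(2))
    finally show "norm (resolvent dom_H (op_H m \<theta>) z f) \<le> norm f * M" by (simp add: u_def mult.commute)
  qed
  then show ?thesis using bij by (simp add: resolvent_set_def z_def)
qed

text \<open>The estimate is available at 2i, not at \<open>z\<close>. Writing (H - 2i)u = f + (z -
  2i)u for u = R f and using that \<open>R\<close> is bounded transfers the graph norm bound to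
  every \<open>z\<close>.\<close>

lemma compact_resolvent:
  assumes \<theta>: "\<bar>\<theta>\<bar> < pi / 2" and z: "z \<in> resolvent_set dom_H (op_H m \<theta>)"
  shows "compact_operator (resolvent dom_H (op_H m \<theta>) z)"
  unfolding compact_operator_def
proof (intro conjI allI impI)
  define R where "R = resolvent dom_H (op_H m \<theta>) z"
  have bij: "bij_betw (\<lambda>u. op_H m \<theta> u - z *\<^sub>C u) dom_H UNIV" and bl: "bounded_linear R"
    using z by (simp_all add: resolvent_set_def R_def)
  note R = resolvent_props[OF bij, folded R_def]
  show "linear_operator UNIV (resolvent dom_H (op_H m \<theta>) z)" using R(3) unfolding R_def .
  fix S :: "(L2 ^ 4) set" assume "bounded S"
  then obtain b where b: "\<And>f. f \<in> S \<Longrightarrow> norm f \<le> b" unfolding bounded_iff by blast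
  obtain C where C: "C > 0" "\<And>f. norm (R f) \<le> norm f * C" using bounded_linear.pos_bounded[OF bl]
    by blast
  obtain M where M: "M > 0" "\<And>u. u \<in> dom_H \<Longrightarrow> graph_norm u \<le> M * norm (shifted m \<theta> 2 u)"
    using a_priori[OF \<theta>, of 2 m] by auto
  show "compact (closure (resolvent dom_H (op_H m \<theta>) z ` S))"
    unfolding R_def[symmetric]
  proof (rule compact_closure_graph_bounded)
    show "R ` S \<subseteq> dom_H" using R(1) by blast
    fix u assume "u \<in> R ` S"
    then obtain f where f: "f \<in> S" "u = R f" by blast
    have "shifted m \<theta> 2 u = f + (z - \<i> * of_real 2) *\<^sub>C u"
    proof -
      have "(z - \<i> * of_real 2) *\<^sub>C u = z *\<^sub>C u - (\<i> * of_real 2) *\<^sub>C u"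
        using scaleC_add_left[of z "- (\<i> * of_real 2)" u] by (simp add: scaleC_minus_left)
      then show ?thesis using R(2)[of f] unfolding shifted_def f(2) by (simp add: algebra_simps)
    qed
    then have "norm (shifted m \<theta> 2 u) \<le> norm f + norm (z - \<i> * of_real 2) * norm u"
      using norm_triangle_ineq[of f "(z - \<i> * of_real 2) *\<^sub>C u"] by (simp add: norm_scaleC)
    also have "\<dots> \<le> b + norm (z - \<i> * of_real 2) * (b * C)"
    proof (intro add_mono mult_left_mono)
      show "norm u \<le> b * C"
          using order_trans[OF C(2)[of f] mult_right_mono[OF b[OF f(1)], of C]] C(1) f(2) by simp
    qed (use b f in auto)
    finally have "M * norm (shifted m \<theta> 2 u) \<le> M * (b + norm (z - \<i> * of_real 2) * (b * C))"
      using M(1) by (intro mult_left_mono) auto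
    moreover have "u \<in> dom_H" using R(1) f(2) by simp
    ultimately show "graph_norm u \<le> M * (b + norm (z - \<i> * of_real 2) * (b * C))"
      using M(2) order_trans by blast
  qed
qed

theorem theorem3p2:
  fixes m \<theta> :: real
  assumes "m \<ge> 0" and "\<bar>\<theta>\<bar> < pi / 2"
  shows "closed_operator dom_H (op_H m \<theta>) \<and> has_compact_resolvent dom_H (op_H m \<theta>)"
  using assms(2) closed_operator_op_H resolvent_set_nonempty compact_resolvent
  unfolding has_compact_resolvent_def by blast

end
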